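(* Let $N\ge 2$, let $\Omega\subset\mathbb{R}^N$ be a bounded domain and let $k$ be a positive integer with $k<N$. For $p>0$ consider the Dirichlet problem $$(\mathrm{D}_p)\qquad u>0,\quad \mathcal{P}^-_k(D^2u)+u^p=0\ \text{ in }\Omega,\qquad u=0\ \text{ on }\partial\Omega .$$ (1) If $p\ge 1$, then there are no subsolutions of $(\mathrm{D}_p)$. (2) If $p\in(0,1)$ and $\Omega\in\mathcal{C}_R$, then there exists a unique solution $U\in C(\overline\Omega)$ of $(\mathrm{D}_p)$. Moreover, for every $x_0\in\partial\Omega$ and every $q<\frac{1}{1-p}$, $$\lim_{x\to x_0}\frac{U(x)-U(x_0)}{|x-x_0|^q}=0 ,$$ where the limit is taken over $x\in\Omega$.
   Context: For a real symmetric $N\times N$ matrix $X$ with eigenvalues $\lambda_1(X)\le\dots\le\lambda_N(X)$, $\mathcal{P}^-_k(X)=\sum_{i=1}^k\lambda_i(X)$. Solutions are understood in the viscosity sense. A nonnegative $u\in USC(\Omega)$ is a subsolution of $\mathcal{P}^-_k(D^2u)+u^p=0$ in $\Omega$ if, whenever $\varphi\in C^2(\Omega)$ and $u-\varphi$ has a local maximum at $x_0\in\Omega$, one has $\mathcal{P}^-_k(D^2\varphi(x_0))+u(x_0)^p\ge 0$. A nonnegative $u\in LSC(\Omega)$ is a supersolution if the reverse inequality holds whenever $u-\varphi$ has a local minimum at $x_0$. A solution is a continuous function that is both. A subsolution of $(\mathrm{D}_p)$ is a function $u\in USC(\overline\Omega)$ that is strictly positive in $\Omega$, is a subsolution of the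 equation in $\Omega$, and satisfies $u\le 0$ on $\partial\Omega$. A solution of $(\mathrm{D}_p)$ is a function $u\in C(\overline\Omega)$, strictly positive in $\Omega$, that solves the equation in $\Omega$ and vanishes on $\partial\Omega$. $\Omega\in\mathcal{C}_R$ means that there exist $R>0$ and a subset $Y\subseteq\mathbb{R}^N$ (depending on $\Omega$) such that $\Omega=\bigcap_{y\in Y}B_R(y)$, where $B_R(y)$ is the open ball of radius $R$ centered at $y$. *)

theory Defs
  imports "HOL-Analysis.Analysis" "HOL-Computational_Algebra.Polynomial"
begin

definition charpoly :: "real ^ 'n ^ 'n \<Rightarrow> real poly" where
  "charpoly X = det (\<chi> i j. [:- (X $ i $ j), if i = j then 1 else 0:])"

text \<open>The \<open>i\<close>-th smallest eigenvalue, counted with multiplicity and with \<open>i\<close> running from 1 to \<open>N\<close>.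
  It is meant for symmetric \<open>X\<close>: only then are there always \<open>N\<close> real roots.\<close>

definition eigval :: "real ^ 'n ^ 'n \<Rightarrow> nat \<Rightarrow> real" where
  "eigval X i = sorted_list_of_multiset (proots (charpoly X)) ! (i - 1)"

definition P_minus :: "nat \<Rightarrow> real ^ 'n ^ 'n \<Rightarrow> real" where
  "P_minus k X = (\<Sum>i = 1..k. eigval X i)"

definition usc_on :: "'a::topological_space set \<Rightarrow> ('a \<Rightarrow> real) \<Rightarrow> bool" where
  "usc_on S u \<longleftrightarrow> (\<forall>x\<in>S. \<forall>a > u x. \<forall>\<^sub>F y in at x within S. u y < a)"

definition lsc_on :: "'a::topological_space set \<Rightarrow> ('a \<Rightarrow> real) \<Rightarrow> bool" where
  "lsc_on S u \<longleftrightarrow> (\<forall>x\<in>S. \<forall>a < u x. \<forall>\<^sub>F y in at x within S. a < u y)"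

definition local_max_at :: "'a::topological_space set \<Rightarrow> ('a \<Rightarrow> real) \<Rightarrow> 'a \<Rightarrow> bool" where
  "local_max_at S f x0 \<longleftrightarrow> x0 \<in> S \<and> (\<forall>\<^sub>F x in at x0 within S. f x \<le> f x0)"

definition local_min_at :: "'a::topological_space set \<Rightarrow> ('a \<Rightarrow> real) \<Rightarrow> 'a \<Rightarrow> bool" where
  "local_min_at S f x0 \<longleftrightarrow> x0 \<in> S \<and> (\<forall>\<^sub>F x in at x0 within S. f x0 \<le> f x)"

text \<open>For open \<open>S\<close>: \<open>\<phi>\<close> is of class C2 on \<open>S\<close>, with gradient \<open>g\<close> and Hessian matrix \<open>H\<close>; both are
  uniquely determined on \<open>S\<close>.\<close>

definition C2_on ::
    "(real ^ 'n) set \<Rightarrow> (real ^ 'n \<Rightarrow> real) \<Rightarrow> (real ^ 'n \<Rightarrow> real ^ 'n) \<Rightarrow> (real ^ 'n \<Rightarrow> real ^ 'n ^ 'n) \<Rightarrow> bool"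
  where
  "C2_on S \<phi> g H \<longleftrightarrow>
     (\<forall>x\<in>S. (\<phi> has_derivative (\<lambda>h. g x \<bullet> h)) (at x)) \<and>
     (\<forall>x\<in>S. (g has_derivative (\<lambda>h. H x *v h)) (at x)) \<and>
     continuous_on S H"

text \<open>The next three notions refer to the equation \<open>P_minus k (D2 u) + u powr p = 0\<close> in \<open>\<Omega>\<close>, in the
  viscosity sense; \<open>u\<close> is nonnegative and \<open>p > 0\<close>, so \<open>powr\<close> is the usual power, also at 0.\<close>

definition viscosity_subsolution :: "nat \<Rightarrow> real \<Rightarrow> (real ^ 'n) set \<Rightarrow> (real ^ 'n \<Rightarrow> real) \<Rightarrow> bool" where
  "viscosity_subsolution k p \<Omega> u \<longleftrightarrow>
     (\<forall>x\<in>\<Omega>. 0 \<le> u x) \<and> usc_on \<Omega> u \<and>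
     (\<forall>\<phi> g H x0. C2_on \<Omega> \<phi> g H \<and> local_max_at \<Omega> (\<lambda>x. u x - \<phi> x) x0 \<longrightarrow>
        P_minus k (H x0) + u x0 powr p \<ge> 0)"

definition viscosity_supersolution :: "nat \<Rightarrow> real \<Rightarrow> (real ^ 'n) set \<Rightarrow> (real ^ 'n \<Rightarrow> real) \<Rightarrow> bool" where
  "viscosity_supersolution k p \<Omega> u \<longleftrightarrow>
     (\<forall>x\<in>\<Omega>. 0 \<le> u x) \<and> lsc_on \<Omega> u \<and>
     (\<forall>\<phi> g H x0. C2_on \<Omega> \<phi> g H \<and> local_min_at \<Omega> (\<lambda>x. u x - \<phi> x) x0 \<longrightarrow>
        P_minus k (H x0) + u x0 powr p \<le> 0)"

definition viscosity_solution :: "nat \<Rightarrow> real \<Rightarrow> (real ^ 'n) set \<Rightarrow> (real ^ 'n \<Rightarrow> real) \<Rightarrow> bool" where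
  "viscosity_solution k p \<Omega> u \<longleftrightarrow>
     continuous_on \<Omega> u \<and> viscosity_subsolution k p \<Omega> u \<and> viscosity_supersolution k p \<Omega> u"

text \<open>For the Dirichlet problem, only the values of \<open>u\<close> on \<open>closure \<Omega>\<close> matter.\<close>

definition Dirichlet_subsolution :: "nat \<Rightarrow> real \<Rightarrow> (real ^ 'n) set \<Rightarrow> (real ^ 'n \<Rightarrow> real) \<Rightarrow> bool" where
  "Dirichlet_subsolution k p \<Omega> u \<longleftrightarrow>
     usc_on (closure \<Omega>) u \<and> (\<forall>x\<in>\<Omega>. 0 < u x) \<and>
     viscosity_subsolution k p \<Omega> u \<and> (\<forall>x\<in>frontier \<Omega>. u x \<le> 0)"

definition Dirichlet_solution :: "nat \<Rightarrow> real \<Rightarrow> (real ^ 'n) set \<Rightarrow> (real ^ 'n \<Rightarrow> real) \<Rightarrow> bool" where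
  "Dirichlet_solution k p \<Omega> u \<longleftrightarrow>
     continuous_on (closure \<Omega>) u \<and> (\<forall>x\<in>\<Omega>. 0 < u x) \<and>
     viscosity_solution k p \<Omega> u \<and> (\<forall>x\<in>frontier \<Omega>. u x = 0)"

definition class_CR :: "(real ^ 'n) set set" where
  "class_CR = {\<Omega>. \<exists>R > 0. \<exists>Y. \<Omega> = (\<Inter>y\<in>Y. ball y R)}"

end

theory Submission
  imports Defs
begin

text \<open>\<open>P_minus k X\<close> is the minimum of the traces of \<open>X\<close> over orthonormal \<open>k\<close>-frames. As \<open>k < N\<close>, a frame can be
  chosen orthogonal to any given vector, which makes radial functions with a very negative tangential
  Hessian strict supersolutions; this excludes subsolutions for \<open>p \<ge> 1\<close>. For \<open>p < 1\<close>, the function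
  \<open>w = u powr (1 - p)\<close> solves an equation that is proper (strictly monotone in \<open>w\<close>), has the explicit
  solutions \<open>(1 - p) / (2 k) * (R\<^sup>2 - (norm (x - y))\<^sup>2)\<close> on balls, and its
  subsolutions are preserved by translations and by lowering \<open>w\<close> by constants. Hence the Perron supremum is automatically Lipschitz and vanishes
  linearly at the boundary, which gives existence and the decay rate.

  Uniqueness is a comparison principle. The operator is concave, so a viscosity subsolution satisfies a
  linear inequality for every frame, and such inequalities survive mollification; the mollified
  subsolution can be used as a test function for the supersolution, and no doubling of variables
  is needed. That the linear viscosity inequalities survive mollification follows from the comparison
  of the subsolution with \<open>(1 - s \<Delta>)\<^sup>-\<^sup>1\<close> of itself, as \<open>s\<close> tends to \<open>0\<close>.\<close>

section \<open>Frames and sums of eigenvalues\<close>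

text \<open>The obstacle is degeneracy. For one frame the linear operator differentiates in only
  \<open>k\<close> of the \<open>N\<close> directions, so its resolvent does not regularize, and a
  viscosity subsolution need not have second derivatives that could be integrated against a
  mollifier. What survives is order: with \<open>R_s\<close> the resolvent, a viscosity subsolution
  of \<open>tr_e D^2 f >= -C\<close> satisfies \<open>f <= R_s f + s C\<close> up to
  \<open>O(s^2)\<close>, and this inequality between functions can be averaged, because
  \<open>R_s\<close> is a positive combination of translations. For the mollified function,
  \<open>R_s \<phi> - \<phi>\<close> is about \<open>s tr_e D^2 \<phi>\<close>, and division by
  \<open>s\<close> returns the linear inequality. To obtain a C2 test function, \<open>f\<close> is
  first mollified at a second, auxiliary scale; to keep \<open>R_s\<close> elementary, it is built
  from finitely many translations. The margin that closes the comparison is the constant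
  \<open>1 - p\<close> of the transformed equation: dividing a subsolution by \<open>t > 1\<close>
  scales the second-order part but not this constant.\<close>

definition frame :: "nat \<Rightarrow> (nat \<Rightarrow> real ^ 'n) \<Rightarrow> bool" where
  "frame k e \<longleftrightarrow> (\<forall>i<k. \<forall>j<k. e i \<bullet> e j = (if i = j then 1 else 0))"

definition ftrace :: "nat \<Rightarrow> (nat \<Rightarrow> real ^ 'n) \<Rightarrow> real ^ 'n ^ 'n \<Rightarrow> real" where
  "ftrace k e X = (\<Sum>i<k. e i \<bullet> (X *v e i))"

lemma frame_norm: "frame k e \<Longrightarrow> i < k \<Longrightarrow> norm (e i) = 1"
  by (auto simp: frame_def norm_eq_1)

lemma frame_extend:
  assumes "frame m f" "norm v = 1" "\<And>i. i < m \<Longrightarrow> f i \<bullet> v = 0"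
  shows "frame (Suc m) (f(m := v))"
  using assms unfolding frame_def
  by (auto simp: less_Suc_eq inner_commute norm_eq_1)

lemma ex_nonzero_orthogonal:
  fixes f :: "nat \<Rightarrow> real ^ 'n"
  assumes "m < CARD('n)"
  shows "\<exists>x. x \<noteq> 0 \<and> (\<forall>i<m. f i \<bullet> x = 0)"
proof -
  have "dim (span (f ` {..<m})) \<le> card (f ` {..<m})"
    by (simp add: dim_le_card')
  also have "\<dots> \<le> m"
    using card_image_le[of "{..<m}" f] by simp
  finally have "dim (f ` {..<m}) < DIM(real ^ 'n)"
    using assms by simp
  then obtain x where x: "x \<noteq> 0" "\<And>y. y \<in> span (f ` {..<m}) \<Longrightarrow> orthogonal x y"
    using orthogonal_to_subspace_exists by blast
  have "f i \<bullet> x = 0" if "i < m" for i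
    using x(2)[of "f i"] that by (auto simp: orthogonal_def inner_commute span_base)
  with x(1) show ?thesis by blast
qed

text \<open>Gram-Schmidt with one extra constraint: each new unit vector is orthogonal to those
  found so far and to \<open>q\<close>, and \<open>k < N\<close> leaves room for it.\<close>

lemma ex_frame_orthogonal:
  fixes q :: "real ^ 'n"
  assumes "k < CARD('n)"
  shows "\<exists>e. frame k e \<and> (\<forall>i<k. e i \<bullet> q = 0)"
  using assms
proof (induction k)
  case 0
  then show ?case by (auto simp: frame_def)
next
  case (Suc k)
  then obtain e where e: "frame k e" "\<And>i. i < k \<Longrightarrow> e i \<bullet> q = 0"
    by auto
  \<comment> \<open>Slot \<open>k\<close> holds \<open>q\<close> temporarily, so that one appeal
    covers the \<open>k\<close> frame vectors and \<open>q\<close>.\<close>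
  obtain x where x: "x \<noteq> 0" "\<And>i. i < Suc k \<Longrightarrow> (e(k := q)) i \<bullet> x = 0"
    using ex_nonzero_orthogonal[of "Suc k" "e(k := q)"] Suc.prems by auto
  define v where "v = x /\<^sub>R norm x"
  have "e i \<bullet> x = 0" if "i < k" for i
    using x(2)[of i] that by simp
  then have "norm v = 1" "v \<bullet> q = 0" "\<And>i. i < k \<Longrightarrow> e i \<bullet> v = 0"
    using x(1) x(2)[of k] by (auto simp: v_def inner_commute)
  then have "frame (Suc k) (e(k := v))" "\<forall>i<Suc k. (e(k := v)) i \<bullet> q = 0"
    using frame_extend[OF e(1)] e(2) by (auto simp: less_Suc_eq)
  then show ?case by blast
qed

lemma frame_bessel:
  fixes x :: "real ^ 'n"
  assumes "frame k e"
  shows "(\<Sum>i<k. (e i \<bullet> x)\<^sup>2) \<le> x \<bullet> x"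
proof -
  define y where "y = (\<Sum>i<k. (e i \<bullet> x) *\<^sub>R e i)"
  have xy: "x \<bullet> y = (\<Sum>i<k. (e i \<bullet> x)\<^sup>2)"
    by (simp add: y_def inner_sum_right power2_eq_square inner_commute)
  have "y \<bullet> y = (\<Sum>i<k. \<Sum>j<k. (e i \<bullet> x) * (e j \<bullet> x) * (e i \<bullet> e j))"
    by (simp add: y_def inner_sum_right inner_sum_left sum_distrib_left ac_simps inner_commute)
  also have "\<dots> = (\<Sum>i<k. \<Sum>j<k. if i = j then (e i \<bullet> x)\<^sup>2 else 0)"
    using assms by (intro sum.cong refl) (auto simp: frame_def power2_eq_square)
  also have "\<dots> = (\<Sum>i<k. (e i \<bullet> x)\<^sup>2)"
    by simp
  finally have yy: "y \<bullet> y = (\<Sum>i<k. (e i \<bullet> x)\<^sup>2)" .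
  have "0 \<le> (x - y) \<bullet> (x - y)" by simp
  then show ?thesis
    using xy yy by (simp add: inner_diff_left inner_diff_right inner_commute)
qed

text \<open>Parseval: a nonzero remainder after projection could be normalized to give
  \<open>N + 1\<close> orthonormal vectors, too many for the dimension.\<close>

lemma frame_complete:
  fixes x :: "real ^ 'n"
  assumes "frame CARD('n) f"
  shows "(\<Sum>i<CARD('n). (f i \<bullet> x)\<^sup>2) = x \<bullet> x"
proof -
  let ?N = "CARD('n)"
  define y where "y = x - (\<Sum>i<?N. (f i \<bullet> x) *\<^sub>R f i)"
  have ort: "f i \<bullet> y = 0" if "i < ?N" for i
  proof -
    have "f i \<bullet> (\<Sum>j<?N. (f j \<bullet> x) *\<^sub>R f j) = (\<Sum>j<?N. if i = j then f i \<bullet> x else 0)"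
      unfolding inner_sum_right using that assms by (intro sum.cong) (auto simp: frame_def)
    then show ?thesis using that by (simp add: y_def inner_diff_right)
  qed
  have "y = 0"
  proof (rule ccontr)
    assume "y \<noteq> 0"
    define v where "v = y /\<^sub>R norm y"
    have "frame (Suc ?N) (f(?N := v))"
      using \<open>y \<noteq> 0\<close> ort by (intro frame_extend assms) (auto simp: v_def)
    define g where "g = f(?N := v)"
    have g: "frame (Suc ?N) g" by (simp add: g_def \<open>frame (Suc ?N) (f(?N := v))\<close>)
    have inj: "inj_on g {..<Suc ?N}"
    proof (rule inj_onI)
      fix i j assume "i \<in> {..<Suc ?N}" "j \<in> {..<Suc ?N}" "g i = g j"
      then show "i = j" using g unfolding frame_def by (metis lessThan_iff zero_neq_one)
    qed
    have "pairwise orthogonal (g ` {..<Suc ?N})"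
      using g inj by (auto simp: pairwise_def orthogonal_def frame_def)
    moreover have "0 \<notin> g ` {..<Suc ?N}"
      using frame_norm[OF g] by fastforce
    ultimately have "independent (g ` {..<Suc ?N})"
      by (rule pairwise_orthogonal_independent)
    then have "card (g ` {..<Suc ?N}) \<le> DIM(real ^ 'n)"
      using independent_bound by blast
    then show False using card_image[OF inj] by simp
  qed
  then have x: "x = (\<Sum>i<?N. (f i \<bullet> x) *\<^sub>R f i)" by (simp add: y_def)
  have "x \<bullet> x = x \<bullet> (\<Sum>i<?N. (f i \<bullet> x) *\<^sub>R f i)" using x by simp
  also have "\<dots> = (\<Sum>i<?N. (f i \<bullet> x)\<^sup>2)"
    by (simp add: inner_sum_right power2_eq_square inner_commute)
  finally show ?thesis by simp
qed

section \<open>Spectral theorem by successive minimization of the Rayleigh quotient\<close>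

lemma symmetric_inner:
  fixes X :: "real ^ 'n ^ 'n"
  assumes "transpose X = X"
  shows "x \<bullet> (X *v y) = y \<bullet> (X *v x)"
  by (metis assms dot_lmul_matrix inner_commute transpose_matrix_vector)

text \<open>The trial value \<open>t = - b / d\<close> with \<open>d > c\<close> makes the linear
  term dominate. This is the first-order condition for Rayleigh minimizers.\<close>

lemma linear_term_zero:
  fixes b c :: real
  assumes "\<And>t. 0 \<le> t * b + t\<^sup>2 * c"
  shows "b = 0"
proof (rule ccontr)
  assume b: "b \<noteq> 0"
  define d where "d = \<bar>c\<bar> + 1"
  have d: "d > 0" "c < d" by (auto simp: d_def)
  have "0 \<le> (- b / d) * b + (- b / d)\<^sup>2 * c" by (rule assms)
  also have "\<dots> = (b\<^sup>2 / d) * (c / d - 1)"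
    using d by (simp add: field_simps power2_eq_square)
  also have "\<dots> < 0"
    using b d by (intro mult_pos_neg) auto
  finally show False by simp
qed

text \<open>The quadratic form has a minimizer \<open>v\<close> on the compact unit sphere of
  \<open>S\<close>. Its first variation shows that \<open>X *v v - l *\<^sub>R v\<close> is
  orthogonal to \<open>S\<close>; by invariance this vector lies in \<open>S\<close>, hence it is
  zero.\<close>

lemma rayleigh_minimizer:
  fixes X :: "real ^ 'n ^ 'n"
  assumes sym: "transpose X = X" and S: "subspace S" "\<And>x. x \<in> S \<Longrightarrow> X *v x \<in> S"
    and ne: "z \<in> S" "z \<noteq> 0"
  shows "\<exists>v \<in> S. \<exists>l. norm v = 1 \<and> X *v v = l *\<^sub>R v \<and> (\<forall>x\<in>S. l * (x \<bullet> x) \<le> x \<bullet> (X *v x))"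
proof -
  have "compact (S \<inter> sphere 0 1)"
    by (intro closed_Int_compact closed_subspace S compact_sphere)
  moreover have "z /\<^sub>R norm z \<in> S \<inter> sphere 0 1"
    using ne S by (auto simp: subspace_scale)
  moreover have "continuous_on (S \<inter> sphere 0 1) (\<lambda>x. x \<bullet> (X *v x))"
    by (intro continuous_intros matrix_vector_mult_linear_continuous_on)
  ultimately obtain v where v: "v \<in> S" "norm v = 1"
    and vmin: "\<And>x. x \<in> S \<Longrightarrow> norm x = 1 \<Longrightarrow> v \<bullet> (X *v v) \<le> x \<bullet> (X *v x)"
    using continuous_attains_inf[of "S \<inter> sphere 0 1" "\<lambda>x. x \<bullet> (X *v x)"]
    by (metis (no_types, lifting) Int_iff empty_iff mem_sphere_0)
  define l where "l = v \<bullet> (X *v v)"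
  have min: "l * (x \<bullet> x) \<le> x \<bullet> (X *v x)" if "x \<in> S" for x
  proof (cases "x = 0")
    case False
    have "l \<le> (x /\<^sub>R norm x) \<bullet> (X *v (x /\<^sub>R norm x))"
      unfolding l_def using that False S by (intro vmin) (auto simp: subspace_scale)
    also have "\<dots> = (x \<bullet> (X *v x)) / (norm x)\<^sup>2"
      by (simp add: matrix_vector_mult_scaleR power2_eq_square divide_inverse)
    finally show ?thesis
      using False by (simp add: power2_norm_eq_inner pos_le_divide_eq)
  qed auto
  have orth: "h \<bullet> (X *v v - l *\<^sub>R v) = 0" if h: "h \<in> S" for h
  proof -
    have vv: "v \<bullet> v = 1" using v by (simp add: norm_eq_1)
    have "0 \<le> t * (2 * (h \<bullet> (X *v v - l *\<^sub>R v))) + t\<^sup>2 * (h \<bullet> (X *v h) - l * (h \<bullet> h))" for t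
    proof -
      have "v + t *\<^sub>R h \<in> S" using v h S by (simp add: subspace_add subspace_scale)
      then have "l * ((v + t *\<^sub>R h) \<bullet> (v + t *\<^sub>R h)) \<le> (v + t *\<^sub>R h) \<bullet> (X *v (v + t *\<^sub>R h))"
        by (rule min)
      then show ?thesis
        using symmetric_inner[OF sym, of v h] vv
        by (simp add: matrix_vector_right_distrib matrix_vector_mult_scaleR inner_add_left
            inner_add_right inner_diff_right l_def[symmetric] inner_commute algebra_simps power2_eq_square)
    qed
    then show ?thesis using linear_term_zero by fastforce
  qed
  have "X *v v - l *\<^sub>R v \<in> S" using v S by (simp add: subspace_diff subspace_scale)
  then have "X *v v = l *\<^sub>R v" using orth[of "X *v v - l *\<^sub>R v"] by simp
  then show ?thesis using v min by blast
qed

text \<open>The last clause carries the induction: all eigenvalues found so far bound the form from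
  below on the remaining orthogonal complement. The next minimum is therefore at least as large as
  they are, and the list comes out sorted.\<close>

lemma symmetric_eigenframe_aux:
  fixes X :: "real ^ 'n ^ 'n"
  assumes sym: "transpose X = X" and "m \<le> CARD('n)"
  shows "\<exists>f l. frame m f \<and> (\<forall>i<m. X *v f i = l i *\<^sub>R f i) \<and> (\<forall>j<m. \<forall>i\<le>j. l i \<le> l j) \<and>
    (\<forall>x. (\<forall>i<m. f i \<bullet> x = 0) \<longrightarrow> (\<forall>i<m. l i * (x \<bullet> x) \<le> x \<bullet> (X *v x)))"
  using assms(2)
proof (induction m)
  case 0
  then show ?case by (auto simp: frame_def)
next
  case (Suc m)
  then obtain f l where f: "frame m f" and eig: "\<And>i. i < m \<Longrightarrow> X *v f i = l i *\<^sub>R f i"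
    and srt: "\<And>i j. j < m \<Longrightarrow> i \<le> j \<Longrightarrow> l i \<le> l j"
    and low: "\<And>x i. (\<And>i. i < m \<Longrightarrow> f i \<bullet> x = 0) \<Longrightarrow> i < m \<Longrightarrow> l i * (x \<bullet> x) \<le> x \<bullet> (X *v x)"
    by (metis Suc_leD)
  define S where "S = {x. \<forall>i<m. f i \<bullet> x = 0}"
  have S: "subspace S"
    by (auto simp: S_def subspace_def inner_add_right)
  have inv: "X *v x \<in> S" if "x \<in> S" for x
    using that eig by (auto simp: S_def symmetric_inner[OF sym, of _ x] inner_commute)
  obtain z where "z \<in> S" "z \<noteq> 0"
    using ex_nonzero_orthogonal[of m f] Suc.prems by (auto simp: S_def)
  from rayleigh_minimizer[OF sym S inv this] obtain v c where v: "v \<in> S" "norm v = 1"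
    and c: "X *v v = c *\<^sub>R v" "\<And>x. x \<in> S \<Longrightarrow> c * (x \<bullet> x) \<le> x \<bullet> (X *v x)" by blast
  have vS: "\<And>i. i < m \<Longrightarrow> f i \<bullet> v = 0" using v by (auto simp: S_def)
  have lc: "l i \<le> c" if "i < m" for i
    using low[OF vS that] c(1) v by (simp add: norm_eq_1)
  show ?case
  proof (intro exI conjI allI impI)
    show "frame (Suc m) (f(m := v))" by (rule frame_extend[OF f v(2) vS])
    show "X *v (f(m := v)) i = (l(m := c)) i *\<^sub>R (f(m := v)) i" if "i < Suc m" for i
      using that eig c by (auto simp: less_Suc_eq)
    show "(l(m := c)) i \<le> (l(m := c)) j" if "j < Suc m" "i \<le> j" for i j
      using that srt lc by (auto simp: less_Suc_eq)
    show "(l(m := c)) i * (x \<bullet> x) \<le> x \<bullet> (X *v x)"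
      if x: "\<forall>i<Suc m. (f(m := v)) i \<bullet> x = 0" and "i < Suc m" for x i
    proof -
      have xm: "\<And>i. i < m \<Longrightarrow> f i \<bullet> x = 0"
        using x by (metis fun_upd_apply less_SucI less_irrefl)
      then show ?thesis
        using \<open>i < Suc m\<close> low[OF xm] c(2)[of x] by (auto simp: less_Suc_eq S_def)
    qed
  qed
qed

lemma symmetric_eigenframe:
  fixes X :: "real ^ 'n ^ 'n"
  assumes "transpose X = X"
  obtains f l where "frame CARD('n) f" "\<And>i. i < CARD('n) \<Longrightarrow> X *v f i = l i *\<^sub>R f i"
    "\<And>i j. j < CARD('n) \<Longrightarrow> i \<le> j \<Longrightarrow> l i \<le> l j"
  using symmetric_eigenframe_aux[OF assms, of "CARD('n)"] by (metis le_refl)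

section \<open>Eigenvalues as roots of the characteristic polynomial\<close>

definition poly_matrix :: "real ^ 'n ^ 'm \<Rightarrow> real poly ^ 'n ^ 'm" where
  "poly_matrix X = (\<chi> i j. [:X $ i $ j:])"

lemma poly_matrix_mult: "poly_matrix (A ** B) = poly_matrix A ** poly_matrix B"
proof -
  have *: "[:sum f S:] = (\<Sum>x\<in>S. [:f x:])" for f :: "'z \<Rightarrow> real" and S
  proof (induction S rule: infinite_finite_induct)
    case (insert x F)
    have "[:f x + sum f F:] = [:f x:] + [:sum f F:]" by simp
    with insert show ?case by (simp del: add_pCons)
  qed auto
  show ?thesis
    by (simp add: poly_matrix_def matrix_matrix_mult_def vec_eq_iff * mult.commute)
qed

text \<open>Over polynomial matrices \<open>charpoly X\<close> is the determinant of
  \<open>x - X\<close> with \<open>x\<close> a scalar matrix. Being central, \<open>x\<close> passes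
  through \<open>Q\<close>, and determinants multiply.\<close>

lemma charpoly_conj:
  fixes X Q :: "real ^ 'n ^ 'n"
  assumes "Q ** transpose Q = mat 1"
  shows "charpoly (Q ** X ** transpose Q) = charpoly X"
proof -
  define x :: "real poly ^ 'n ^ 'n" where "x = mat [:0, 1:]"
  have ch: "charpoly Y = det (x - poly_matrix Y)" for Y :: "real ^ 'n ^ 'n"
    unfolding charpoly_def x_def poly_matrix_def
    by (intro arg_cong[where f = det]) (auto simp: vec_eq_iff mat_def)
  have one: "poly_matrix Q ** poly_matrix (transpose Q) = mat 1"
    unfolding poly_matrix_mult[symmetric] assms by (auto simp: poly_matrix_def mat_def vec_eq_iff one_pCons)
  have sub_ld: "A ** (B - C) = A ** B - A ** C" and sub_rd: "(B - C) ** A = B ** A - C ** A"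
    for A B C :: "real poly ^ 'n ^ 'n"
    by (simp_all add: matrix_matrix_mult_def vec_eq_iff algebra_simps sum_subtractf)
  have sc: "A ** x = x ** A" for A :: "real poly ^ 'n ^ 'n"
    unfolding x_def matrix_matrix_mult_def mat_def
    by (auto simp: vec_eq_iff if_distrib if_distribR sum.delta' sum.delta cong: if_cong)
  have "x = x ** (poly_matrix Q ** poly_matrix (transpose Q))"
    by (simp add: one)
  also have "\<dots> = poly_matrix Q ** x ** poly_matrix (transpose Q)"
    by (metis sc matrix_mul_assoc)
  finally have "x - poly_matrix (Q ** X ** transpose Q) =
      poly_matrix Q ** (x - poly_matrix X) ** poly_matrix (transpose Q)"
    by (simp add: poly_matrix_mult sub_ld sub_rd)
  then have "charpoly (Q ** X ** transpose Q) =
     det (poly_matrix Q) * det (x - poly_matrix X) * det (poly_matrix (transpose Q))"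
    by (simp add: ch det_mul)
  also have "\<dots> = det (x - poly_matrix X) * det (poly_matrix Q ** poly_matrix (transpose Q))"
    by (simp add: det_mul)
  also have "\<dots> = charpoly X" by (simp add: one ch)
  finally show ?thesis .
qed

text \<open>Conjugation by the matrix \<open>Q\<close> with rows \<open>f (b i)\<close> makes
  \<open>X\<close> diagonal, so the roots with multiplicity are the \<open>l i\<close>, already
  sorted. The bijection \<open>b\<close> numbers the abstract index type; \<open>eigval\<close>
  counts from 1 and \<open>l\<close> from 0, hence the shift.\<close>

lemma eigval_eigenframe:
  fixes X :: "real ^ 'n ^ 'n"
  assumes f: "frame CARD('n) f" and eig: "\<And>i. i < CARD('n) \<Longrightarrow> X *v f i = l i *\<^sub>R f i"
    and srt: "\<And>i j. j < CARD('n) \<Longrightarrow> i \<le> j \<Longrightarrow> l i \<le> l j"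
    and i: "1 \<le> i" "i \<le> CARD('n)"
  shows "eigval X i = l (i - 1)"
proof -
  let ?N = "CARD('n)"
  obtain b :: "'n \<Rightarrow> nat" where b: "bij_betw b UNIV {..<?N}"
    using ex_bij_betw_finite_nat[of "UNIV :: 'n set"] by (auto simp: atLeast0LessThan)
  have bN: "b j < ?N" for j using b by (auto simp: bij_betw_def)
  have binj: "b i = b j \<longleftrightarrow> i = j" for i j using b by (auto simp: bij_betw_def inj_def)
  define Q :: "real ^ 'n ^ 'n" where "Q = (\<chi> i. f (b i))"
  have ent: "(Q ** Y ** transpose Q) $ i $ j = f (b i) \<bullet> (Y *v f (b j))" for Y i j
    by (simp add: Q_def matrix_matrix_mult_def transpose_def matrix_vector_mult_def inner_vec_def
        sum_distrib_left sum_distrib_right mult.assoc) (rule sum.swap)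
  have "Q ** transpose Q = mat 1"
    using ent[of "mat 1"] f bN binj
    by (auto simp: matrix_mul_rid matrix_vector_mul_lid vec_eq_iff frame_def) (auto simp: mat_def)
  then have "charpoly X = charpoly (Q ** X ** transpose Q)"
    by (rule charpoly_conj[symmetric])
  also have "\<dots> = (\<Prod>i\<in>UNIV. [:- l (b i), 1:])"
    unfolding charpoly_def
    using f bN binj eig by (subst det_diagonal) (auto simp: ent frame_def)
  also have "\<dots> = (\<Prod>i<?N. [:- l i, 1:])"
    using prod.reindex_bij_betw[OF b, of "\<lambda>i. [:- l i, 1:]"] by simp
  finally have "proots (charpoly X) = (\<Sum>i<?N. {#l i#})"
    by (simp add: proots_prod)
  also have "\<dots> = mset (map l [0..<?N])"
    by (simp add: sum_unfold_sum_mset mset_map image_mset.compositionality o_def atLeast0LessThan[symmetric])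
  finally have "sorted_list_of_multiset (proots (charpoly X)) = sort (map l [0..<?N])"
    by (simp only: sorted_list_of_multiset_mset)
  also have "\<dots> = map l [0..<?N]"
    by (rule sorted_sort_id) (auto simp: sorted_iff_nth_mono_less intro!: srt)
  finally show ?thesis using i by (simp add: eigval_def)
qed

lemma P_minus_attained:
  fixes X :: "real ^ 'n ^ 'n"
  assumes sym: "transpose X = X" and k: "0 < k" "k \<le> CARD('n)"
  obtains e where "frame k e" "P_minus k X = ftrace k e X"
proof -
  obtain f l where f: "frame CARD('n) f" and eig: "\<And>i. i < CARD('n) \<Longrightarrow> X *v f i = l i *\<^sub>R f i"
    and srt: "\<And>i j. j < CARD('n) \<Longrightarrow> i \<le> j \<Longrightarrow> l i \<le> l j"
    using symmetric_eigenframe[OF sym] by blast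
  have "P_minus k X = (\<Sum>i = 1..k. l (i - 1))"
    unfolding P_minus_def by (intro sum.cong refl eigval_eigenframe[OF f eig srt]) (use k in auto)
  also have "\<dots> = (\<Sum>i<k. l i)"
    by (rule sum.reindex_bij_witness[of _ Suc "\<lambda>i. i - 1"]) auto
  also have "\<dots> = ftrace k f X"
    unfolding ftrace_def
    using f k eig by (intro sum.cong refl) (auto simp: frame_def)
  finally have "P_minus k X = ftrace k f X" .
  moreover have "frame k f" using f k by (auto simp: frame_def)
  ultimately show ?thesis by (rule that[rotated])
qed

text \<open>Ky Fan: in an eigenbasis the trace over a frame is a combination of the eigenvalues with weights
  in \<open>[0, 1]\<close> of total \<open>k\<close>.\<close>

lemma P_minus_le_ftrace:
  fixes X :: "real ^ 'n ^ 'n"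
  assumes sym: "transpose X = X" and k: "0 < k" "k \<le> CARD('n)" and e: "frame k e"
  shows "P_minus k X \<le> ftrace k e X"
proof -
  let ?N = "CARD('n)"
  obtain f l where f: "frame ?N f" and eig: "\<And>i. i < ?N \<Longrightarrow> X *v f i = l i *\<^sub>R f i"
    and srt: "\<And>i j. j < ?N \<Longrightarrow> i \<le> j \<Longrightarrow> l i \<le> l j"
    using symmetric_eigenframe[OF sym] by blast
  have "P_minus k X = (\<Sum>i = 1..k. l (i - 1))"
    unfolding P_minus_def by (intro sum.cong refl eigval_eigenframe[OF f eig srt]) (use k in auto)
  also have "\<dots> = (\<Sum>i<k. l i)"
    by (rule sum.reindex_bij_witness[of _ Suc "\<lambda>i. i - 1"]) auto
  finally have P: "P_minus k X = (\<Sum>i<k. l i)" .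
  define m where "m j = (\<Sum>i<k. (e i \<bullet> f j)\<^sup>2)" for j
  have m0: "0 \<le> m j" for j by (simp add: m_def sum_nonneg)
  have m1: "m j \<le> 1" if "j < ?N" for j
    using frame_bessel[OF e, of "f j"] f that by (simp add: m_def frame_def)
  have msum: "(\<Sum>j<?N. m j) = k"
  proof -
    have "(\<Sum>j<?N. m j) = (\<Sum>i<k. \<Sum>j<?N. (f j \<bullet> e i)\<^sup>2)"
      unfolding m_def by (subst sum.swap) (simp add: inner_commute)
    also have "\<dots> = (\<Sum>i<k. 1)"
      using e by (intro sum.cong refl) (simp add: frame_complete[OF f] frame_def)
    finally show ?thesis by simp
  qed
  have quad: "x \<bullet> (X *v x) = (\<Sum>j<?N. l j * (f j \<bullet> x)\<^sup>2)" for x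
  proof -
    have c: "(\<Sum>j<?N. (f j \<bullet> z)\<^sup>2) = z \<bullet> z" for z by (rule frame_complete[OF f])
    \<comment> \<open>Polarization: Parseval is available for squares only, so the mixed product is
      written through three of them.\<close>
    have "x \<bullet> (X *v x) = ((x + X *v x) \<bullet> (x + X *v x) - x \<bullet> x - (X *v x) \<bullet> (X *v x)) / 2"
      by (simp add: inner_add_left inner_add_right inner_commute)
    also have "\<dots> = (\<Sum>j<?N. ((f j \<bullet> (x + X *v x))\<^sup>2 - (f j \<bullet> x)\<^sup>2 - (f j \<bullet> (X *v x))\<^sup>2) / 2)"
      by (simp add: c[symmetric] sum_subtractf sum_divide_distrib[symmetric])
    also have "\<dots> = (\<Sum>j<?N. l j * (f j \<bullet> x)\<^sup>2)"
    proof (intro sum.cong refl)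
      fix j assume "j \<in> {..<?N}"
      then have "f j \<bullet> (X *v x) = l j * (f j \<bullet> x)"
        using symmetric_inner[OF sym, of "f j" x] eig[of j] by (simp add: inner_commute)
      then show "((f j \<bullet> (x + X *v x))\<^sup>2 - (f j \<bullet> x)\<^sup>2 - (f j \<bullet> (X *v x))\<^sup>2) / 2 = l j * (f j \<bullet> x)\<^sup>2"
        by (simp add: inner_add_right power2_eq_square algebra_simps)
    qed
    finally show ?thesis .
  qed
  have "ftrace k e X = (\<Sum>i<k. \<Sum>j<?N. l j * (f j \<bullet> e i)\<^sup>2)"
    by (simp add: ftrace_def quad)
  also have "\<dots> = (\<Sum>j<?N. l j * m j)"
    by (subst sum.swap) (simp add: m_def sum_distrib_left inner_commute)
  finally have tr: "ftrace k e X = (\<Sum>j<?N. l j * m j)" .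
  \<comment> \<open>Replacing \<open>l j\<close> by \<open>l j - c\<close>, with \<open>c\<close>
    the \<open>k\<close>-th smallest eigenvalue, does not change the difference of the two weighted
    sums, because the weights \<open>m\<close> and \<open>d\<close> both total \<open>k\<close>.
    Then every summand is a product of factors of equal sign.\<close>
  define c where "c = l (k - 1)"
  define d where "d j = (if j < k then 1 else 0::real)" for j
  have d1: "(\<Sum>j<?N. d j) = k" and d2: "(\<Sum>j<?N. l j * d j) = (\<Sum>j<k. l j)"
  proof -
    have *: "{..<?N} \<inter> {j. j < k} = {..<k}" using k by auto
    show "(\<Sum>j<?N. d j) = k" by (simp add: d_def sum.If_cases *)
    have "(\<Sum>j<?N. l j * d j) = (\<Sum>j<?N. if j < k then l j else 0)"
      by (intro sum.cong) (auto simp: d_def)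
    then show "(\<Sum>j<?N. l j * d j) = (\<Sum>j<k. l j)" by (simp add: sum.If_cases *)
  qed
  have "0 \<le> (\<Sum>j<?N. (l j - c) * (m j - d j))"
  proof (rule sum_nonneg)
    fix j assume j: "j \<in> {..<?N}"
    show "0 \<le> (l j - c) * (m j - d j)"
    proof (cases "j < k")
      case True
      then have "l j \<le> c" using srt[of "k - 1" j] k by (simp add: c_def)
      then show ?thesis using m1[of j] j True by (simp add: d_def mult_nonpos_nonpos)
    next
      case False
      then have "c \<le> l j" using srt[of j "k - 1"] j by (simp add: c_def)
      then show ?thesis using m0 False by (simp add: d_def)
    qed
  qed
  also have "\<dots> = (\<Sum>j<?N. l j * m j) - (\<Sum>j<?N. l j * d j) - c * ((\<Sum>j<?N. m j) - (\<Sum>j<?N. d j))"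
    by (simp add: sum_subtractf[symmetric] sum_distrib_left algebra_simps)
  finally show ?thesis by (simp add: P tr d1 d2 msum)
qed

section \<open>Second-order test functions\<close>

definition outer :: "real ^ 'n \<Rightarrow> real ^ 'n ^ 'n" where
  "outer q = (\<chi> i j. q $ i * q $ j)"

lemma outer_mult: "outer q *v h = (q \<bullet> h) *\<^sub>R q"
  by (simp add: outer_def matrix_vector_mult_def vec_eq_iff inner_vec_def sum_distrib_left
      sum_distrib_right ac_simps)

lemma transpose_outer [simp]: "transpose (outer q) = outer q"
  by (simp add: outer_def transpose_def vec_eq_iff ac_simps)

lemma transpose_add [simp]: "transpose (A + B) = transpose A + transpose B"
  by (simp add: transpose_def vec_eq_iff)

lemma transpose_scaleR [simp]: "transpose (c *\<^sub>R A) = c *\<^sub>R transpose (A :: real ^ 'n ^ 'm)"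
  by (simp add: transpose_def vec_eq_iff)

lemma mat_mult_vec: "mat c *v h = c *\<^sub>R (h :: real ^ 'n)"
  by (simp add: mat_def matrix_vector_mult_def vec_eq_iff if_distrib if_distribR sum.delta cong: if_cong)

lemma ftrace_add: "ftrace k e (X + Y) = ftrace k e X + ftrace k e Y"
  by (simp add: ftrace_def matrix_vector_mult_add_rdistrib inner_add_right sum.distrib)

lemma ftrace_scaleR: "ftrace k e (c *\<^sub>R X) = c * ftrace k e X"
  by (simp add: ftrace_def scaleR_matrix_vector_assoc[symmetric] sum_distrib_left)

lemma ftrace_outer: "ftrace k e (outer q) = (\<Sum>i<k. (e i \<bullet> q)\<^sup>2)"
  by (simp add: ftrace_def outer_mult power2_eq_square inner_commute)

lemma ftrace_mat: "frame k e \<Longrightarrow> ftrace k e (mat c) = real k * c"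
  by (simp add: ftrace_def mat_mult_vec frame_def)

lemma P_minus_geI:
  fixes X :: "real ^ 'n ^ 'n"
  assumes "transpose X = X" "0 < k" "k \<le> CARD('n)" "\<And>e. frame k e \<Longrightarrow> b \<le> ftrace k e X"
  shows "b \<le> P_minus k X"
  by (metis P_minus_attained assms)

lemma P_minus_add_mat:
  fixes X :: "real ^ 'n ^ 'n"
  assumes X: "transpose X = X" and k: "0 < k" "k \<le> CARD('n)"
  shows "P_minus k (X + mat c) = P_minus k X + real k * c"
proof (rule antisym)
  obtain e where "frame k e" "P_minus k X = ftrace k e X"
    using P_minus_attained[OF X k] by blast
  then show "P_minus k (X + mat c) \<le> P_minus k X + real k * c"
    using P_minus_le_ftrace[of "X + mat c" k e] X k by (simp add: ftrace_add ftrace_mat)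
  show "P_minus k X + real k * c \<le> P_minus k (X + mat c)"
    by (rule P_minus_geI) (use X k P_minus_le_ftrace[OF X k] in \<open>auto simp: ftrace_add ftrace_mat\<close>)
qed

lemma P_minus_mono:
  fixes X Y :: "real ^ 'n ^ 'n"
  assumes X: "transpose X = X" and Y: "transpose Y = Y" and k: "0 < k" "k \<le> CARD('n)"
    and le: "\<And>h. h \<bullet> (X *v h) \<le> h \<bullet> (Y *v h)"
  shows "P_minus k X \<le> P_minus k Y"
proof -
  obtain e where e: "frame k e" "P_minus k Y = ftrace k e Y"
    using P_minus_attained[OF Y k] by blast
  have "ftrace k e X \<le> ftrace k e Y"
    unfolding ftrace_def by (intro sum_mono le)
  then show ?thesis using P_minus_le_ftrace[OF X k e(1)] e by simp
qed

lemma P_minus_scaleR: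
  fixes X :: "real ^ 'n ^ 'n"
  assumes X: "transpose X = X" and k: "0 < k" "k \<le> CARD('n)" and c: "0 < c"
  shows "P_minus k (c *\<^sub>R X) = c * P_minus k X"
proof (rule antisym)
  obtain e where "frame k e" "P_minus k X = ftrace k e X"
    using P_minus_attained[OF X k] by blast
  then show "P_minus k (c *\<^sub>R X) \<le> c * P_minus k X"
    using P_minus_le_ftrace[of "c *\<^sub>R X" k e] X k by (simp add: ftrace_scaleR)
  show "c * P_minus k X \<le> P_minus k (c *\<^sub>R X)"
    by (rule P_minus_geI) (use X k c P_minus_le_ftrace[OF X k] in \<open>auto simp: ftrace_scaleR\<close>)
qed

text \<open>The norm of a matrix, as a vector of vectors, is the Frobenius norm; this is
  Cauchy-Schwarz row by row.\<close>

lemma norm_matrix_vector_mult_le: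
  fixes X :: "real ^ 'n ^ 'n"
  shows "norm (X *v h) \<le> norm X * norm h"
proof -
  have "\<bar>(X *v h) $ i\<bar> \<le> norm (X $ i) * norm h" for i
    unfolding matrix_vector_mul_component by (rule Cauchy_Schwarz_ineq2)
  then have "norm (X *v h) \<le> L2_set (\<lambda>i. norm (X $ i) * norm h) UNIV"
    unfolding norm_vec_def[of "X *v h"] by (intro L2_set_mono) auto
  also have "\<dots> = norm X * norm h"
    by (simp add: norm_vec_def[of X] L2_set_left_distrib)
  finally show ?thesis .
qed

lemma matrix_form_bound:
  fixes X :: "real ^ 'n ^ 'n"
  shows "\<bar>h \<bullet> (X *v h)\<bar> \<le> norm X * (h \<bullet> h)"
proof -
  have "norm h * norm (X *v h) \<le> norm h * (norm X * norm h)"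
    by (intro mult_left_mono norm_matrix_vector_mult_le) simp
  then show ?thesis
    using Cauchy_Schwarz_ineq2[of h "X *v h"]
    by (simp add: power2_norm_eq_inner[symmetric] power2_eq_square algebra_simps)
qed

text \<open>As quadratic forms, \<open>X\<close> lies below \<open>Y + mat (norm (X - Y))\<close>,
  and adding \<open>mat c\<close> shifts \<open>P_minus k\<close> by \<open>k * c\<close>.\<close>

lemma P_minus_lipschitz:
  fixes X Y :: "real ^ 'n ^ 'n"
  assumes X: "transpose X = X" and Y: "transpose Y = Y" and k: "0 < k" "k \<le> CARD('n)"
  shows "\<bar>P_minus k X - P_minus k Y\<bar> \<le> real k * norm (X - Y)"
proof -
  have "h \<bullet> (X *v h) \<le> h \<bullet> ((Y + mat (norm (X - Y))) *v h)" for h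
    using matrix_form_bound[of h "X - Y"]
    by (simp add: matrix_vector_mult_add_rdistrib matrix_vector_mult_diff_rdistrib mat_mult_vec
        inner_add_right inner_diff_right)
  then have 1: "P_minus k X \<le> P_minus k (Y + mat (norm (X - Y)))"
    using X Y k by (intro P_minus_mono) auto
  have "h \<bullet> (Y *v h) \<le> h \<bullet> ((X + mat (norm (X - Y))) *v h)" for h
    using matrix_form_bound[of h "X - Y"]
    by (simp add: matrix_vector_mult_add_rdistrib matrix_vector_mult_diff_rdistrib mat_mult_vec
        inner_add_right inner_diff_right)
  then have 2: "P_minus k Y \<le> P_minus k (X + mat (norm (X - Y)))"
    using X Y k by (intro P_minus_mono) auto
  show ?thesis using 1 2 by (simp add: P_minus_add_mat X Y k)
qed

text \<open>A pointwise weakening of \<open>C2_on\<close>: the gradient has a derivative at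
  \<open>x0\<close> alone. This already yields the second-order Taylor expansion and the symmetry of
  \<open>H\<close>, and it is stable under the powers used below.\<close>

definition C2_at ::
    "(real ^ 'n \<Rightarrow> real) \<Rightarrow> (real ^ 'n \<Rightarrow> real ^ 'n) \<Rightarrow> real ^ 'n ^ 'n \<Rightarrow> real ^ 'n \<Rightarrow> bool" where
  "C2_at \<phi> g H x0 \<longleftrightarrow> (\<forall>\<^sub>F x in nhds x0. (\<phi> has_derivative (\<lambda>h. g x \<bullet> h)) (at x)) \<and>
     (g has_derivative (\<lambda>h. H *v h)) (at x0)"

lemma C2_atE:
  assumes "C2_at \<phi> g H x0" "0 < \<epsilon>"
  obtains d where "0 < d" "\<And>x. x \<in> ball x0 d \<Longrightarrow> (\<phi> has_derivative (\<lambda>h. g x \<bullet> h)) (at x)"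
    "\<And>x. x \<in> ball x0 d \<Longrightarrow> norm (g x - g x0 - H *v (x - x0)) \<le> \<epsilon> * norm (x - x0)"
proof -
  obtain d1 where d1: "0 < d1" "\<And>x. dist x x0 < d1 \<Longrightarrow> (\<phi> has_derivative (\<lambda>h. g x \<bullet> h)) (at x)"
    using assms unfolding C2_at_def eventually_nhds_metric by blast
  have "(g has_derivative (\<lambda>h. H *v h)) (at x0 within UNIV)"
    using assms by (simp add: C2_at_def)
  then obtain d2 where d2: "0 < d2"
    "\<And>x. norm (x - x0) < d2 \<Longrightarrow> norm (g x - g x0 - H *v (x - x0)) \<le> \<epsilon> * norm (x - x0)"
    using assms(2) unfolding has_derivative_within_alt by (metis UNIV_I)
  show ?thesis
    by (rule that[of "min d1 d2"]) (use d1 d2 in \<open>auto simp: dist_commute dist_norm\<close>)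
qed

lemma has_derivative_along_line:
  assumes "(\<phi> has_derivative (\<lambda>h. g \<bullet> h)) (at (x + t *\<^sub>R h))"
  shows "((\<lambda>t. \<phi> (x + t *\<^sub>R h)) has_real_derivative g \<bullet> h) (at t)"
proof -
  have "((\<lambda>t. x + t *\<^sub>R h) has_derivative (\<lambda>s. s *\<^sub>R h)) (at t)"
    by (auto intro!: derivative_eq_intros)
  from has_derivative_compose[OF this assms] show ?thesis
    by (rule has_derivative_imp_has_field_derivative) simp
qed

text \<open>The mean value theorem along the segment, applied to \<open>\<phi>\<close> minus its
  quadratic model: the derivative is the linearization error of the gradient. Stated with an
  explicit ball, so that it also serves when the radius is uniform in \<open>x0\<close>.\<close>

lemma taylor2_ball:
  fixes \<phi> :: "real ^ 'n \<Rightarrow> real"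
  assumes d: "\<And>x. x \<in> ball x0 d \<Longrightarrow> (\<phi> has_derivative (\<lambda>h. g x \<bullet> h)) (at x)"
    "\<And>x. x \<in> ball x0 d \<Longrightarrow> norm (g x - g x0 - H *v (x - x0)) \<le> \<epsilon> * norm (x - x0)"
    and "0 < \<epsilon>" and x: "dist x x0 < d"
  shows "\<bar>\<phi> x - \<phi> x0 - g x0 \<bullet> (x - x0) - (x - x0) \<bullet> (H *v (x - x0)) / 2\<bar> \<le> \<epsilon> * (norm (x - x0))\<^sup>2"
proof -
  define h where "h = x - x0"
  have hd: "norm h < d" using x by (simp add: h_def dist_norm)
  have inb: "x0 + t *\<^sub>R h \<in> ball x0 d" if "0 \<le> t" "t \<le> 1" for t
  proof -
    have "norm (t *\<^sub>R h) \<le> norm h" using that by (simp add: mult_left_le_one_le)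
    then show ?thesis using hd by (simp add: dist_norm)
  qed
  define \<psi> where "\<psi> t = \<phi> (x0 + t *\<^sub>R h) - t * (g x0 \<bullet> h) - t\<^sup>2 * (h \<bullet> (H *v h)) / 2" for t
  have der: "(\<psi> has_real_derivative (g (x0 + t *\<^sub>R h) - g x0 - H *v (t *\<^sub>R h)) \<bullet> h) (at t)"
    if "0 \<le> t" "t \<le> 1" for t
  proof -
    have "(\<psi> has_real_derivative g (x0 + t *\<^sub>R h) \<bullet> h - g x0 \<bullet> h - t * (h \<bullet> (H *v h))) (at t)"
      unfolding \<psi>_def
      by (auto intro!: derivative_eq_intros has_derivative_along_line[OF d(1)[OF inb[OF that]]])
    then show ?thesis
      by (simp add: inner_diff_left matrix_vector_mult_scaleR inner_commute algebra_simps)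
  qed
  obtain t where t: "0 < t" "t < 1"
    and eq: "\<psi> 1 - \<psi> 0 = (1 - 0) * ((g (x0 + t *\<^sub>R h) - g x0 - H *v (t *\<^sub>R h)) \<bullet> h)"
    using MVT2[of 0 1 \<psi>, OF _ der] by auto
  have "\<bar>\<psi> 1 - \<psi> 0\<bar> \<le> norm (g (x0 + t *\<^sub>R h) - g x0 - H *v (t *\<^sub>R h)) * norm h"
    unfolding eq using Cauchy_Schwarz_ineq2 by simp
  also have "\<dots> \<le> (\<epsilon> * norm (t *\<^sub>R h)) * norm h"
    using d(2)[OF inb[of t]] t by (intro mult_right_mono) auto
  also have "\<dots> = t * (\<epsilon> * (norm h)\<^sup>2)"
    using t by (simp add: power2_eq_square)
  also have "\<dots> \<le> \<epsilon> * (norm h)\<^sup>2"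
    using t \<open>0 < \<epsilon>\<close> by (simp add: mult_left_le_one_le)
  finally show ?thesis by (simp add: \<psi>_def h_def)
qed

lemma C2_at_taylor:
  assumes "C2_at \<phi> g H x0" "0 < \<epsilon>"
  shows "\<forall>\<^sub>F x in nhds x0. \<bar>\<phi> x - \<phi> x0 - g x0 \<bullet> (x - x0) - (x - x0) \<bullet> (H *v (x - x0)) / 2\<bar>
    \<le> \<epsilon> * (norm (x - x0))\<^sup>2"
proof -
  obtain d where d: "0 < d" "\<And>x. x \<in> ball x0 d \<Longrightarrow> (\<phi> has_derivative (\<lambda>h. g x \<bullet> h)) (at x)"
    "\<And>x. x \<in> ball x0 d \<Longrightarrow> norm (g x - g x0 - H *v (x - x0)) \<le> \<epsilon> * norm (x - x0)"
    using C2_atE[OF assms] by blast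
  then show ?thesis
    unfolding eventually_nhds_metric using taylor2_ball[OF d(2,3) assms(2)] by blast
qed

text \<open>The mixed second difference is an increment in direction \<open>u\<close> of a
  difference in direction \<open>v\<close>; the mean value theorem in \<open>u\<close> and the
  linearization of \<open>g\<close> at \<open>x0\<close> evaluate it. As the difference is symmetric
  in \<open>u\<close> and \<open>v\<close>, the Hessian must be symmetric.\<close>

lemma C2_at_second_difference:
  assumes "C2_at \<phi> g H x0" "0 < \<epsilon>"
  shows "\<forall>\<^sub>F s in at_right 0. \<bar>(\<phi> (x0 + s *\<^sub>R v + s *\<^sub>R u) - \<phi> (x0 + s *\<^sub>R u) - \<phi> (x0 + s *\<^sub>R v) + \<phi> x0) / s\<^sup>2
     - u \<bullet> (H *v v)\<bar> \<le> 2 * \<epsilon> * (norm u + norm v)\<^sup>2"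
proof -
  obtain d where d: "0 < d" "\<And>x. x \<in> ball x0 d \<Longrightarrow> (\<phi> has_derivative (\<lambda>h. g x \<bullet> h)) (at x)"
    "\<And>x. x \<in> ball x0 d \<Longrightarrow> norm (g x - g x0 - H *v (x - x0)) \<le> \<epsilon> * norm (x - x0)"
    using C2_atE[OF assms] by blast
  define S where "S = norm u + norm v"
  have "((\<lambda>s. s * S) \<longlongrightarrow> 0) (at_right 0)" by (auto intro!: tendsto_eq_intros)
  then have "\<forall>\<^sub>F s in at_right 0. s * S < d" using d(1) by (rule order_tendstoD)
  moreover have "\<forall>\<^sub>F s in at_right 0. (0::real) < s" by (simp add: eventually_at_right_less)
  ultimately show ?thesis
  proof eventually_elim
    case (elim s)
    have bnd: "norm (t *\<^sub>R (s *\<^sub>R u)) \<le> s * norm u" if "0 \<le> t" "t \<le> 1" for t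
      using that elim by (simp add: mult_left_le_one_le)
    have n1: "norm (s *\<^sub>R v + t *\<^sub>R (s *\<^sub>R u)) \<le> s * S" "norm (t *\<^sub>R (s *\<^sub>R u)) \<le> s * S" if "0 \<le> t" "t \<le> 1" for t
    proof -
      show "norm (s *\<^sub>R v + t *\<^sub>R (s *\<^sub>R u)) \<le> s * S"
        using norm_triangle_ineq[of "s *\<^sub>R v" "t *\<^sub>R (s *\<^sub>R u)"] bnd[OF that] elim by (simp add: S_def algebra_simps)
      show "norm (t *\<^sub>R (s *\<^sub>R u)) \<le> s * S"
        using bnd[OF that] elim by (simp add: S_def algebra_simps add_increasing2)
    qed
    have inb: "x0 + s *\<^sub>R v + t *\<^sub>R (s *\<^sub>R u) \<in> ball x0 d" "x0 + t *\<^sub>R (s *\<^sub>R u) \<in> ball x0 d" if "0 \<le> t" "t \<le> 1" for t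
      
    proof -
      have ballI: "x0 + w \<in> ball x0 d" if "norm w < d" for w
        using that by (simp add: dist_norm)
      show "x0 + s *\<^sub>R v + t *\<^sub>R (s *\<^sub>R u) \<in> ball x0 d" "x0 + t *\<^sub>R (s *\<^sub>R u) \<in> ball x0 d"
        using n1[OF that] elim by (auto simp: add.assoc simp del: mem_ball intro!: ballI)
    qed

    define \<psi> where "\<psi> t = \<phi> (x0 + s *\<^sub>R v + t *\<^sub>R (s *\<^sub>R u)) - \<phi> (x0 + t *\<^sub>R (s *\<^sub>R u))" for t
    have der: "(\<psi> has_real_derivative (g (x0 + s *\<^sub>R v + t *\<^sub>R (s *\<^sub>R u)) - g (x0 + t *\<^sub>R (s *\<^sub>R u))) \<bullet> (s *\<^sub>R u)) (at t)"
      if "0 \<le> t" "t \<le> 1" for t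
      unfolding \<psi>_def inner_diff_left
      by (intro DERIV_diff has_derivative_along_line d(2) inb[OF that])
    obtain t where t: "0 < t" "t < 1"
      and eq: "\<psi> 1 - \<psi> 0 = (1 - 0) * ((g (x0 + s *\<^sub>R v + t *\<^sub>R (s *\<^sub>R u)) - g (x0 + t *\<^sub>R (s *\<^sub>R u))) \<bullet> (s *\<^sub>R u))"
      using MVT2[of 0 1 \<psi>, OF _ der] by auto
    define a where "a = g (x0 + s *\<^sub>R v + t *\<^sub>R (s *\<^sub>R u)) - g x0 - H *v (s *\<^sub>R v + t *\<^sub>R (s *\<^sub>R u))"
    define b where "b = g (x0 + t *\<^sub>R (s *\<^sub>R u)) - g x0 - H *v (t *\<^sub>R (s *\<^sub>R u))"
    have a: "norm a \<le> \<epsilon> * (s * S)"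
    proof -
      have "norm a \<le> \<epsilon> * norm (s *\<^sub>R v + t *\<^sub>R (s *\<^sub>R u))"
        using d(3)[OF inb(1)[of t]] t by (simp add: a_def add.assoc)
      also have "\<dots> \<le> \<epsilon> * (s * S)" using n1[of t] t assms(2) by (intro mult_left_mono) auto
      finally show ?thesis .
    qed
    have b: "norm b \<le> \<epsilon> * (s * S)"
    proof -
      have "norm b \<le> \<epsilon> * norm (t *\<^sub>R (s *\<^sub>R u))"
        using d(3)[OF inb(2)[of t]] t by (simp add: b_def)
      also have "\<dots> \<le> \<epsilon> * (s * S)" using n1[of t] t assms(2) by (intro mult_left_mono) auto
      finally show ?thesis .
    qed
    have ab: "(g (x0 + s *\<^sub>R v + t *\<^sub>R (s *\<^sub>R u)) - g (x0 + t *\<^sub>R (s *\<^sub>R u))) = H *v (s *\<^sub>R v) + (a - b)"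
      by (simp add: a_def b_def matrix_vector_right_distrib)
    have "\<psi> 1 - \<psi> 0 = s\<^sup>2 * (u \<bullet> (H *v v)) + s * ((a - b) \<bullet> u)"
      unfolding eq ab by (simp add: inner_add_left matrix_vector_mult_scaleR power2_eq_square inner_commute algebra_simps)
    then have e: "(\<psi> 1 - \<psi> 0) / s\<^sup>2 - u \<bullet> (H *v v) = ((a - b) \<bullet> u) / s"
      using elim by (simp add: field_simps power2_eq_square)
    have "\<bar>(a - b) \<bullet> u\<bar> \<le> norm (a - b) * norm u" by (rule Cauchy_Schwarz_ineq2)
    also have "\<dots> \<le> (2 * \<epsilon> * (s * S)) * S"
      using a b norm_triangle_ineq4[of a b] elim assms(2) by (intro mult_mono) (auto simp: S_def)
    finally have "\<bar>(a - b) \<bullet> u\<bar> / s \<le> 2 * \<epsilon> * S\<^sup>2"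
      using elim by (simp add: field_simps power2_eq_square)
    then have "\<bar>(\<psi> 1 - \<psi> 0) / s\<^sup>2 - u \<bullet> (H *v v)\<bar> \<le> 2 * \<epsilon> * S\<^sup>2"
      unfolding e using elim by simp
    then show ?case by (simp add: \<psi>_def S_def algebra_simps)
  qed
qed

lemma C2_at_symmetric:
  fixes H :: "real ^ 'n ^ 'n"
  assumes "C2_at \<phi> g H x0"
  shows "transpose H = H"
proof -
  have "u \<bullet> (H *v v) = v \<bullet> (H *v u)" for u v
  proof (rule ccontr)
    define D where "D = \<bar>u \<bullet> (H *v v) - v \<bullet> (H *v u)\<bar>"
    define S where "S = (norm u + norm v)\<^sup>2 + 1"
    assume "u \<bullet> (H *v v) \<noteq> v \<bullet> (H *v u)"
    then have D: "0 < D" by (simp add: D_def)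
    have S: "0 < S" by (auto simp: S_def intro: add_nonneg_pos)
    define \<epsilon> where "\<epsilon> = D / (8 * S)"
    have \<epsilon>: "0 < \<epsilon>" using D S by (simp add: \<epsilon>_def)
    have "\<forall>\<^sub>F s in at_right (0::real). False"
      using C2_at_second_difference[OF assms \<epsilon>, of v u] C2_at_second_difference[OF assms \<epsilon>, of u v]
    proof eventually_elim
      case (elim s)
      have comm: "x0 + s *\<^sub>R u + s *\<^sub>R v = x0 + s *\<^sub>R v + s *\<^sub>R u" by simp
      have "D \<le> 4 * \<epsilon> * (norm u + norm v)\<^sup>2"
        using elim unfolding D_def comm by (auto simp: add.commute abs_le_iff algebra_simps)
      also have "\<dots> \<le> 4 * \<epsilon> * S" using \<epsilon> by (simp add: S_def)
      also have "\<dots> < D" using D S by (simp add: \<epsilon>_def)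
      finally show False by simp
    qed
    then show False by simp
  qed
  then have "axis i 1 \<bullet> (H *v axis j 1) = axis j 1 \<bullet> (H *v axis i 1)" for i j by blast
  then have "H $ i $ j = H $ j $ i" for i j
    by (simp add: inner_axis' matrix_vector_mul_component inner_axis)
  then show ?thesis by (simp add: transpose_def vec_eq_iff)
qed

section \<open>Viscosity solutions and the transformed equation\<close>

lemma has_derivative_matrix_affine:
  fixes X :: "real ^ 'n ^ 'n"
  shows "((\<lambda>x. X *v (x - x0)) has_derivative (\<lambda>h. X *v h)) (at z)"
proof -
  have "((\<lambda>x. X *v (x - x0)) has_derivative (\<lambda>h. X *v (h - 0))) (at z)"
    by (rule bounded_linear.has_derivative[OF matrix_vector_mul_bounded_linear
          has_derivative_diff[OF has_derivative_ident has_derivative_const]])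
  then show ?thesis by simp
qed

definition quad :: "real ^ 'n \<Rightarrow> real \<Rightarrow> real ^ 'n \<Rightarrow> real ^ 'n ^ 'n \<Rightarrow> real ^ 'n \<Rightarrow> real" where
  "quad x0 c q X x = c + q \<bullet> (x - x0) + (x - x0) \<bullet> (X *v (x - x0)) / 2"

lemma quad_at [simp]: "quad x0 c q X x0 = c"
  by (simp add: quad_def)

lemma quad_add_mat: "quad x0 c q (X + mat \<epsilon>) x = quad x0 c q X x + \<epsilon> / 2 * (norm (x - x0))\<^sup>2"
  by (simp add: quad_def matrix_vector_mult_add_rdistrib mat_mult_vec inner_add_right
      power2_norm_eq_inner add_divide_distrib)

lemma has_derivative_quad:
  assumes "transpose X = X"
  shows "(quad x0 c q X has_derivative (\<lambda>h. (q + X *v (x - x0)) \<bullet> h)) (at x)"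
proof -
  have "(quad x0 c q X has_derivative (\<lambda>h. q \<bullet> h + ((x - x0) \<bullet> (X *v h) + h \<bullet> (X *v (x - x0))) / 2)) (at x)"
    unfolding quad_def
    by (auto intro!: derivative_eq_intros has_derivative_matrix_affine)
  moreover have "q \<bullet> h + ((x - x0) \<bullet> (X *v h) + h \<bullet> (X *v (x - x0))) / 2 = (q + X *v (x - x0)) \<bullet> h" for h
    using symmetric_inner[OF assms, of "x - x0" h] by (simp add: inner_add_left inner_add_right inner_commute)
  ultimately show ?thesis by simp
qed

lemma C2_on_quad:
  assumes "transpose X = X"
  shows "C2_on S (quad x0 c q X) (\<lambda>x. q + X *v (x - x0)) (\<lambda>_. X)"
  unfolding C2_on_def using has_derivative_quad[OF assms]
    has_derivative_add[OF has_derivative_const has_derivative_matrix_affine] by auto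

lemma C2_on_imp_C2_at: "C2_on S \<phi> g H \<Longrightarrow> open S \<Longrightarrow> x0 \<in> S \<Longrightarrow> C2_at \<phi> g (H x0) x0"
  unfolding C2_on_def C2_at_def using eventually_nhds by blast

lemma C2_at_quad: "transpose X = X \<Longrightarrow> C2_at (quad x0 c q X) (\<lambda>x. q + X *v (x - x0)) X z"
  using C2_on_imp_C2_at[OF C2_on_quad open_UNIV] by blast

lemma C2_at_affine:
  assumes "C2_at \<phi> g H x0"
  shows "C2_at (\<lambda>x. b * \<phi> x + c) (\<lambda>x. b *\<^sub>R g x) (b *\<^sub>R H) x0"
  unfolding C2_at_def
proof
  show "\<forall>\<^sub>F x in nhds x0. ((\<lambda>x. b * \<phi> x + c) has_derivative (\<lambda>h. (b *\<^sub>R g x) \<bullet> h)) (at x)"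
    using assms unfolding C2_at_def
    by (auto elim!: eventually_mono intro!: derivative_eq_intros)
  show "((\<lambda>x. b *\<^sub>R g x) has_derivative (\<lambda>h. (b *\<^sub>R H) *v h)) (at x0)"
    using assms unfolding C2_at_def
    by (auto intro!: derivative_eq_intros simp: scaleR_matrix_vector_assoc)
qed

lemma C2_at_add_const: "C2_at \<phi> g H x0 \<Longrightarrow> C2_at (\<lambda>x. \<phi> x + c) g H x0"
  using C2_at_affine[of \<phi> g H x0 1 c] by simp

lemma C2_at_isCont:
  assumes "C2_at \<phi> g H x0" shows "isCont \<phi> x0"
  using assms eventually_nhds_x_imp_x has_derivative_continuous unfolding C2_at_def by blast

lemma isCont_nhds: "isCont f x \<Longrightarrow> (f \<longlongrightarrow> f x) (nhds x)"
  by (simp add: continuous_at tendsto_at_iff_tendsto_nhds)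

lemma C2_at_pos:
  assumes "C2_at \<phi> g H x0" "0 < \<phi> x0"
  shows "\<forall>\<^sub>F x in nhds x0. 0 < \<phi> x"
  by (rule order_tendstoD(1)[OF isCont_nhds[OF C2_at_isCont[OF assms(1)]] assms(2)])

text \<open>The chain rule, with the factor \<open>b * \<phi> x0 powr (b - 1)\<close> pulled out of
  the Hessian: it is positive for \<open>b > 0\<close>, so \<open>P_minus_scaleR\<close> can move it
  outside.\<close>

lemma C2_at_powr:
  assumes C: "C2_at \<phi> g H x0" and pos: "0 < \<phi> x0"
  shows "C2_at (\<lambda>x. \<phi> x powr b) (\<lambda>x. (b * \<phi> x powr (b - 1)) *\<^sub>R g x)
    ((b * \<phi> x0 powr (b - 1)) *\<^sub>R (H + ((b - 1) / \<phi> x0) *\<^sub>R outer (g x0))) x0"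
  unfolding C2_at_def
proof
  show "\<forall>\<^sub>F x in nhds x0. ((\<lambda>x. \<phi> x powr b) has_derivative (\<lambda>h. ((b * \<phi> x powr (b - 1)) *\<^sub>R g x) \<bullet> h)) (at x)"
    using C2_at_pos[OF assms] C[unfolded C2_at_def, THEN conjunct1]
  proof eventually_elim
    case (elim x)
    have "((\<lambda>s. s powr b) has_derivative (\<lambda>t. t * (b * \<phi> x powr (b - 1)))) (at (\<phi> x))"
      using has_real_derivative_powr[OF elim(1), of b]
      by (simp add: has_field_derivative_def mult.commute[of _ "b * _"] )
    from has_derivative_compose[OF elim(2) this] show ?case
      by (simp add: mult.commute)
  qed
  have d: "(\<phi> has_derivative (\<lambda>h. g x0 \<bullet> h)) (at x0)"
    using C eventually_nhds_x_imp_x unfolding C2_at_def by blast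
  have "((\<lambda>s. b * s powr (b - 1)) has_derivative (\<lambda>t. t * (b * ((b - 1) * \<phi> x0 powr (b - 1 - 1))))) (at (\<phi> x0))"
    using DERIV_cmult[OF has_real_derivative_powr[OF pos, of "b - 1"], of b]
    by (simp add: has_field_derivative_def mult.commute[of _ "b * _"])
  from has_derivative_compose[OF d this]
  have d2: "((\<lambda>x. b * \<phi> x powr (b - 1)) has_derivative (\<lambda>h. (g x0 \<bullet> h) * (b * ((b - 1) * \<phi> x0 powr (b - 1 - 1))))) (at x0)" .
  have e: "\<phi> x0 powr (b - 2) = \<phi> x0 powr (b - 1) / \<phi> x0"
    using pos by (simp add: powr_diff power2_eq_square)
  have "((\<lambda>x. (b * \<phi> x powr (b - 1)) *\<^sub>R g x) has_derivative
     (\<lambda>h. (b * \<phi> x0 powr (b - 1)) *\<^sub>R (H *v h) + ((g x0 \<bullet> h) * (b * ((b - 1) * \<phi> x0 powr (b - 1 - 1)))) *\<^sub>R g x0)) (at x0)"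
    using C unfolding C2_at_def by (intro has_derivative_scaleR d2) auto
  then show "((\<lambda>x. (b * \<phi> x powr (b - 1)) *\<^sub>R g x) has_derivative
      (\<lambda>h. ((b * \<phi> x0 powr (b - 1)) *\<^sub>R (H + ((b - 1) / \<phi> x0) *\<^sub>R outer (g x0))) *v h)) (at x0)"
    by (simp add: e scaleR_matrix_vector_assoc[symmetric] matrix_vector_mult_add_rdistrib outer_mult
        scaleR_right_distrib mult_ac)
qed

text \<open>Contact with equal values instead of an extremum of the difference: an additive constant
  in the test function does not survive a power, equality at the contact point does.\<close>

definition touches_above where
  "touches_above \<phi> g H f x0 \<longleftrightarrow> C2_at \<phi> g H x0 \<and> \<phi> x0 = f x0 \<and> (\<forall>\<^sub>F x in nhds x0. f x \<le> \<phi> x)"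

definition touches_below where
  "touches_below \<phi> g H f x0 \<longleftrightarrow> C2_at \<phi> g H x0 \<and> \<phi> x0 = f x0 \<and> (\<forall>\<^sub>F x in nhds x0. \<phi> x \<le> f x)"

text \<open>Replaces a test function that is only \<open>C2_at\<close> by a polynomial, which is C2
  everywhere. The price \<open>2 * \<epsilon>\<close> in the Hessian absorbs the Taylor error and
  changes \<open>P_minus k\<close> by \<open>2 * k * \<epsilon>\<close>.\<close>

lemma touches_above_quad:
  assumes "touches_above \<phi> g H f x0" "0 < \<epsilon>"
  shows "\<forall>\<^sub>F x in nhds x0. f x \<le> quad x0 (f x0) (g x0) (H + mat (2 * \<epsilon>)) x"
proof -
  have "C2_at \<phi> g H x0" using assms by (simp add: touches_above_def)
  note C2_at_taylor[OF this assms(2)]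
  moreover have "\<forall>\<^sub>F x in nhds x0. f x \<le> \<phi> x" using assms by (simp add: touches_above_def)
  ultimately show ?thesis
    unfolding quad_add_mat
    by eventually_elim (use assms in \<open>simp add: quad_def abs_le_iff touches_above_def\<close>)
qed

lemma touches_below_quad:
  assumes "touches_below \<phi> g H f x0" "0 < \<epsilon>"
  shows "\<forall>\<^sub>F x in nhds x0. quad x0 (f x0) (g x0) (H + mat (- 2 * \<epsilon>)) x \<le> f x"
proof -
  have "C2_at \<phi> g H x0" using assms by (simp add: touches_below_def)
  note C2_at_taylor[OF this assms(2)]
  moreover have "\<forall>\<^sub>F x in nhds x0. \<phi> x \<le> f x" using assms by (simp add: touches_below_def)
  ultimately show ?thesis
    unfolding quad_add_mat
    by eventually_elim (use assms in \<open>simp add: quad_def abs_le_iff touches_below_def\<close>)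
qed

lemma transpose_mat [simp]: "transpose (mat c :: real ^ 'n ^ 'n) = mat c"
  by (simp add: transpose_def mat_def vec_eq_iff)

lemma touches_sym: "touches_above \<phi> g H f x0 \<Longrightarrow> transpose H = H" "touches_below \<phi> g H f x0 \<Longrightarrow> transpose H = H"
  by (auto simp: touches_above_def touches_below_def dest: C2_at_symmetric)

lemma eventually_within_open_iff_nhds:
  "open S \<Longrightarrow> x0 \<in> S \<Longrightarrow> P x0 \<Longrightarrow> (\<forall>\<^sub>F x in at x0 within S. P x) \<longleftrightarrow> (\<forall>\<^sub>F x in nhds x0. P x)"
  by (simp add: at_within_open[of x0 S] eventually_nhds_conv_at)

lemma local_max_at_iff: "open S \<Longrightarrow> x0 \<in> S \<Longrightarrow> local_max_at S f x0 \<longleftrightarrow> (\<forall>\<^sub>F x in nhds x0. f x \<le> f x0)"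
  using eventually_within_open_iff_nhds[of S x0 "\<lambda>x. f x \<le> f x0"] by (simp add: local_max_at_def)

lemma local_min_at_iff: "open S \<Longrightarrow> x0 \<in> S \<Longrightarrow> local_min_at S f x0 \<longleftrightarrow> (\<forall>\<^sub>F x in nhds x0. f x0 \<le> f x)"
  using eventually_within_open_iff_nhds[of S x0 "\<lambda>x. f x0 \<le> f x"] by (simp add: local_min_at_def)

lemma field_le_mult_epsilon:
  assumes "\<And>\<epsilon>. 0 < \<epsilon> \<Longrightarrow> (a::real) \<le> b + c * \<epsilon>" "0 \<le> c"
  shows "a \<le> b"
proof (rule field_le_epsilon)
  fix e :: real assume "0 < e"
  have "c * (e / (c + 1)) \<le> e" using assms(2) \<open>0 < e\<close> by (simp add: field_simps)
  then show "a \<le> b + e" using assms(1)[of "e / (c + 1)"] assms(2) \<open>0 < e\<close> by simp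
qed

text \<open>\<open>C2_on\<close> implies \<open>C2_at\<close>, which settles one direction. In the
  other, the test function is replaced by its Taylor polynomial with a margin
  \<open>\<epsilon>\<close>, and \<open>\<epsilon>\<close> tends to 0.\<close>

lemma viscosity_subsolution_iff:
  fixes \<Omega> :: "(real ^ 'n) set"
  assumes op: "open \<Omega>" and k: "0 < k" "k \<le> CARD('n)"
  shows "viscosity_subsolution k p \<Omega> u \<longleftrightarrow> (\<forall>x\<in>\<Omega>. 0 \<le> u x) \<and> usc_on \<Omega> u \<and>
    (\<forall>x0\<in>\<Omega>. \<forall>\<phi> g H. touches_above \<phi> g H u x0 \<longrightarrow> 0 \<le> P_minus k H + u x0 powr p)" (is "?L \<longleftrightarrow> ?R")
proof
  assume L: ?L
  show ?R
  proof (intro conjI ballI allI impI)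
    fix x0 \<phi> g H assume x0: "x0 \<in> \<Omega>" and t: "touches_above \<phi> g H u x0"
    note sym = touches_sym(1)[OF t]
    have "0 \<le> (P_minus k H + u x0 powr p) + real k * 2 * \<epsilon>" if "0 < \<epsilon>" for \<epsilon>
    proof -
      let ?X = "H + mat (2 * \<epsilon>)"
      have "local_max_at \<Omega> (\<lambda>x. u x - quad x0 (u x0) (g x0) ?X x) x0"
        using touches_above_quad[OF t that] by (simp add: local_max_at_iff[OF op x0])
      moreover have "C2_on \<Omega> (quad x0 (u x0) (g x0) ?X) (\<lambda>x. g x0 + ?X *v (x - x0)) (\<lambda>_. ?X)"
        by (intro C2_on_quad) (simp add: sym)
      ultimately have "0 \<le> P_minus k ?X + u x0 powr p"
        using L unfolding viscosity_subsolution_def by blast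
      then show ?thesis by (simp add: P_minus_add_mat[OF sym k])
    qed
    then show "0 \<le> P_minus k H + u x0 powr p"
      by (rule field_le_mult_epsilon) simp_all
  qed (use L in \<open>auto simp: viscosity_subsolution_def\<close>)
next
  assume R: ?R
  show ?L unfolding viscosity_subsolution_def
  proof (intro conjI allI impI)
    fix \<phi> g H x0 assume *: "C2_on \<Omega> \<phi> g H \<and> local_max_at \<Omega> (\<lambda>x. u x - \<phi> x) x0"
    then have x0: "x0 \<in> \<Omega>" by (simp add: local_max_at_def)
    have "C2_at (\<lambda>x. \<phi> x + (u x0 - \<phi> x0)) g (H x0) x0"
      using * by (intro C2_at_add_const C2_on_imp_C2_at[OF _ op x0]) simp
    moreover have "\<forall>\<^sub>F x in nhds x0. u x - \<phi> x \<le> u x0 - \<phi> x0"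
      using * by (simp add: local_max_at_iff[OF op x0])
    ultimately have "touches_above (\<lambda>x. \<phi> x + (u x0 - \<phi> x0)) g (H x0) u x0"
      unfolding touches_above_def by (auto elim: eventually_mono)
    then show "0 \<le> P_minus k (H x0) + u x0 powr p" using R x0 by blast
  qed (use R in auto)
qed

lemma viscosity_supersolution_iff:
  fixes \<Omega> :: "(real ^ 'n) set"
  assumes op: "open \<Omega>" and k: "0 < k" "k \<le> CARD('n)"
  shows "viscosity_supersolution k p \<Omega> u \<longleftrightarrow> (\<forall>x\<in>\<Omega>. 0 \<le> u x) \<and> lsc_on \<Omega> u \<and>
    (\<forall>x0\<in>\<Omega>. \<forall>\<phi> g H. touches_below \<phi> g H u x0 \<longrightarrow> P_minus k H + u x0 powr p \<le> 0)" (is "?L \<longleftrightarrow> ?R")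
proof
  assume L: ?L
  show ?R
  proof (intro conjI ballI allI impI)
    fix x0 \<phi> g H assume x0: "x0 \<in> \<Omega>" and t: "touches_below \<phi> g H u x0"
    note sym = touches_sym(2)[OF t]
    have "P_minus k H + u x0 powr p \<le> 0 + real k * 2 * \<epsilon>" if "0 < \<epsilon>" for \<epsilon>
    proof -
      let ?X = "H + mat (- 2 * \<epsilon>)"
      have "local_min_at \<Omega> (\<lambda>x. u x - quad x0 (u x0) (g x0) ?X x) x0"
        using touches_below_quad[OF t that] by (simp add: local_min_at_iff[OF op x0])
      moreover have "C2_on \<Omega> (quad x0 (u x0) (g x0) ?X) (\<lambda>x. g x0 + ?X *v (x - x0)) (\<lambda>_. ?X)"
        by (intro C2_on_quad) (simp add: sym)
      ultimately have "P_minus k ?X + u x0 powr p \<le> 0"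
        using L unfolding viscosity_supersolution_def by blast
      then show ?thesis by (simp add: P_minus_add_mat[OF sym k])
    qed
    then show "P_minus k H + u x0 powr p \<le> 0"
      by (rule field_le_mult_epsilon) simp_all
  qed (use L in \<open>auto simp: viscosity_supersolution_def\<close>)
next
  assume R: ?R
  show ?L unfolding viscosity_supersolution_def
  proof (intro conjI allI impI)
    fix \<phi> g H x0 assume *: "C2_on \<Omega> \<phi> g H \<and> local_min_at \<Omega> (\<lambda>x. u x - \<phi> x) x0"
    then have x0: "x0 \<in> \<Omega>" by (simp add: local_min_at_def)
    have "C2_at (\<lambda>x. \<phi> x + (u x0 - \<phi> x0)) g (H x0) x0"
      using * by (intro C2_at_add_const C2_on_imp_C2_at[OF _ op x0]) simp
    moreover have "\<forall>\<^sub>F x in nhds x0. u x - \<phi> x \<ge> u x0 - \<phi> x0"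
      using * by (simp add: local_min_at_iff[OF op x0])
    ultimately have "touches_below (\<lambda>x. \<phi> x + (u x0 - \<phi> x0)) g (H x0) u x0"
      unfolding touches_below_def by (auto elim: eventually_mono)
    then show "P_minus k (H x0) + u x0 powr p \<le> 0" using R x0 by blast
  qed (use R in auto)
qed

text \<open>The operator of the equation satisfied by \<open>w = u powr (1 - p)\<close>, at a point where \<open>w\<close> has the
  value \<open>r\<close>, gradient \<open>q\<close> and Hessian \<open>X\<close>.\<close>

definition opw :: "nat \<Rightarrow> real \<Rightarrow> real \<Rightarrow> real ^ 'n \<Rightarrow> real ^ 'n ^ 'n \<Rightarrow> real" where
  "opw k p r q X = P_minus k (X + (p / ((1 - p) * r)) *\<^sub>R outer q) + (1 - p)"

lemma touches_above_powr:
  assumes t: "touches_above \<phi> g H f x0" and pos: "0 < f x0" and b: "0 < b"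
    and nn: "\<forall>\<^sub>F x in nhds x0. 0 \<le> f x"
  shows "touches_above (\<lambda>x. \<phi> x powr b) (\<lambda>x. (b * \<phi> x powr (b - 1)) *\<^sub>R g x)
    ((b * f x0 powr (b - 1)) *\<^sub>R (H + ((b - 1) / f x0) *\<^sub>R outer (g x0))) (\<lambda>x. f x powr b) x0"
proof -
  have "\<forall>\<^sub>F x in nhds x0. f x powr b \<le> \<phi> x powr b"
    using t[unfolded touches_above_def, THEN conjunct2, THEN conjunct2] nn
    by eventually_elim (use b in \<open>auto intro: powr_mono2\<close>)
  then show ?thesis
    using t pos C2_at_powr[of \<phi> g H x0 b] by (simp add: touches_above_def)
qed

lemma touches_below_powr:
  assumes t: "touches_below \<phi> g H f x0" and pos: "0 < f x0" and b: "0 < b"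
  shows "touches_below (\<lambda>x. \<phi> x powr b) (\<lambda>x. (b * \<phi> x powr (b - 1)) *\<^sub>R g x)
    ((b * f x0 powr (b - 1)) *\<^sub>R (H + ((b - 1) / f x0) *\<^sub>R outer (g x0))) (\<lambda>x. f x powr b) x0"
proof -
  have C: "C2_at \<phi> g H x0" "\<phi> x0 = f x0" using t by (auto simp: touches_below_def)
  have "\<forall>\<^sub>F x in nhds x0. 0 < \<phi> x" using C2_at_pos[OF C(1)] C(2) pos by simp
  with t[unfolded touches_below_def, THEN conjunct2, THEN conjunct2]
  have "\<forall>\<^sub>F x in nhds x0. \<phi> x powr b \<le> f x powr b"
    by eventually_elim (use b in \<open>auto intro: powr_mono2\<close>)
  then show ?thesis
    using C pos C2_at_powr[of \<phi> g H x0 b] by (simp add: touches_below_def)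
qed

text \<open>From \<open>w\<close> to \<open>u = w powr b\<close>: as \<open>b * p = b - 1\<close>,
  the source term has the same power as the factor of the Hessian, and
  \<open>b * (1 - p) = 1\<close> leaves the constant \<open>1 - p\<close>. From \<open>u\<close> to
  \<open>w\<close>: the gradient term of \<open>opw\<close> cancels the one created by the power. In
  both directions the operators agree up to a positive factor.\<close>

lemma opw_powr:
  fixes H :: "real ^ 'n ^ 'n"
  assumes H: "transpose H = H" and k: "0 < k" "k \<le> CARD('n)" and p: "0 < p" "p < 1" and r: "0 < r"
  shows "b = 1 / (1 - p) \<Longrightarrow> P_minus k ((b * r powr (b - 1)) *\<^sub>R (H + ((b - 1) / r) *\<^sub>R outer g)) + (r powr b) powr p =
      (b * r powr (b - 1)) * opw k p r g H"
    and "b = 1 - p \<Longrightarrow> opw k p (r powr b) ((b * r powr (b - 1)) *\<^sub>R g) ((b * r powr (b - 1)) *\<^sub>R (H + ((b - 1) / r) *\<^sub>R outer g)) =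
      (b * r powr (b - 1)) * (P_minus k H + r powr p)"
proof -
  have outer_scale: "outer (c *\<^sub>R g) = c\<^sup>2 *\<^sub>R outer g" for c
    by (simp add: outer_def vec_eq_iff power2_eq_square)
  show "P_minus k ((b * r powr (b - 1)) *\<^sub>R (H + ((b - 1) / r) *\<^sub>R outer g)) + (r powr b) powr p =
      (b * r powr (b - 1)) * opw k p r g H" if b: "b = 1 / (1 - p)"
  proof -
    have "0 < b" using b p by simp
    have e: "b - 1 = p / (1 - p)" using b p by (simp add: field_simps)
    have e2: "(r powr b) powr p = r powr (b - 1)" unfolding e powr_powr using b by simp
    have b1: "b * (1 - p) = 1" using b p by simp
    have e4: "p / ((1 - p) * r) = (b - 1) / r" by (simp add: e)
    have e3': "b * r powr (b - 1) * (1 - p) = r powr (b - 1)"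
      using b1 by (metis mult.commute mult.left_commute mult_1)
    have "P_minus k ((b * r powr (b - 1)) *\<^sub>R (H + ((b - 1) / r) *\<^sub>R outer g)) =
       (b * r powr (b - 1)) * P_minus k (H + ((b - 1) / r) *\<^sub>R outer g)"
      using k \<open>0 < b\<close> r H by (intro P_minus_scaleR) auto
    then show ?thesis using e3' e4 unfolding e2 opw_def by (simp only: distrib_left)
  qed
  show "opw k p (r powr b) ((b * r powr (b - 1)) *\<^sub>R g) ((b * r powr (b - 1)) *\<^sub>R (H + ((b - 1) / r) *\<^sub>R outer g)) =
      (b * r powr (b - 1)) * (P_minus k H + r powr p)" if b: "b = 1 - p"
  proof -
    have "0 < b" using b p by simp
    define s where "s = r powr (b - 1)"
    have s: "0 < s" "r powr b = s * r" using r by (simp_all add: s_def powr_diff)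
    have "(p / ((1 - p) * (s * r))) * (b * s)\<^sup>2 = b * s * (- ((b - 1) / r))"
      using s r p unfolding b by (simp add: field_simps power2_eq_square)
    then have "(b * s) *\<^sub>R (H + ((b - 1) / r) *\<^sub>R outer g) + (p / ((1 - p) * (s * r))) *\<^sub>R outer ((b * s) *\<^sub>R g)
       = (b * s) *\<^sub>R H"
      by (simp add: outer_scale scaleR_right_distrib scaleR_add_left[symmetric] add.assoc)
    then have "opw k p (s * r) ((b * s) *\<^sub>R g) ((b * s) *\<^sub>R (H + ((b - 1) / r) *\<^sub>R outer g)) =
       b * s * P_minus k H + b"
      unfolding opw_def using P_minus_scaleR[OF H k, of "b * s"] \<open>0 < b\<close> s b by simp
    moreover have "s * r powr p = 1" using r by (simp add: s_def b powr_add[symmetric])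
    ultimately show ?thesis unfolding s(2) s_def[symmetric] by (simp add: algebra_simps)
  qed
qed

definition sub_at :: "nat \<Rightarrow> real \<Rightarrow> (real ^ 'n \<Rightarrow> real) \<Rightarrow> real ^ 'n \<Rightarrow> bool" where
  "sub_at k p w x0 \<longleftrightarrow> (\<forall>\<phi> g H. touches_above \<phi> g H w x0 \<longrightarrow> 0 \<le> opw k p (w x0) (g x0) H)"

definition super_at :: "nat \<Rightarrow> real \<Rightarrow> (real ^ 'n \<Rightarrow> real) \<Rightarrow> real ^ 'n \<Rightarrow> bool" where
  "super_at k p w x0 \<longleftrightarrow> (\<forall>\<phi> g H. touches_below \<phi> g H w x0 \<longrightarrow> opw k p (w x0) (g x0) H \<le> 0)"

lemma nonpos_of_mult: "a * b \<le> 0 \<Longrightarrow> 0 < a \<Longrightarrow> b \<le> 0" for a b :: real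
  by (simp add: mult_le_0_iff)

lemma nonneg_of_mult: "0 \<le> a * b \<Longrightarrow> 0 < a \<Longrightarrow> 0 \<le> b" for a b :: real
  by (simp add: zero_le_mult_iff)

text \<open>Test functions for \<open>u\<close> are pushed through the power \<open>1 - p\<close>,
  those for its transform through the inverse power; \<open>opw_powr\<close> compares the
  operators.\<close>

lemma sub_at_powr_iff:
  fixes u :: "real ^ 'n \<Rightarrow> real"
  assumes k: "0 < k" "k \<le> CARD('n)" and p: "0 < p" "p < 1" and pos: "0 < u x0"
    and nn: "\<forall>\<^sub>F x in nhds x0. 0 \<le> u x"
  shows "sub_at k p (\<lambda>x. u x powr (1 - p)) x0 \<longleftrightarrow>
    (\<forall>\<phi> g H. touches_above \<phi> g H u x0 \<longrightarrow> 0 \<le> P_minus k H + u x0 powr p)" (is "?L \<longleftrightarrow> ?R")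
proof
  assume L: ?L
  show ?R
  proof (intro allI impI)
    fix \<phi> g H assume t: "touches_above \<phi> g H u x0"
    have \<phi>0: "\<phi> x0 = u x0" using t by (simp add: touches_above_def)
    have b: "0 < 1 - p" using p by simp
    have "0 \<le> ((1 - p) * u x0 powr (1 - p - 1)) * (P_minus k H + u x0 powr p)"
      using L[unfolded sub_at_def, rule_format, OF touches_above_powr[OF t pos b nn]]
      by (simp only: opw_powr(2)[OF touches_sym(1)[OF t] k p pos refl] \<phi>0)
    then show "0 \<le> P_minus k H + u x0 powr p"
      by (rule nonneg_of_mult) (use p pos in simp)
  qed
next
  assume R: ?R
  let ?w = "\<lambda>x. u x powr (1 - p)" and ?b = "1 / (1 - p)"
  show ?L unfolding sub_at_def
  proof (intro allI impI)
    fix \<phi> g H assume t: "touches_above \<phi> g H ?w x0"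
    have wpos: "0 < ?w x0" using pos by simp
    have nn': "\<forall>\<^sub>F x in nhds x0. 0 \<le> ?w x" by simp
    have b: "0 < ?b" using p by simp
    define \<Phi> where "\<Phi> = (\<lambda>x. \<phi> x powr ?b)"
    define G where "G = (\<lambda>x. (?b * \<phi> x powr (?b - 1)) *\<^sub>R g x)"
    define HH where "HH = (?b * ?w x0 powr (?b - 1)) *\<^sub>R (H + ((?b - 1) / ?w x0) *\<^sub>R outer (g x0))"
    have "touches_above \<Phi> G HH (\<lambda>x. ?w x powr ?b) x0"
      unfolding \<Phi>_def G_def HH_def by (rule touches_above_powr[OF t wpos b nn'])
    moreover have inv: "0 \<le> u x \<Longrightarrow> ?w x powr ?b = u x" for x using p by (simp add: powr_powr)
    ultimately have "touches_above \<Phi> G HH u x0"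
      using pos nn unfolding touches_above_def by (auto elim: eventually_elim2)
    then have "0 \<le> P_minus k HH + u x0 powr p" using R by blast
    then have "0 \<le> (?b * ?w x0 powr (?b - 1)) * opw k p (?w x0) (g x0) H"
      using opw_powr(1)[OF touches_sym(1)[OF t] k p wpos refl, of "g x0"] inv[of x0] pos
      unfolding HH_def by simp
    then show "0 \<le> opw k p (?w x0) (g x0) H"
      by (rule nonneg_of_mult) (use b pos in simp)
  qed
qed

lemma super_at_powr_iff:
  fixes u :: "real ^ 'n \<Rightarrow> real"
  assumes k: "0 < k" "k \<le> CARD('n)" and p: "0 < p" "p < 1" and pos: "0 < u x0"
    and nn: "\<forall>\<^sub>F x in nhds x0. 0 \<le> u x"
  shows "super_at k p (\<lambda>x. u x powr (1 - p)) x0 \<longleftrightarrow>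
    (\<forall>\<phi> g H. touches_below \<phi> g H u x0 \<longrightarrow> P_minus k H + u x0 powr p \<le> 0)" (is "?L \<longleftrightarrow> ?R")
proof
  assume L: ?L
  show ?R
  proof (intro allI impI)
    fix \<phi> g H assume t: "touches_below \<phi> g H u x0"
    have \<phi>0: "\<phi> x0 = u x0" using t by (simp add: touches_below_def)
    have b: "0 < 1 - p" using p by simp
    have "((1 - p) * u x0 powr (1 - p - 1)) * (P_minus k H + u x0 powr p) \<le> 0"
      using L[unfolded super_at_def, rule_format, OF touches_below_powr[OF t pos b]]
      by (simp only: opw_powr(2)[OF touches_sym(2)[OF t] k p pos refl] \<phi>0)
    then show "P_minus k H + u x0 powr p \<le> 0"
      by (rule nonpos_of_mult) (use p pos in simp)
  qed
next
  assume R: ?R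
  let ?w = "\<lambda>x. u x powr (1 - p)" and ?b = "1 / (1 - p)"
  show ?L unfolding super_at_def
  proof (intro allI impI)
    fix \<phi> g H assume t: "touches_below \<phi> g H ?w x0"
    have wpos: "0 < ?w x0" using pos by simp
    have b: "0 < ?b" using p by simp
    define \<Phi> where "\<Phi> = (\<lambda>x. \<phi> x powr ?b)"
    define G where "G = (\<lambda>x. (?b * \<phi> x powr (?b - 1)) *\<^sub>R g x)"
    define HH where "HH = (?b * ?w x0 powr (?b - 1)) *\<^sub>R (H + ((?b - 1) / ?w x0) *\<^sub>R outer (g x0))"
    have "touches_below \<Phi> G HH (\<lambda>x. ?w x powr ?b) x0"
      unfolding \<Phi>_def G_def HH_def by (rule touches_below_powr[OF t wpos b])
    moreover have inv: "0 \<le> u x \<Longrightarrow> ?w x powr ?b = u x" for x using p by (simp add: powr_powr)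
    ultimately have "touches_below \<Phi> G HH u x0"
      using pos nn unfolding touches_below_def by (auto elim: eventually_elim2)
    then have "P_minus k HH + u x0 powr p \<le> 0" using R by blast
    then have "(?b * ?w x0 powr (?b - 1)) * opw k p (?w x0) (g x0) H \<le> 0"
      using opw_powr(1)[OF touches_sym(2)[OF t] k p wpos refl, of "g x0"] inv[of x0] pos
      unfolding HH_def by simp
    then show "opw k p (?w x0) (g x0) H \<le> 0"
      by (rule nonpos_of_mult) (use b pos in simp)
  qed
qed

section \<open>Nonexistence for exponents at least one\<close>

text \<open>Without a maximum point, \<open>S\<close> is covered by open sets on which
  \<open>u\<close> is below some value \<open>u y\<close>. In a finite subcover the point
  \<open>y\<close> with the largest value lies in one of these sets, a contradiction.\<close>

lemma usc_on_attains_sup: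
  assumes S: "compact S" "S \<noteq> {}" and usc: "usc_on S u"
  obtains x where "x \<in> S" "\<And>y. y \<in> S \<Longrightarrow> u y \<le> u x"
proof (rule ccontr)
  assume "\<not> thesis"
  with that have no_max: "\<exists>y\<in>S. u x < u y" if "x \<in> S" for x
    using \<open>x \<in> S\<close> by (meson not_less)
  define A where "A y = {T. open T \<and> (\<forall>z\<in>T \<inter> S. u z < u y)}" for y
  have cover: "S \<subseteq> \<Union> (\<Union>y\<in>S. A y)"
  proof
    fix x assume x: "x \<in> S"
    obtain y where y: "y \<in> S" "u x < u y" using no_max[OF x] by blast
    have "\<forall>\<^sub>F z in at x within S. u z < u y" using usc x y by (auto simp: usc_on_def)
    then obtain T where "open T" "x \<in> T" "\<forall>z\<in>T. z \<noteq> x \<longrightarrow> z \<in> S \<longrightarrow> u z < u y"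
      unfolding eventually_at_topological by blast
    then have "T \<in> A y" using y by (auto simp: A_def)
    then show "x \<in> \<Union> (\<Union>y\<in>S. A y)" using y \<open>x \<in> T\<close> by blast
  qed
  obtain C where C: "C \<subseteq> (\<Union>y\<in>S. A y)" "finite C" "S \<subseteq> \<Union> C"
    using compactE[OF S(1) cover] by (auto simp: A_def)
  then have "\<forall>T\<in>C. \<exists>y\<in>S. T \<in> A y" by blast
  then obtain y where y: "\<And>T. T \<in> C \<Longrightarrow> y T \<in> S \<and> T \<in> A (y T)" by metis
  have "C \<noteq> {}" using C S by auto
  then have "Max ((\<lambda>T. u (y T)) ` C) \<in> (\<lambda>T. u (y T)) ` C" using C(2) by (intro Max_in) auto
  then obtain T where T: "T \<in> C" "Max ((\<lambda>T. u (y T)) ` C) = u (y T)" by auto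
  then have T2: "u (y T') \<le> u (y T)" if "T' \<in> C" for T'
    using Max_ge[of "(\<lambda>T. u (y T)) ` C" "u (y T')"] C(2) that by auto
  have "y T \<in> S" using y[OF T(1)] by blast
  then obtain T' where "T' \<in> C" "y T \<in> T'" using C(3) by blast
  then have "u (y T) < u (y T')" using y[OF T(1)] y[of T'] by (auto simp: A_def)
  with T2[OF \<open>T' \<in> C\<close>] show False by simp
qed

text \<open>The positive part makes both factors nonnegative, so that separate upper bounds may be
  multiplied.\<close>

lemma usc_on_pos_part_mult:
  assumes usc: "usc_on S u" and E: "continuous_on S E" "\<And>x. x \<in> S \<Longrightarrow> 0 < E x"
  shows "usc_on S (\<lambda>x. max (u x) 0 * E x)"
  unfolding usc_on_def
proof (intro ballI allI impI)
  fix x a assume x: "x \<in> S" and a: "max (u x) 0 * E x < a"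
  have "((\<lambda>\<eta>. (max (u x) 0 + \<eta>) * (E x + \<eta>)) \<longlongrightarrow> (max (u x) 0 + 0) * (E x + 0)) (at_right 0)"
    by (intro tendsto_intros)
  then have "\<forall>\<^sub>F \<eta> in at_right 0. (max (u x) 0 + \<eta>) * (E x + \<eta>) < a"
    using a by (intro order_tendstoD) auto
  moreover have "\<forall>\<^sub>F \<eta> in at_right 0. (0::real) < \<eta>" by (rule eventually_at_right_less)
  ultimately have "\<forall>\<^sub>F \<eta> in at_right 0. 0 < \<eta> \<and> (max (u x) 0 + \<eta>) * (E x + \<eta>) < a"
    by eventually_elim simp
  then obtain \<eta> where \<eta>: "0 < \<eta>" "(max (u x) 0 + \<eta>) * (E x + \<eta>) < a"
    using eventually_happens'[OF trivial_limit_at_right_real] by blast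
  have "\<forall>\<^sub>F y in at x within S. u y < max (u x) 0 + \<eta>"
    using usc x \<eta> by (auto simp: usc_on_def)
  moreover have "\<forall>\<^sub>F y in at x within S. E y < E x + \<eta>"
    using E(1) x \<eta> by (intro order_tendstoD(2)[of E "E x"]) (auto simp: continuous_on_def)
  moreover have "\<forall>\<^sub>F y in at x within S. y \<in> S"
    by (simp add: eventually_at_filter)
  ultimately show "\<forall>\<^sub>F y in at x within S. max (u y) 0 * E y < a"
  proof eventually_elim
    case (elim y)
    have "max (u y) 0 * E y \<le> (max (u x) 0 + \<eta>) * (E x + \<eta>)"
      using elim \<eta> E(2)[OF elim(3)] by (intro mult_mono) auto
    then show ?case using \<eta> by simp
  qed
qed

lemma quad_ball: "quad y B 0 (mat (- 2 * c)) x = B - c * (norm (x - y))\<^sup>2"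
  by (simp add: quad_def mat_mult_vec power2_norm_eq_inner)

text \<open>The functions \<open>t * (B - (norm x)\<^sup>2) powr b\<close> are strict supersolutions for large \<open>b\<close>: as \<open>k < N\<close>,
  some frame is orthogonal to the gradient and sees only the tangential part of the Hessian.\<close>

theorem no_Dirichlet_subsolution:
  fixes \<Omega> :: "(real ^ 'n) set"
  assumes op: "open \<Omega>" and ne: "\<Omega> \<noteq> {}" and bd: "bounded \<Omega>" and k: "0 < k" "k < CARD('n)"
    and p: "1 \<le> p"
  shows "\<not> Dirichlet_subsolution k p \<Omega> u"
proof
  assume D: "Dirichlet_subsolution k p \<Omega> u"
  let ?C = "closure \<Omega>"
  have C: "compact ?C" "?C \<noteq> {}" using bd ne by auto
  have usc: "usc_on ?C u" and pos: "\<And>x. x \<in> \<Omega> \<Longrightarrow> 0 < u x"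
    and vs: "viscosity_subsolution k p \<Omega> u" and fr: "\<And>x. x \<in> frontier \<Omega> \<Longrightarrow> u x \<le> 0"
    using D by (auto simp: Dirichlet_subsolution_def)
  obtain xM where xM: "\<And>x. x \<in> ?C \<Longrightarrow> u x \<le> u xM"
    using usc_on_attains_sup[OF C usc] by blast
  define M where "M = u xM"
  obtain z where "z \<in> \<Omega>" using ne by blast
  then have M: "0 < M" "\<And>x. x \<in> ?C \<Longrightarrow> u x \<le> M"
    using xM pos[of z] closure_subset[of \<Omega>] by (fastforce simp: M_def)+
  obtain r where r: "0 < r" "\<And>x. x \<in> ?C \<Longrightarrow> norm x < r"
    using bounded_closure[OF bd] unfolding bounded_pos_less by blast
  define B where "B = r\<^sup>2"
  have B: "0 < B" "\<And>x. x \<in> ?C \<Longrightarrow> 0 < B - (norm x)\<^sup>2"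
    using r by (auto simp: B_def intro!: power_strict_mono)
  \<comment> \<open>The tangential trace at the contact point will be
    \<open>- 2 * k * b * u / Q\<close> with \<open>Q \<le> B\<close>, and \<open>p \<ge> 1\<close>
    gives \<open>u powr p \<le> M powr (p - 1) * u\<close>; this \<open>b\<close> lets the former
    dominate.\<close>
  define b where "b = M powr (p - 1) * B"
  have b: "0 < b" using M B by (simp add: b_def)
  \<comment> \<open>The reciprocal of the profile: the maximum \<open>t\<close> of
    \<open>u * E\<close> is the smallest multiple of the profile lying above \<open>u\<close>, and
    contact occurs where it is attained.\<close>
  define E where "E x = (B - (norm x)\<^sup>2) powr (- b)" for x :: "real ^ 'n"
  have E: "continuous_on ?C E" "\<And>x. x \<in> ?C \<Longrightarrow> 0 < E x"
    unfolding E_def using B(2) by (auto intro!: continuous_intros) force+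
  obtain x0 where x0: "x0 \<in> ?C" and mx: "\<And>x. x \<in> ?C \<Longrightarrow> max (u x) 0 * E x \<le> max (u x0) 0 * E x0"
    using usc_on_attains_sup[OF C usc_on_pos_part_mult[OF usc E]] by blast
  define t where "t = max (u x0) 0 * E x0"
  have "0 < max (u z) 0 * E z"
    using pos[OF \<open>z \<in> \<Omega>\<close>] E(2)[of z] closure_subset[of \<Omega>] \<open>z \<in> \<Omega>\<close> by auto
  also have "\<dots> \<le> t" unfolding t_def using \<open>z \<in> \<Omega>\<close> closure_subset by (intro mx) blast
  finally have t: "0 < t" .
  then have u0: "0 < u x0" using E(2)[OF x0] by (auto simp: t_def zero_less_mult_iff max_def split: if_splits)
  then have x0\<Omega>: "x0 \<in> \<Omega>" using fr[of x0] x0 op by (auto simp: frontier_def interior_open)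
  define Q where "Q = quad 0 B (0 :: real ^ 'n) (mat (- 2 * 1))"
  have Q: "Q x = B - (norm x)\<^sup>2" for x unfolding Q_def quad_ball by simp
  define \<phi> where "\<phi> x = t * Q x powr b" for x
  have above: "u x \<le> \<phi> x" if "x \<in> ?C" for x
  proof -
    have "max (u x) 0 * E x \<le> t" unfolding t_def using mx that by blast
    then have "max (u x) 0 \<le> \<phi> x"
      using B(2)[OF that] by (simp add: E_def \<phi>_def Q powr_minus field_simps)
    then show ?thesis by simp
  qed
  have eq: "\<phi> x0 = u x0"
    using u0 B(2)[OF x0] by (simp add: \<phi>_def t_def Q E_def powr_add[symmetric] max_def)
  define G where "G = (\<lambda>x. t *\<^sub>R ((b * Q x powr (b - 1)) *\<^sub>R (0 + mat (- 2 * 1) *v (x - 0))))"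
  define H where "H = t *\<^sub>R ((b * Q x0 powr (b - 1)) *\<^sub>R (mat (- 2 * 1) + ((b - 1) / Q x0) *\<^sub>R
    outer (0 + mat (- 2 * 1) *v (x0 - 0))))"
  have Q0: "0 < Q x0" using B(2)[OF x0] by (simp add: Q)
  have "C2_at Q (\<lambda>x. 0 + mat (- 2 * 1) *v (x - 0)) (mat (- 2 * 1)) x0"
    unfolding Q_def by (rule C2_at_quad) simp
  from C2_at_affine[OF C2_at_powr[OF this Q0, of b], of t 0]
  have "C2_at \<phi> G H x0" unfolding \<phi>_def G_def H_def by simp
  moreover have "\<forall>\<^sub>F x in nhds x0. u x \<le> \<phi> x"
    using eventually_nhds_in_open[OF op x0\<Omega>]
    by (rule eventually_mono) (use above closure_subset in blast)
  ultimately have ta: "touches_above \<phi> G H u x0" using eq by (simp add: touches_above_def)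
  then have ge: "0 \<le> P_minus k H + u x0 powr p"
    using vs x0\<Omega> k unfolding viscosity_subsolution_iff[OF op k(1) less_imp_le[OF k(2)]] by blast
  \<comment> \<open>A frame orthogonal to \<open>x0\<close> is orthogonal to the gradient, so the
    \<open>outer\<close> term, quadratic in \<open>b\<close>, drops out and the negative multiple of
    the identity remains.\<close>
  obtain e where e: "frame k e" "\<And>i. i < k \<Longrightarrow> e i \<bullet> x0 = 0"
    using ex_frame_orthogonal[OF k(2)] by blast
  have "P_minus k H \<le> ftrace k e H"
    using P_minus_le_ftrace[OF touches_sym(1)[OF ta] _ _ e(1)] k by simp
  also have "\<dots> = t * (b * Q x0 powr (b - 1) * (real k * (- 2)))"
    unfolding H_def using e
    by (simp add: ftrace_scaleR ftrace_add ftrace_mat ftrace_outer mat_mult_vec)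
  also have "\<dots> = - 2 * real k * b * (u x0 / Q x0)"
    using Q0 by (simp add: eq[symmetric] \<phi>_def powr_diff)
  also have "\<dots> < - (M powr (p - 1) * u x0)"
  proof -
    have "Q x0 \<le> B" by (simp add: Q)
    then have "u x0 / B \<le> u x0 / Q x0" using u0 Q0 by (simp add: frac_le)
    then have "b * (u x0 / B) \<le> b * (u x0 / Q x0)" using b by (intro mult_left_mono) auto
    then have "M powr (p - 1) * u x0 \<le> b * (u x0 / Q x0)" using B(1) by (simp add: b_def)
    moreover have "1 * (b * (u x0 / Q x0)) < 2 * real k * (b * (u x0 / Q x0))"
      using k b u0 Q0 by (intro mult_strict_right_mono) auto
    ultimately show ?thesis by simp
  qed
  finally have "P_minus k H < - (M powr (p - 1) * u x0)" .
  moreover have "u x0 powr p \<le> M powr (p - 1) * u x0"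
  proof -
    have "u x0 powr p = u x0 powr (p - 1) * u x0"
      using u0 by (simp add: powr_mult_base powr_diff)
    also have "\<dots> \<le> M powr (p - 1) * u x0"
      using u0 M(2)[OF x0] p by (intro mult_right_mono powr_mono2) auto
    finally show ?thesis .
  qed
  ultimately show False using ge by simp
qed

section \<open>Mollification\<close>

lemma uniformly_continuous_compact_support:
  fixes f :: "real ^ 'n \<Rightarrow> 'b::real_normed_vector"
  assumes f: "continuous_on UNIV f" and supp: "\<And>z. r < norm z \<Longrightarrow> f z = 0"
  shows "uniformly_continuous_on UNIV f"
  unfolding uniformly_continuous_on_def
proof (intro allI impI)
  fix e :: real assume "0 < e"
  have "uniformly_continuous_on (cball 0 (r + 1)) f"
    using f continuous_on_subset by (intro compact_uniformly_continuous) auto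
  then obtain d where d: "0 < d" "\<And>x y. x \<in> cball 0 (r + 1) \<Longrightarrow> y \<in> cball 0 (r + 1) \<Longrightarrow> dist y x < d \<Longrightarrow> dist (f y) (f x) < e"
    using \<open>0 < e\<close> unfolding uniformly_continuous_on_def by metis
  have "dist (f y) (f x) < e" if "dist y x < min d 1" for x y
  proof (cases "x \<in> cball 0 (r + 1) \<and> y \<in> cball 0 (r + 1)")
    case True
    then show ?thesis using d that by auto
  next
    case False
    have "norm x \<le> norm y + dist y x" "norm y \<le> norm x + dist y x"
      by (metis dist_norm norm_minus_commute norm_triangle_sub)+
    then have "f x = 0" "f y = 0" using False that by (auto intro!: supp)
    then show ?thesis using \<open>0 < e\<close> by simp
  qed
  then show "\<exists>d>0. \<forall>x\<in>UNIV. \<forall>x'\<in>UNIV. dist x' x < d \<longrightarrow> dist (f x') (f x) < e"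
    using d(1) by (intro exI[of _ "min d 1"]) auto
qed

lemma integrable_compact_support:
  fixes f :: "real ^ 'n \<Rightarrow> 'b::{banach, second_countable_topology}"
  assumes f: "continuous_on UNIV f" and supp: "\<And>z. r < norm z \<Longrightarrow> f z = 0"
  shows "integrable lborel f"
proof -
  have "integrable lborel (\<lambda>x. indicator (cball 0 r) x *\<^sub>R f x)"
    using f continuous_on_subset by (intro borel_integrable_compact) auto
  moreover have "(\<lambda>x. indicator (cball 0 r) x *\<^sub>R f x) = f"
    using supp by (auto simp: indicator_def fun_eq_iff not_le)
  ultimately show ?thesis by simp
qed

lemma norm_integral_compact_support:
  fixes f :: "real ^ 'n \<Rightarrow> 'b::{banach, second_countable_topology}"
  assumes f: "continuous_on UNIV f" and supp: "\<And>z. r < norm z \<Longrightarrow> f z = 0"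
    and B: "\<And>z. norm (f z) \<le> B"
  shows "norm (LINT z|lborel. f z) \<le> B * measure lborel (cball 0 r :: (real ^ 'n) set)"
proof -
  have "norm (LINT z|lborel. f z) \<le> (LINT z|lborel. indicator (cball (0 :: real ^ 'n) r) z *\<^sub>R B)"
  proof (rule Bochner_Integration.integral_norm_bound_integral)
    show "integrable lborel f" by (rule integrable_compact_support[OF f supp])
    show "integrable lborel (\<lambda>z. indicat_real (cball 0 r :: (real ^ 'n) set) z *\<^sub>R B)"
      by (rule borel_integrable_compact) auto
    show "norm (f z) \<le> indicat_real (cball 0 r) z *\<^sub>R B" for z
      using B[of z] supp[of z] by (auto simp: indicator_def not_le)
  qed
  also have "\<dots> = B * measure lborel (cball 0 r :: (real ^ 'n) set)"
    using emeasure_lborel_cball_finite[of "0 :: real ^ 'n" r] by simp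
  finally show ?thesis .
qed

text \<open>A correlation, that is, convolution with the reflected kernel: each derivative moved to
  the kernel brings a minus sign, so the gradient is \<open>- conv f k1\<close> and the Hessian
  \<open>conv f k2\<close>.\<close>

definition conv :: "(real ^ 'n \<Rightarrow> real) \<Rightarrow> (real ^ 'n \<Rightarrow> 'b::{banach, second_countable_topology}) \<Rightarrow> real ^ 'n \<Rightarrow> 'b" where
  "conv f K x = (LINT z|lborel. f (x + z) *\<^sub>R K z)"

lemma conv_integrable:
  fixes f :: "real ^ 'n \<Rightarrow> real" and K :: "real ^ 'n \<Rightarrow> 'b::{banach, second_countable_topology}"
  assumes "continuous_on UNIV f" "continuous_on UNIV K" "\<And>z. r < norm z \<Longrightarrow> K z = 0"
  shows "integrable lborel (\<lambda>z. f (x + z) *\<^sub>R K z)"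
  by (rule integrable_compact_support[of _ r])
    (use assms in \<open>auto intro!: continuous_intros continuous_on_compose2[OF assms(1)]\<close>)

text \<open>Two functions and two base points, so that one estimate yields moduli of continuity, sup
  bounds and closeness of mollifications.\<close>

lemma conv_diff_bound:
  fixes f :: "real ^ 'n \<Rightarrow> real" and K :: "real ^ 'n \<Rightarrow> 'b::{banach, second_countable_topology}"
  assumes f: "continuous_on UNIV f" "continuous_on UNIV f'" and K: "continuous_on UNIV K" "\<And>z. r < norm z \<Longrightarrow> K z = 0"
    and le: "\<And>z. \<bar>f (x + z) - f' (y + z)\<bar> \<le> e"
  shows "norm (conv f K x - conv f' K y) \<le> e * (LINT z|lborel. norm (K z))"
proof -
  have iK: "integrable lborel (\<lambda>z. norm (K z))"
    using integrable_compact_support[OF K] by simp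
  have "conv f K x - conv f' K y = (LINT z|lborel. (f (x + z) - f' (y + z)) *\<^sub>R K z)"
    unfolding conv_def scaleR_left_diff_distrib
    by (rule Bochner_Integration.integral_diff[symmetric, OF conv_integrable[OF f(1) K] conv_integrable[OF f(2) K]])
  also have "norm \<dots> \<le> (LINT z|lborel. e * norm (K z))"
  proof (rule Bochner_Integration.integral_norm_bound_integral)
    show "integrable lborel (\<lambda>z. (f (x + z) - f' (y + z)) *\<^sub>R K z)"
      unfolding scaleR_left_diff_distrib
      by (rule Bochner_Integration.integrable_diff[OF conv_integrable[OF f(1) K] conv_integrable[OF f(2) K]])
    show "norm ((f (x + z) - f' (y + z)) *\<^sub>R K z) \<le> e * norm (K z)" for z
      using le[of z] by (simp add: mult_right_mono)
  qed (use iK in simp)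
  finally show ?thesis by simp
qed

lemma conv_uniformly_continuous:
  fixes f :: "real ^ 'n \<Rightarrow> real" and K :: "real ^ 'n \<Rightarrow> 'b::{banach, second_countable_topology}"
  assumes f: "uniformly_continuous_on UNIV f" and K: "continuous_on UNIV K" "\<And>z. r < norm z \<Longrightarrow> K z = 0"
  shows "uniformly_continuous_on UNIV (conv f K)"
  unfolding uniformly_continuous_on_def
proof (intro allI impI)
  fix e :: real assume "0 < e"
  define I where "I = (LINT z|lborel. norm (K z))"
  have I: "0 \<le> I" by (simp add: I_def)
  have fc: "continuous_on UNIV f" using f uniformly_continuous_imp_continuous by blast
  have "0 < e / (I + 1)" using \<open>0 < e\<close> I by simp
  then obtain d where d: "0 < d" "\<And>x y. dist y x < d \<Longrightarrow> dist (f y) (f x) < e / (I + 1)"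
    using f unfolding uniformly_continuous_on_def by (metis UNIV_I)
  have "dist (conv f K y) (conv f K x) < e" if "dist y x < d" for x y
  proof -
    have "norm (conv f K y - conv f K x) \<le> e / (I + 1) * I"
      unfolding I_def
    proof (rule conv_diff_bound[OF fc fc K])
      show "\<bar>f (y + z) - f (x + z)\<bar> \<le> e / ((LINT z|lborel. norm (K z)) + 1)" for z
        using d(2)[of "y + z" "x + z"] that by (simp add: dist_norm I_def less_imp_le)
    qed
    also have "\<dots> < e" using \<open>0 < e\<close> I by (simp add: field_simps)
    finally show ?thesis by (simp add: dist_norm)
  qed
  then show "\<exists>d>0. \<forall>x\<in>UNIV. \<forall>x'\<in>UNIV. dist x' x < d \<longrightarrow> dist (conv f K x') (conv f K x) < e"
    using d(1) by blast
qed

lemma conv_shift: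
  fixes f :: "real ^ 'n \<Rightarrow> real" and K :: "real ^ 'n \<Rightarrow> 'b::{banach, second_countable_topology}"
  assumes f: "continuous_on UNIV f" and K: "continuous_on UNIV K"
  shows "conv f K (x + h) = (LINT z|lborel. f (x + z) *\<^sub>R K (z - h))"
proof -
  define F where "F z = f (x + z) *\<^sub>R K (z - h)" for z
  have "continuous_on UNIV F"
    unfolding F_def
    by (auto intro!: continuous_intros continuous_on_compose2[OF f] continuous_on_compose2[OF K])
  then have F: "F \<in> borel_measurable borel" by (rule borel_measurable_continuous_onI)
  have "(LINT z|lborel. F z) = (LINT z|distr lborel borel ((+) h). F z)"
    by (simp add: lborel_distr_plus)
  also have "\<dots> = (LINT z|lborel. F (h + z))"
    by (rule integral_distr) (use F in auto)
  finally show ?thesis by (simp add: conv_def F_def add.assoc)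
qed

text \<open>\<open>A\<close> stands for the gradient or Hessian field that represents
  \<open>K'\<close>; its uniform continuity makes the linearization error uniform in
  \<open>z\<close>, hence integrable against bounded functions over a bounded support.\<close>

lemma uniform_linearization:
  fixes K :: "real ^ 'n \<Rightarrow> 'b::real_normed_vector"
  assumes der: "\<And>z. (K has_derivative K' z) (at z)"
    and bnd: "\<And>z z' h. norm (K' z h - K' z' h) \<le> norm (A z - A z') * norm h"
    and A: "uniformly_continuous_on UNIV (A :: real ^ 'n \<Rightarrow> 'c::real_normed_vector)" and "0 < \<epsilon>"
  obtains d where "0 < d" "\<And>z h. norm h < d \<Longrightarrow> norm (K (z + h) - K z - K' z h) \<le> \<epsilon> * norm h"
proof -
  obtain d where d: "0 < d" "\<And>x y. dist y x < d \<Longrightarrow> dist (A y) (A x) < \<epsilon>"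
    using A \<open>0 < \<epsilon>\<close> unfolding uniformly_continuous_on_def by (metis UNIV_I)
  have "norm (K (z + h) - K z - K' z h) \<le> \<epsilon> * norm h" if h: "norm h < d" for z h
  proof -
    have "norm (K (z + h) - K z - K' z ((z + h) - z)) \<le> norm ((z + h) - z) * \<epsilon>"
    proof (rule differentiable_bound_linearization[where S = "ball z d"])
      show "z + t *\<^sub>R (z + h - z) \<in> ball z d" if "t \<in> {0..1}" for t
      proof -
        have "norm (t *\<^sub>R h) \<le> norm h" using that by (simp add: mult_left_le_one_le)
        then show ?thesis using h by (simp add: dist_norm)
      qed
      show "(K has_derivative K' x) (at x within ball z d)" for x
        using der by (rule has_derivative_at_withinI)
      show "onorm (K' x - K' z) \<le> \<epsilon>" if "x \<in> ball z d" for x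
      proof (rule onorm_le)
        fix h :: "real ^ 'n"
        have "norm (A x - A z) \<le> \<epsilon>"
          using d(2)[of x z] that by (simp add: dist_norm norm_minus_commute)
        then have "norm (A x - A z) * norm h \<le> \<epsilon> * norm h" by (rule mult_right_mono) simp
        with bnd[of x h z] show "norm ((K' x - K' z) h) \<le> \<epsilon> * norm h" by simp
      qed
    qed (use d in auto)
    then show ?thesis by (simp add: mult.commute)
  qed
  with d(1) show ?thesis by (rule that)
qed

text \<open>By \<open>conv_shift\<close> the increment falls on the kernel, so \<open>f\<close>
  itself is never differentiated.\<close>

lemma conv_has_derivative:
  fixes f :: "real ^ 'n \<Rightarrow> real" and K :: "real ^ 'n \<Rightarrow> 'b::{banach, second_countable_topology}"
  assumes f: "continuous_on UNIV f" "\<And>x. \<bar>f x\<bar> \<le> M"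
    and K: "continuous_on UNIV K" "\<And>z. r < norm z \<Longrightarrow> K z = 0"
    and der: "\<And>z. (K has_derivative K' z) (at z)"
    and K': "\<And>h. continuous_on UNIV (\<lambda>z. K' z h)" "\<And>z h. r < norm z \<Longrightarrow> K' z h = 0"
    and bnd: "\<And>z z' h. norm (K' z h - K' z' h) \<le> norm (A z - A z') * norm h"
    and A: "uniformly_continuous_on UNIV (A :: real ^ 'n \<Rightarrow> 'c::real_normed_vector)"
    and D: "bounded_linear D" "\<And>h. D h = - conv f (\<lambda>z. K' z h) x"
  shows "(conv f K has_derivative D) (at x)"
  unfolding has_derivative_within_alt
proof (intro conjI allI impI D(1))
  fix e :: real assume "0 < e"
  \<comment> \<open>The radius \<open>r + 1\<close> accommodates the support of \<open>K\<close> and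
    of its translates by vectors shorter than 1.\<close>
  define V where "V = measure lborel (cball 0 (r + 1) :: (real ^ 'n) set)"
  have V: "0 \<le> V" by (simp add: V_def)
  have M: "0 \<le> M" using f(2)[of 0] by linarith
  define \<epsilon> where "\<epsilon> = e / (M * V + 1)"
  have MV: "0 \<le> M * V" using V M by simp
  then have \<epsilon>: "0 < \<epsilon>" "M * V * \<epsilon> \<le> e" using \<open>0 < e\<close> by (auto simp: \<epsilon>_def field_simps)
  obtain d where d: "0 < d" "\<And>z h. norm h < d \<Longrightarrow> norm (K (z + h) - K z - K' z h) \<le> \<epsilon> * norm h"
    using uniform_linearization[OF der bnd A \<epsilon>(1)] by blast
  have "norm (conv f K y - conv f K x - D (y - x)) \<le> e * norm (y - x)" if y: "norm (y - x) < min d 1" for y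
  proof -
    define h where "h = y - x"
    have h: "norm h < d" "norm h < 1" using y by (auto simp: h_def)
    have lin: "K' z (- h) = - K' z h" for z
      using linear_neg[OF has_derivative_linear[OF der]] .
    define F where "F z = f (x + z) *\<^sub>R (K (z - h) - K z + K' z h)" for z
    have Fc: "continuous_on UNIV F" unfolding F_def
      by (auto intro!: continuous_intros continuous_on_compose2[OF f(1)] continuous_on_compose2[OF K(1)] K K')
    have Fs: "F z = 0" if "r + 1 < norm z" for z
    proof -
      have "norm z \<le> norm (z - h) + norm h" by (metis diff_add_cancel norm_triangle_ineq)
      then show ?thesis using that h by (simp add: F_def K K')
    qed
    have Fb: "norm (F z) \<le> M * (\<epsilon> * norm h)" for z
      using d(2)[of "- h" z] h f(2)[of "x + z"] lin[of z] M unfolding F_def norm_scaleR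
      by (intro mult_mono) auto
    have i1: "integrable lborel (\<lambda>z. f (x + z) *\<^sub>R K (z - h))"
    proof (rule integrable_compact_support[where r = "r + 1"])
      show "continuous_on UNIV (\<lambda>z. f (x + z) *\<^sub>R K (z - h))"
        by (auto intro!: continuous_intros continuous_on_compose2[OF f(1)] continuous_on_compose2[OF K(1)])
      show "f (x + z) *\<^sub>R K (z - h) = 0" if "r + 1 < norm z" for z
      proof -
        have "norm z \<le> norm (z - h) + norm h" by (metis diff_add_cancel norm_triangle_ineq)
        then show ?thesis using that h by (simp add: K)
      qed
    qed
    have i2: "integrable lborel (\<lambda>z. f (x + z) *\<^sub>R K z)" by (rule conv_integrable[OF f(1) K])
    have i3: "integrable lborel (\<lambda>z. f (x + z) *\<^sub>R K' z h)" by (rule conv_integrable[OF f(1) K'])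
    have "conv f K y = (LINT z|lborel. f (x + z) *\<^sub>R K (z - h))"
      using conv_shift[OF f(1) K(1), of x h] by (simp add: h_def)
    then have "conv f K y - conv f K x - D (y - x) = (LINT z|lborel. F z)"
      unfolding F_def D(2) h_def[symmetric] using i1 i2 i3
      by (simp add: conv_def[of f K x] conv_def[of f "\<lambda>z. K' z h"] scaleR_right_distrib scaleR_right_diff_distrib)
    also have "norm \<dots> \<le> M * (\<epsilon> * norm h) * V"
      unfolding V_def by (rule norm_integral_compact_support[OF Fc Fs Fb])
    also have "\<dots> = (M * V * \<epsilon>) * norm h" by simp
    also have "\<dots> \<le> e * norm h" using \<epsilon>(2) by (rule mult_right_mono) simp
    finally show ?thesis by (simp add: h_def)
  qed
  then show "\<exists>d>0. \<forall>y\<in>UNIV. norm (y - x) < d \<longrightarrow> norm (conv f K y - conv f K x - D (y - x)) \<le> e * norm (y - x)"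
    using d(1) by (intro exI[of _ "min d 1"]) auto
qed

text \<open>Uniform continuity of the Hessian makes second differences converge uniformly in
  \<open>x\<close>; this is needed because they will be averaged over translations.\<close>

definition C2u :: "(real ^ 'n \<Rightarrow> real) \<Rightarrow> (real ^ 'n \<Rightarrow> real ^ 'n) \<Rightarrow> (real ^ 'n \<Rightarrow> real ^ 'n ^ 'n) \<Rightarrow> bool" where
  "C2u \<phi> g H \<longleftrightarrow> (\<forall>x. (\<phi> has_derivative (\<lambda>h. g x \<bullet> h)) (at x)) \<and>
    (\<forall>x. (g has_derivative (\<lambda>h. H x *v h)) (at x)) \<and> uniformly_continuous_on UNIV H"

text \<open>\<open>k1\<close> and \<open>k2\<close> are the gradient and Hessian of
  \<open>\<rho>\<close>. Two continuous derivatives are asked for, so a truncated polynomial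
  qualifies.\<close>

definition mollifier ::
    "real \<Rightarrow> (real ^ 'n \<Rightarrow> real) \<Rightarrow> (real ^ 'n \<Rightarrow> real ^ 'n) \<Rightarrow> (real ^ 'n \<Rightarrow> real ^ 'n ^ 'n) \<Rightarrow> bool" where
  "mollifier \<delta> \<rho> k1 k2 \<longleftrightarrow> continuous_on UNIV \<rho> \<and> continuous_on UNIV k1 \<and> continuous_on UNIV k2 \<and>
     (\<forall>z. \<delta> < norm z \<longrightarrow> \<rho> z = 0 \<and> k1 z = 0 \<and> k2 z = 0) \<and> (\<forall>z. 0 \<le> \<rho> z) \<and> (LINT z|lborel. \<rho> z) = 1 \<and>
     (\<forall>z. (\<rho> has_derivative (\<lambda>h. k1 z \<bullet> h)) (at z)) \<and> (\<forall>z. (k1 has_derivative (\<lambda>h. k2 z *v h)) (at z))"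

lemma bounded_linear_matrix_left: "bounded_linear (\<lambda>X :: real ^ 'n ^ 'n. X *v h)"
  by (rule bounded_linear_intro[of _ "norm h"])
    (auto simp: matrix_vector_mult_add_rdistrib scaleR_matrix_vector_assoc norm_matrix_vector_mult_le)

lemma conv_bounded_linear:
  assumes T: "bounded_linear T" and f: "continuous_on UNIV f"
    and K: "continuous_on UNIV K" "\<And>z. r < norm z \<Longrightarrow> K z = 0"
  shows "conv f (\<lambda>z. T (K z)) x = T (conv f K x)"
proof -
  interpret bounded_linear T by (rule T)
  have "(LINT z|lborel. T (f (x + z) *\<^sub>R K z)) = T (LINT z|lborel. f (x + z) *\<^sub>R K z)"
    by (rule integral_bounded_linear[OF T conv_integrable[OF f K]])
  then show ?thesis by (simp add: conv_def scaleR)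
qed

lemma conv_C2u:
  fixes f :: "real ^ 'n \<Rightarrow> real"
  assumes f: "uniformly_continuous_on UNIV f" "\<And>x. \<bar>f x\<bar> \<le> M" and m: "mollifier \<delta> \<rho> k1 k2"
  shows "C2u (conv f \<rho>) (\<lambda>x. - conv f k1 x) (conv f k2)"
  unfolding C2u_def
proof (intro conjI allI)
  have fc: "continuous_on UNIV f" using f uniformly_continuous_imp_continuous by blast
  have c: "continuous_on UNIV \<rho>" "continuous_on UNIV k1" "continuous_on UNIV k2"
    and s: "\<And>z. \<delta> < norm z \<Longrightarrow> \<rho> z = 0" "\<And>z. \<delta> < norm z \<Longrightarrow> k1 z = 0" "\<And>z. \<delta> < norm z \<Longrightarrow> k2 z = 0"
    and d: "\<And>z. (\<rho> has_derivative (\<lambda>h. k1 z \<bullet> h)) (at z)" "\<And>z. (k1 has_derivative (\<lambda>h. k2 z *v h)) (at z)"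
    using m by (auto simp: mollifier_def)
  show "(conv f \<rho> has_derivative (\<lambda>h. - conv f k1 x \<bullet> h)) (at x)" for x
  proof (rule conv_has_derivative[OF fc f(2) c(1) s(1) d(1)])
    show "norm (k1 z \<bullet> h - k1 z' \<bullet> h) \<le> norm (k1 z - k1 z') * norm h" for z z' h
      by (metis Cauchy_Schwarz_ineq2 inner_diff_left real_norm_def)
    show "uniformly_continuous_on UNIV k1" by (rule uniformly_continuous_compact_support[OF c(2) s(2)])
    show "- conv f k1 x \<bullet> h = - conv f (\<lambda>z. k1 z \<bullet> h) x" for h
      using conv_bounded_linear[OF bounded_linear_inner_left fc c(2) s(2)] by simp
    show "bounded_linear ((\<bullet>) (- conv f k1 x))" by (rule bounded_linear_inner_right)
  qed (auto intro!: continuous_intros c simp: s)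
  show "((\<lambda>x. - conv f k1 x) has_derivative (\<lambda>h. conv f k2 x *v h)) (at x)" for x
  proof -
    have "(conv f k1 has_derivative (\<lambda>h. - (conv f k2 x *v h))) (at x)"
    proof (rule conv_has_derivative[OF fc f(2) c(2) s(2) d(2)])
      show "norm (k2 z *v h - k2 z' *v h) \<le> norm (k2 z - k2 z') * norm h" for z z' h
        by (metis norm_matrix_vector_mult_le matrix_vector_mult_diff_rdistrib)
      show "uniformly_continuous_on UNIV k2" by (rule uniformly_continuous_compact_support[OF c(3) s(3)])
      show "- (conv f k2 x *v h) = - conv f (\<lambda>z. k2 z *v h) x" for h
        using conv_bounded_linear[OF bounded_linear_matrix_left fc c(3) s(3)] by simp
      show "bounded_linear (\<lambda>h. - (conv f k2 x *v h))"
        by (intro bounded_linear_minus matrix_vector_mul_bounded_linear)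
      show "continuous_on UNIV (\<lambda>z. k2 z *v h)" for h
        by (rule bounded_linear.continuous_on[OF bounded_linear_matrix_left c(3)])
    qed (auto simp: s)
    from has_derivative_minus[OF this] show ?thesis by simp
  qed
  show "uniformly_continuous_on UNIV (conv f k2)"
    by (rule conv_uniformly_continuous[OF f(1) c(3) s(3)])
qed

lemma DERIV_pos_part_power:
  "((\<lambda>s. max 0 s ^ Suc (Suc n)) has_real_derivative real (n + 2) * max 0 s ^ Suc n) (at s)"
proof -
  consider "0 < s" | "s < 0" | "s = 0" by linarith
  then show ?thesis
  proof cases
    case 1
    have "((\<lambda>s. s ^ Suc (Suc n)) has_real_derivative real (n + 2) * max 0 s ^ Suc n) (at s)"
      using 1 DERIV_pow[of "Suc (Suc n)" s] by (simp add: max_def)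
    then show ?thesis
      by (rule has_field_derivative_transform_within_open[of _ _ _ "{0<..}"]) (use 1 in auto)
  next
    case 2
    have "((\<lambda>s. 0) has_real_derivative real (n + 2) * max 0 s ^ Suc n) (at s)"
      using 2 by simp
    then show ?thesis
      by (rule has_field_derivative_transform_within_open[of _ _ _ "{..<0}"]) (use 2 in auto)
  next
    case 3
    have "((\<lambda>h. max 0 h ^ Suc (Suc n) / h) \<longlongrightarrow> 0) (at (0::real))"
    proof (rule Lim_null_comparison)
      show "\<forall>\<^sub>F h in at (0::real). norm (max 0 h ^ Suc (Suc n) / h) \<le> \<bar>h\<bar> ^ Suc n"
        by (intro always_eventually allI) (auto simp: max_def mult_nonpos_nonneg)
      show "((\<lambda>h::real. \<bar>h\<bar> ^ Suc n) \<longlongrightarrow> 0) (at 0)"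
        by (auto intro!: tendsto_eq_intros)
    qed
    then show ?thesis using 3 by (simp add: DERIV_def)
  qed
qed

text \<open>The bump is the cube of the positive part of
  \<open>\<delta>\<^sup>2 - z \<bullet> z\<close>, divided by its integral; with a cube the Hessian
  is still continuous across the sphere.\<close>

lemma ex_mollifier:
  assumes "0 < \<delta>"
  obtains \<rho> :: "real ^ 'n \<Rightarrow> real" and k1 k2 where "mollifier \<delta> \<rho> k1 k2"
proof -
  define m where "m z = max 0 (\<delta>\<^sup>2 - z \<bullet> z)" for z :: "real ^ 'n"
  define \<kappa> where "\<kappa> z = m z ^ 3" for z
  define k1 where "k1 z = (- 6 * m z ^ 2) *\<^sub>R z" for z
  define k2 where "k2 z = (- 6 * m z ^ 2) *\<^sub>R mat 1 + (24 * m z) *\<^sub>R outer z" for z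
  have mc: "continuous_on UNIV m" unfolding m_def by (intro continuous_intros)
  have oc: "continuous_on UNIV (outer :: real ^ 'n \<Rightarrow> _)"
    unfolding outer_def by (intro continuous_intros continuous_on_vec_lambda)
  have c: "continuous_on UNIV \<kappa>" "continuous_on UNIV k1" "continuous_on UNIV k2"
    unfolding \<kappa>_def k1_def k2_def by (intro continuous_intros mc oc)+
  have m0: "m z = 0" if "\<delta> < norm z" for z
  proof -
    have "\<delta>\<^sup>2 < (norm z)\<^sup>2" using that assms by (intro power_strict_mono) auto
    then show ?thesis by (simp add: m_def power2_norm_eq_inner)
  qed
  have s: "\<kappa> z = 0" "k1 z = 0" "k2 z = 0" if "\<delta> < norm z" for z
    using m0[OF that] by (simp_all add: \<kappa>_def k1_def k2_def)
  have inn: "((\<lambda>z :: real ^ 'n. \<delta>\<^sup>2 - z \<bullet> z) has_derivative (\<lambda>h. - (2 * (z \<bullet> h)))) (at z)" for z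
    by (auto intro!: derivative_eq_intros simp: inner_commute)
  have dm: "((\<lambda>z. m z ^ Suc (Suc n)) has_derivative (\<lambda>h. - (2 * (z \<bullet> h)) * (real (n + 2) * m z ^ Suc n))) (at z)" for z n
    using DERIV_compose_FDERIV[OF DERIV_pos_part_power inn] by (simp add: m_def)
  have d1: "(\<kappa> has_derivative (\<lambda>h. k1 z \<bullet> h)) (at z)" for z
    using dm[of 1 z] by (simp add: \<kappa>_def[abs_def] k1_def numeral_3_eq_3 numeral_2_eq_2 mult_ac)
  have d2: "(k1 has_derivative (\<lambda>h. k2 z *v h)) (at z)" for z
  proof -
    have "((\<lambda>z. (- 6 * m z ^ Suc (Suc 0)) *\<^sub>R z) has_derivative
       (\<lambda>h. (- 6 * m z ^ Suc (Suc 0)) *\<^sub>R h + (- 6 * (- (2 * (z \<bullet> h)) * (real (0 + 2) * m z ^ Suc 0))) *\<^sub>R z)) (at z)"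
      by (intro has_derivative_scaleR has_derivative_mult_right dm has_derivative_ident)
    moreover have "(- 6 * m z ^ Suc (Suc 0)) *\<^sub>R h + (- 6 * (- (2 * (z \<bullet> h)) * (real (0 + 2) * m z ^ Suc 0))) *\<^sub>R z
      = k2 z *v h" for h
      unfolding k2_def
      by (simp add: matrix_vector_mult_add_rdistrib matrix_vector_mult_diff_rdistrib
          scaleR_matrix_vector_assoc[symmetric] outer_mult numeral_2_eq_2)
    ultimately show ?thesis by (simp add: k1_def[abs_def] numeral_2_eq_2)
  qed
  define I where "I = (LINT z|lborel. \<kappa> z)"
  have i: "integrable lborel \<kappa>" by (rule integrable_compact_support[OF c(1) s(1)])
  have nn: "0 \<le> \<kappa> z" for z by (simp add: \<kappa>_def m_def)
  have "0 < I"
  proof -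
    \<comment> \<open>On the ball of half the radius the bump is at least
      \<open>(3 / 4 * \<delta>\<^sup>2) ^ 3\<close>, so its integral is positive.\<close>
    define B where "B = cball (0 :: real ^ 'n) (\<delta> / 2)"
    have "0 < measure lborel B" unfolding B_def using assms by (simp add: content_cball_pos)
    moreover have "(LINT z|lborel. indicator B z *\<^sub>R (3 / 4 * \<delta>\<^sup>2) ^ 3) \<le> I"
      unfolding I_def
    proof (rule integral_mono[OF _ i])
      show "integrable lborel (\<lambda>z. indicator B z *\<^sub>R (3 / 4 * \<delta>\<^sup>2) ^ 3)"
        unfolding B_def by (rule borel_integrable_compact) auto
      show "indicator B z *\<^sub>R (3 / 4 * \<delta>\<^sup>2) ^ 3 \<le> \<kappa> z" for z
      proof (cases "z \<in> B")
        case True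
        then have "(norm z)\<^sup>2 \<le> (\<delta> / 2)\<^sup>2" unfolding B_def by (intro power_mono) auto
        then have "3 / 4 * \<delta>\<^sup>2 \<le> \<delta>\<^sup>2 - z \<bullet> z" by (simp add: power2_norm_eq_inner power_divide)
        then have "3 / 4 * \<delta>\<^sup>2 \<le> m z" unfolding m_def by (rule max.coboundedI2)
        then have "(3 / 4 * \<delta>\<^sup>2) ^ 3 \<le> \<kappa> z" unfolding \<kappa>_def by (intro power_mono) auto
        then show ?thesis using True by simp
      qed (use nn in simp)
    qed
    moreover have "(LINT z|lborel. indicator B z *\<^sub>R (3 / 4 * \<delta>\<^sup>2) ^ 3) = measure lborel B * (3 / 4 * \<delta>\<^sup>2) ^ 3"
      using emeasure_lborel_cball_finite[of "0 :: real ^ 'n" "\<delta> / 2"] by (simp add: B_def)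
    moreover have "0 < (3 / 4 * \<delta>\<^sup>2) ^ 3" using assms by simp
    ultimately show ?thesis by (metis mult_pos_pos order_less_le_trans)
  qed
  have "mollifier \<delta> (\<lambda>z. \<kappa> z / I) (\<lambda>z. (1 / I) *\<^sub>R k1 z) (\<lambda>z. (1 / I) *\<^sub>R k2 z)"
    unfolding mollifier_def
  proof (intro conjI allI impI)
    show "((\<lambda>z. \<kappa> z / I) has_derivative (\<lambda>h. ((1 / I) *\<^sub>R k1 z) \<bullet> h)) (at z)" for z
      using has_derivative_mult_right[OF d1[of z], of "1 / I"] by simp
    show "((\<lambda>z. (1 / I) *\<^sub>R k1 z) has_derivative (\<lambda>h. ((1 / I) *\<^sub>R k2 z) *v h)) (at z)" for z
      using has_derivative_scaleR_right[OF d2[of z], of "1 / I"] by (simp add: scaleR_matrix_vector_assoc)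
  qed (use c s nn \<open>0 < I\<close> in \<open>auto intro!: continuous_intros simp: I_def\<close>)
  then show ?thesis by (rule that)
qed

section \<open>Averaging operators and an approximate resolvent\<close>

text \<open>Integration against a finite discrete measure, given as a list of pairs of weight and
  displacement. Commutation with derivatives, linear maps and mollification then follows by
  induction on the list.\<close>

primrec wsum :: "(real \<times> (real ^ 'n)) list \<Rightarrow> (real ^ 'n \<Rightarrow> 'b::real_vector) \<Rightarrow> real ^ 'n \<Rightarrow> 'b" where
  "wsum [] f x = 0"
| "wsum (a # l) f x = fst a *\<^sub>R f (x + snd a) + wsum l f x"

definition nonneg_weights :: "(real \<times> (real ^ 'n)) list \<Rightarrow> bool" where
  "nonneg_weights l \<longleftrightarrow> (\<forall>a\<in>set l. 0 \<le> fst a)"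

definition weight :: "(real \<times> (real ^ 'n)) list \<Rightarrow> real" where
  "weight l = wsum l (\<lambda>_. 1) 0"

definition wscale :: "real \<Rightarrow> real ^ 'n \<Rightarrow> (real \<times> (real ^ 'n)) list \<Rightarrow> (real \<times> (real ^ 'n)) list" where
  "wscale c v l = map (\<lambda>a. (c * fst a, v + snd a)) l"

text \<open>Convolution of the two discrete measures, which composes the operators
  \<open>wsum\<close>.\<close>

definition wcomp :: "(real \<times> (real ^ 'n)) list \<Rightarrow> (real \<times> (real ^ 'n)) list \<Rightarrow> (real \<times> (real ^ 'n)) list" where
  "wcomp l l' = concat (map (\<lambda>a. wscale (fst a) (snd a) l') l)"

lemma wsum_append: "wsum (l @ l') f x = wsum l f x + wsum l' f x"
  by (induction l) (auto simp: add.assoc)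

lemma wsum_wscale: "wsum (wscale c v l) f x = c *\<^sub>R wsum l f (x + v)"
  by (induction l) (auto simp: wscale_def scaleR_right_distrib add.assoc)

lemma wsum_wcomp: "wsum (wcomp l l') f x = wsum l (wsum l' f) x"
  by (induction l) (auto simp: wcomp_def wsum_append wsum_wscale)

lemma wsum_concat: "wsum (concat (map L [0..<n])) f x = (\<Sum>i<n. wsum (L i) f x)"
  by (induction n) (auto simp: wsum_append)

lemma wsum_add: "wsum l (\<lambda>x. f x + g x) x = wsum l f x + wsum l g x"
  by (induction l) (auto simp: scaleR_right_distrib)

lemma wsum_scaleR: "wsum l (\<lambda>x. c *\<^sub>R f x) x = c *\<^sub>R wsum l f x"
  by (induction l) (auto simp: scaleR_right_distrib)

lemma wsum_mult: "wsum l (\<lambda>x. c * f x) x = c * wsum l f x" for f :: "real ^ 'n \<Rightarrow> real"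
  using wsum_scaleR[of l c f x] by simp

lemma wsum_diff: "wsum l (\<lambda>x. f x - g x) x = wsum l f x - wsum l g x"
  by (induction l) (auto simp: scaleR_right_diff_distrib)

lemma wsum_const: "wsum l (\<lambda>_. c) x = weight l * c" for c :: real
  by (induction l) (auto simp: weight_def algebra_simps)

lemma wsum_mono:
  fixes f g :: "real ^ 'n \<Rightarrow> real"
  assumes "nonneg_weights l" "\<And>x. f x \<le> g x"
  shows "wsum l f x \<le> wsum l g x"
  using assms by (induction l) (auto simp: nonneg_weights_def intro!: add_mono mult_left_mono)

lemma wsum_abs_le:
  fixes f :: "real ^ 'n \<Rightarrow> real"
  assumes l: "nonneg_weights l" and f: "\<And>x. \<bar>f x\<bar> \<le> C"
  shows "\<bar>wsum l f x\<bar> \<le> weight l * C"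
proof -
  have "wsum l f x \<le> wsum l (\<lambda>_. C) x"
    using f by (intro wsum_mono[OF l]) (auto simp: abs_le_iff)
  moreover have "wsum l (\<lambda>_. - C) x \<le> wsum l f x"
  proof (intro wsum_mono[OF l])
    show "- C \<le> f x" for x using f[of x] by linarith
  qed
  ultimately show ?thesis by (simp add: wsum_const abs_le_iff)
qed

lemma wsum_continuous: "continuous_on UNIV f \<Longrightarrow> continuous_on UNIV (wsum l (f :: real ^ 'n \<Rightarrow> real))"
proof (induction l)
  case (Cons a l)
  then show ?case
    by (auto intro!: continuous_intros continuous_on_compose2[OF Cons.prems])
qed auto

lemma wsum_has_derivative:
  assumes "\<And>x. (f has_derivative (\<lambda>h. D x h)) (at x)"
  shows "(wsum l f has_derivative (\<lambda>h. wsum l (\<lambda>x. D x h) x)) (at x)"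
proof (induction l)
  case (Cons a l)
  have "((\<lambda>x. x + snd a) has_derivative (\<lambda>h. h)) (at x)"
    by (auto intro!: derivative_eq_intros)
  from has_derivative_compose[OF this assms]
  have "((\<lambda>x. f (x + snd a)) has_derivative (\<lambda>h. D (x + snd a) h)) (at x)" .
  then show ?case
    using Cons.IH by (auto intro!: derivative_intros)
qed auto

lemma wsum_bounded_linear:
  assumes "bounded_linear T"
  shows "wsum l (\<lambda>x. T (f x)) x = T (wsum l f x)"
proof -
  interpret bounded_linear T by fact
  show ?thesis by (induction l) (auto simp: zero add scaleR)
qed

lemma wsum_C2_at:
  assumes "C2u f g H"
  shows "C2_at (wsum l f) (wsum l g) (wsum l H x) x"
  unfolding C2_at_def
proof
  have "(wsum l f has_derivative (\<lambda>h. wsum l g x \<bullet> h)) (at x)" for x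
    using wsum_has_derivative[of f "\<lambda>x h. g x \<bullet> h"] assms
    by (simp add: C2u_def wsum_bounded_linear[OF bounded_linear_inner_left])
  then show "\<forall>\<^sub>F x in nhds x. (wsum l f has_derivative (\<lambda>h. wsum l g x \<bullet> h)) (at x)" by simp
  show "(wsum l g has_derivative (\<lambda>h. wsum l H x *v h)) (at x)"
    using wsum_has_derivative[of g "\<lambda>x h. H x *v h"] assms
    by (simp add: C2u_def wsum_bounded_linear[OF bounded_linear_matrix_left])
qed

lemma bounded_linear_ftrace: "bounded_linear (ftrace k e)"
  unfolding ftrace_def
  by (intro bounded_linear_sum bounded_linear_inner_right[THEN bounded_linear_compose] bounded_linear_matrix_left)

lemma conv_add:
  fixes f :: "real ^ 'n \<Rightarrow> real" and K :: "real ^ 'n \<Rightarrow> real"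
  assumes f: "continuous_on UNIV f" "continuous_on UNIV f'"
    and K: "continuous_on UNIV K" "\<And>z. r < norm z \<Longrightarrow> K z = 0"
  shows "conv (\<lambda>x. f x + f' x) K x = conv f K x + conv f' K x"
  unfolding conv_def scaleR_left_distrib
  by (rule Bochner_Integration.integral_add[OF conv_integrable[OF f(1) K] conv_integrable[OF f(2) K]])

lemma conv_wsum:
  fixes f :: "real ^ 'n \<Rightarrow> real" and K :: "real ^ 'n \<Rightarrow> real"
  assumes f: "continuous_on UNIV f" and K: "continuous_on UNIV K" "\<And>z. r < norm z \<Longrightarrow> K z = 0"
  shows "conv (wsum l f) K x = wsum l (conv f K) x"
proof (induction l)
  case Nil
  then show ?case by (simp add: conv_def)
next
  case (Cons a l)
  have c: "continuous_on UNIV (\<lambda>x. fst a *\<^sub>R f (x + snd a))"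
    by (auto intro!: continuous_intros continuous_on_compose2[OF f])
  have "conv (\<lambda>x. fst a *\<^sub>R f (x + snd a)) K x = fst a *\<^sub>R conv f K (x + snd a)"
  proof -
    have "conv (\<lambda>x. fst a *\<^sub>R f (x + snd a)) K x = (LINT z|lborel. fst a * (f (x + snd a + z) * K z))"
      unfolding conv_def by (simp add: ac_simps)
    also have "\<dots> = fst a * (LINT z|lborel. f (x + snd a + z) * K z)" by (rule integral_mult_right_zero)
    finally show ?thesis by (simp add: conv_def)
  qed
  then show ?case
    using conv_add[OF c wsum_continuous[OF f, of l] K] Cons.IH by simp
qed

text \<open>The centred finite difference that approximates \<open>ftrace k e\<close> of the
  Hessian.\<close>

definition Lh :: "nat \<Rightarrow> (nat \<Rightarrow> real ^ 'n) \<Rightarrow> real \<Rightarrow> (real ^ 'n \<Rightarrow> real) \<Rightarrow> real ^ 'n \<Rightarrow> real" where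
  "Lh k e h f x = (\<Sum>i<k. f (x + h *\<^sub>R e i) + f (x - h *\<^sub>R e i) - 2 * f x) / h\<^sup>2"

text \<open>One step of the symmetric random walk along the frame: \<open>2 * k\<close> neighbours
  of equal weight.\<close>

definition step_avg :: "nat \<Rightarrow> (nat \<Rightarrow> real ^ 'n) \<Rightarrow> real \<Rightarrow> (real \<times> (real ^ 'n)) list" where
  "step_avg k e h = concat (map (\<lambda>i. [(1 / (2 * real k), h *\<^sub>R e i), (1 / (2 * real k), - (h *\<^sub>R e i))]) [0..<k])"

lemma wsum_step_avg:
  "wsum (step_avg k e h) f x = (\<Sum>i<k. f (x + h *\<^sub>R e i) + f (x - h *\<^sub>R e i)) / (2 * real k)"
  for f :: "real ^ 'n \<Rightarrow> real"
  unfolding step_avg_def wsum_concat by (simp add: sum_divide_distrib add_divide_distrib)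

lemma Lh_step_avg:
  assumes "0 < k" "0 < h"
  shows "s * Lh k e h f x = 2 * real k * s / h\<^sup>2 * (wsum (step_avg k e h) f x - f x)"
  using assms by (simp add: wsum_step_avg Lh_def sum_subtractf field_simps)

text \<open>The weights are those of the truncated Neumann series of \<open>(1 - s Lh)\<^sup>-\<^sup>1\<close>, expanded around the
  averaging operator.\<close>

lemma approx_resolvent:
  fixes e :: "nat \<Rightarrow> real ^ 'n"
  assumes k: "0 < k" and h: "0 < h" and s: "0 < s" and \<epsilon>: "0 < \<epsilon>"
  obtains l where "nonneg_weights l" "weight l \<le> 1" "1 - \<epsilon> \<le> weight l"
    "\<And>f x. (\<And>x. 0 \<le> f x) \<Longrightarrow> wsum l f x - s * wsum l (Lh k e h f) x \<le> f x"
    "\<And>f x C. (\<And>x. \<bar>f x\<bar> \<le> C) \<Longrightarrow> \<bar>wsum l f x - s * wsum l (Lh k e h f) x - f x\<bar> \<le> \<epsilon> * C"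
proof -
  \<comment> \<open>With \<open>S\<close> the one-step average, \<open>1 - s Lh\<close> equals
    \<open>(1 + A) - A S\<close>. Its inverse is the geometric series in \<open>\<theta> S\<close>
    divided by \<open>1 + A\<close>, a positive combination of translations; \<open>J\<close>
    truncates it with error below \<open>\<epsilon>\<close>.\<close>
  define A where "A = 2 * real k * s / h\<^sup>2"
  have A: "0 < A" using k h s by (simp add: A_def)
  define \<theta> where "\<theta> = A / (1 + A)"
  have \<theta>: "0 < \<theta>" "\<theta> < 1" using A by (auto simp: \<theta>_def field_simps)
  obtain J where J: "\<theta> ^ J < \<epsilon>" using real_arch_pow_inv[OF \<epsilon> \<theta>(2)] by blast
  define S where "S = step_avg k e h"
  define P where "P = rec_nat [(1, 0)] (\<lambda>_ l. wcomp l S)"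
  have P: "P 0 = [(1, 0)]" "\<And>j. P (Suc j) = wcomp (P j) S" by (simp_all add: P_def)
  have S: "nonneg_weights S" "weight S = 1"
    using k wsum_step_avg[of k e h "\<lambda>_. 1" 0] by (auto simp: S_def weight_def step_avg_def nonneg_weights_def)
  have Pj: "nonneg_weights (P j)" "weight (P j) = 1" for j
  proof (induction j)
    case 0
    { case 1 show ?case by (simp add: P nonneg_weights_def) }
    { case 2 show ?case by (simp add: P weight_def) }
  next
    case (Suc j)
    { case 1 show ?case using Suc S unfolding P
        by (auto simp: nonneg_weights_def wcomp_def wscale_def) }
    { case 2
      have "wsum S (\<lambda>_. 1 :: real) = (\<lambda>_. 1)" using S by (simp add: fun_eq_iff wsum_const)
      then show ?case using Suc(2) by (simp add: weight_def P wsum_wcomp) }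
  qed
  define l where "l = concat (map (\<lambda>j. wscale (\<theta> ^ j / (1 + A)) 0 (P j)) [0..<J])"
  have nn: "nonneg_weights l"
    using Pj(1) \<theta> A by (auto simp: l_def nonneg_weights_def wscale_def)
  \<comment> \<open>The partial sum telescopes, leaving the remainder
    \<open>\<theta> ^ J * wsum (P J) f x\<close>. Its sign for nonnegative \<open>f\<close> gives
    the one-sided estimate, which also covers unbounded \<open>f\<close>; its size gives the
    two-sided one.\<close>
  have key: "wsum l f x - s * wsum l (Lh k e h f) x = f x - \<theta> ^ J * wsum (P J) f x" for f x
  proof -
    have "wsum l f x - s * wsum l (Lh k e h f) x = wsum l (\<lambda>x. f x - s * Lh k e h f x) x"
      by (simp add: wsum_diff wsum_mult)
    also have "(\<lambda>x. f x - s * Lh k e h f x) = (\<lambda>x. (1 + A) * f x - A * wsum S f x)"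
      unfolding Lh_step_avg[OF k h] A_def[symmetric] S_def[symmetric] by (simp add: algebra_simps)
    also have "wsum l \<dots> x = (1 + A) * wsum l f x - A * wsum l (wsum S f) x"
      by (simp only: wsum_diff wsum_mult)
    also have "\<dots> = (\<Sum>j<J. \<theta> ^ j * wsum (P j) f x - \<theta> ^ Suc j * wsum (P (Suc j)) f x)"
      unfolding l_def wsum_concat wsum_wscale P wsum_wcomp sum_subtractf sum_distrib_left
    proof (intro arg_cong2[of _ _ _ _ "(-)"] sum.cong refl)
      show "(1 + A) * ((\<theta> ^ j / (1 + A)) *\<^sub>R wsum (P j) f (x + 0)) = \<theta> ^ j * wsum (P j) f x" for j
        using A by simp
      show "A * ((\<theta> ^ j / (1 + A)) *\<^sub>R wsum (P j) (wsum S f) (x + 0)) = \<theta> ^ Suc j * wsum (P j) (wsum S f) x" for j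
        by (simp add: \<theta>_def)
    qed
    also have "\<dots> = wsum (P 0) f x - \<theta> ^ J * wsum (P J) f x"
      using sum_lessThan_telescope'[of "\<lambda>j. \<theta> ^ j * wsum (P j) f x" J] by simp
    finally show ?thesis by (simp add: P)
  qed
  have "weight l = 1 - \<theta> ^ J"
  proof -
    have "Lh k e h (\<lambda>_. 1) = (\<lambda>_. 0)" by (simp add: Lh_def fun_eq_iff)
    then show ?thesis
      using key[of "\<lambda>_. 1" 0] Pj(2)[of J] by (simp add: wsum_const)
  qed
  then have w: "weight l \<le> 1" "1 - \<epsilon> \<le> weight l" using J \<theta> by auto
  show ?thesis
  proof (rule that[OF nn w])
    show "wsum l f x - s * wsum l (Lh k e h f) x \<le> f x" if "\<And>x. 0 \<le> f x" for f x
    proof -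
      have "wsum (P J) (\<lambda>_. 0) x \<le> wsum (P J) f x" by (rule wsum_mono[OF Pj(1) that])
      then show ?thesis using \<theta> by (simp add: key wsum_const)
    qed
    show "\<bar>wsum l f x - s * wsum l (Lh k e h f) x - f x\<bar> \<le> \<epsilon> * C" if "\<And>x. \<bar>f x\<bar> \<le> C" for f x C
    proof -
      have "\<bar>wsum (P J) f x\<bar> \<le> C" using wsum_abs_le[OF Pj(1)[of J] that, where x = x] Pj(2) by simp
      then have "\<theta> ^ J * \<bar>wsum (P J) f x\<bar> \<le> \<epsilon> * C"
        using J \<theta> \<epsilon> by (intro mult_mono) auto
      then show ?thesis using \<theta> by (simp add: key abs_mult)
    qed
  qed
qed

lemma C2u_uniform_taylor:
  assumes "C2u f g H" "0 < \<epsilon>"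
  obtains d where "0 < d" "\<And>x v. norm v < d \<Longrightarrow>
    \<bar>f (x + v) - f x - g x \<bullet> v - v \<bullet> (H x *v v) / 2\<bar> \<le> \<epsilon> * (norm v)\<^sup>2"
proof -
  have der: "\<And>x. (f has_derivative (\<lambda>h. g x \<bullet> h)) (at x)" "\<And>x. (g has_derivative (\<lambda>h. H x *v h)) (at x)"
    and uc: "uniformly_continuous_on UNIV H" using assms by (auto simp: C2u_def)
  have "norm (H z *v h - H z' *v h) \<le> norm (H z - H z') * norm h" for z z' h
    by (metis norm_matrix_vector_mult_le matrix_vector_mult_diff_rdistrib)
  from uniform_linearization[OF der(2) this uc assms(2)]
  obtain d where d: "0 < d" "\<And>z h. norm h < d \<Longrightarrow> norm (g (z + h) - g z - H z *v h) \<le> \<epsilon> * norm h"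
    by blast
  have "\<bar>f (x + v) - f x - g x \<bullet> v - v \<bullet> (H x *v v) / 2\<bar> \<le> \<epsilon> * (norm v)\<^sup>2" if "norm v < d" for x v
  proof -
    have "norm (g y - g x - H x *v (y - x)) \<le> \<epsilon> * norm (y - x)" if "y \<in> ball x d" for y
      using d(2)[of "y - x" x] that by (simp add: dist_norm norm_minus_commute)
    from taylor2_ball[OF der(1) this assms(2), where x = "x + v"] that show ?thesis
      by (simp add: dist_norm)
  qed
  with d(1) show ?thesis by (rule that)
qed

text \<open>The gradient terms at \<open>h\<close> and \<open>- h\<close> cancel. Uniformity in
  \<open>x\<close> allows \<open>h\<close> to be fixed before the list of translations is
  chosen.\<close>

lemma C2u_Lh:
  fixes e :: "nat \<Rightarrow> real ^ 'n"
  assumes C: "C2u f g H" and e: "frame k e" and "0 < \<epsilon>"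
  obtains d where "0 < d" "\<And>h x. 0 < h \<Longrightarrow> h < d \<Longrightarrow> \<bar>Lh k e h f x - ftrace k e (H x)\<bar> \<le> \<epsilon>"
proof -
  define \<epsilon>' where "\<epsilon>' = \<epsilon> / (2 * real k + 1)"
  have \<epsilon>': "0 < \<epsilon>'" "2 * real k * \<epsilon>' \<le> \<epsilon>" using \<open>0 < \<epsilon>\<close> by (auto simp: \<epsilon>'_def field_simps)
  obtain d where d: "0 < d" "\<And>x v. norm v < d \<Longrightarrow>
      \<bar>f (x + v) - f x - g x \<bullet> v - v \<bullet> (H x *v v) / 2\<bar> \<le> \<epsilon>' * (norm v)\<^sup>2"
    using C2u_uniform_taylor[OF C \<epsilon>'(1)] by blast
  have "\<bar>Lh k e h f x - ftrace k e (H x)\<bar> \<le> \<epsilon>" if h: "0 < h" "h < d" for h x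
  proof -
    have 1: "\<bar>f (x + h *\<^sub>R e i) + f (x - h *\<^sub>R e i) - 2 * f x - h\<^sup>2 * (e i \<bullet> (H x *v e i))\<bar> \<le> 2 * \<epsilon>' * h\<^sup>2"
      if "i < k" for i
    proof -
      have n: "norm (h *\<^sub>R e i) = h" "norm (- (h *\<^sub>R e i)) = h" using frame_norm[OF e that] h by auto
      have neg: "H x *v (- (h *\<^sub>R e i)) = - (h *\<^sub>R (H x *v e i))"
        by (metis matrix_vector_mult_scaleR scaleR_minus_left)
      show ?thesis
        using d(2)[of "h *\<^sub>R e i" x] d(2)[of "- (h *\<^sub>R e i)" x] h unfolding n neg
        by (simp add: matrix_vector_mult_scaleR power2_eq_square abs_le_iff)
    qed
    have "h\<^sup>2 * (Lh k e h f x - ftrace k e (H x)) =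
        (\<Sum>i<k. f (x + h *\<^sub>R e i) + f (x - h *\<^sub>R e i) - 2 * f x - h\<^sup>2 * (e i \<bullet> (H x *v e i)))"
    proof -
      have "h\<^sup>2 * Lh k e h f x = (\<Sum>i<k. f (x + h *\<^sub>R e i) + f (x - h *\<^sub>R e i) - 2 * f x)"
        using h by (simp add: Lh_def)
      then show ?thesis by (simp only: right_diff_distrib ftrace_def sum_subtractf sum_distrib_left)
    qed
    also have "\<bar>\<dots>\<bar> \<le> (\<Sum>i<k. 2 * \<epsilon>' * h\<^sup>2)"
      by (rule order_trans[OF sum_abs sum_mono]) (use 1 in auto)
    also have "\<dots> = h\<^sup>2 * (2 * real k * \<epsilon>')" by simp
    finally have "h\<^sup>2 * \<bar>Lh k e h f x - ftrace k e (H x)\<bar> \<le> h\<^sup>2 * (2 * real k * \<epsilon>')"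
      by (simp add: abs_mult)
    then have "\<bar>Lh k e h f x - ftrace k e (H x)\<bar> \<le> 2 * real k * \<epsilon>'"
      using h by (simp add: mult_le_cancel_left)
    then show ?thesis using \<epsilon>'(2) by linarith
  qed
  with d(1) show ?thesis by (rule that)
qed

section \<open>Mollified viscosity subsolutions\<close>

lemma quartic_C2:
  fixes z :: "real ^ 'n" and K :: real
  defines "g \<equiv> \<lambda>x. (4 * K * ((x - z) \<bullet> (x - z))) *\<^sub>R (x - z)"
    and "H \<equiv> \<lambda>x. (4 * K * ((x - z) \<bullet> (x - z))) *\<^sub>R mat 1 + (8 * K) *\<^sub>R outer (x - z)"
  shows "C2_at (\<lambda>x. K * (norm (x - z)) ^ 4) g (H y) y"
proof -
  have n4: "(norm v) ^ 4 = (v \<bullet> v) * (v \<bullet> v)" for v :: "real ^ 'n"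
    by (simp add: power2_norm_eq_inner[symmetric] power4_eq_xxxx power2_eq_square)
  have d: "((\<lambda>x. K * (norm (x - z)) ^ 4) has_derivative (\<lambda>h. g x \<bullet> h)) (at x)" for x
    unfolding n4 g_def
    by (auto intro!: derivative_eq_intros simp: inner_commute algebra_simps)
  have "(g has_derivative (\<lambda>h. (4 * K * ((y - z) \<bullet> (y - z))) *\<^sub>R h + (4 * K * (2 * ((y - z) \<bullet> h))) *\<^sub>R (y - z))) (at y)"
    unfolding g_def
    by (auto intro!: derivative_eq_intros simp: inner_commute)
  moreover have "(4 * K * ((y - z) \<bullet> (y - z))) *\<^sub>R h + (4 * K * (2 * ((y - z) \<bullet> h))) *\<^sub>R (y - z) = H y *v h" for h
    by (simp add: H_def matrix_vector_mult_add_rdistrib scaleR_matrix_vector_assoc[symmetric] outer_mult)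
  ultimately show ?thesis using d by (simp add: C2_at_def)
qed

lemma C2_at_add:
  assumes "C2_at f g H x" "C2_at f' g' H' x"
  shows "C2_at (\<lambda>x. f x + f' x) (\<lambda>x. g x + g' x) (H + H') x"
  unfolding C2_at_def
proof
  show "\<forall>\<^sub>F x in nhds x. ((\<lambda>x. f x + f' x) has_derivative (\<lambda>h. (g x + g' x) \<bullet> h)) (at x)"
    using assms[unfolded C2_at_def, THEN conjunct1]
    by eventually_elim (auto intro!: derivative_eq_intros simp: inner_add_left)
  show "((\<lambda>x. g x + g' x) has_derivative (\<lambda>h. (H + H') *v h)) (at x)"
    using assms unfolding C2_at_def
    by (auto intro!: derivative_eq_intros simp: matrix_vector_mult_add_rdistrib)
qed

definition viscosity_ge :: "nat \<Rightarrow> (nat \<Rightarrow> real ^ 'n) \<Rightarrow> real \<Rightarrow> (real ^ 'n \<Rightarrow> real) \<Rightarrow> (real ^ 'n) set \<Rightarrow> bool" where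
  "viscosity_ge k e C f D \<longleftrightarrow> (\<forall>x\<in>D. \<forall>\<phi> g H. touches_above \<phi> g H f x \<longrightarrow> - C \<le> ftrace k e H)"

text \<open>The quartic penalty localizes the maximum principle at a cost of only \<open>O(s\<^sup>2)\<close>, which is still
  negligible after division by \<open>s\<close>.\<close>

lemma viscosity_ge_le_resolvent:
  fixes f :: "real ^ 'n \<Rightarrow> real"
  assumes e: "frame k e" and r: "0 < r" and M: "0 \<le> M"
    and f: "continuous_on UNIV f" "\<And>x. \<bar>f x\<bar> \<le> M" "viscosity_ge k e C f (cball z r)"
    and w: "\<And>x. C2_at w g (H x) x" "\<And>x. \<bar>w x\<bar> \<le> M"
    and res: "\<And>x. f x - \<eta> \<le> w x - s * ftrace k e (H x)" and s: "0 < s"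
  shows "f z \<le> w z + s * C + \<eta> + (5 * (M + 1) / r ^ 4) * (4 * (real k + 2)\<^sup>2) * s\<^sup>2"
proof -
  \<comment> \<open>On the sphere of radius \<open>r\<close> the penalty equals
    \<open>5 * (M + 1)\<close>, more than the possible variation \<open>4 * M\<close> of
    \<open>f - w\<close>; so the maximum is interior.\<close>
  define K where "K = 5 * (M + 1) / r ^ 4"
  have K: "0 < K" using M r by (simp add: K_def)
  define \<beta> where "\<beta> x = K * (norm (x - z)) ^ 4" for x
  have wc: "continuous_on UNIV w"
    using C2_at_isCont[OF w(1)] by (auto simp: continuous_on_eq_continuous_at)
  have "continuous_on (cball z r) (\<lambda>x. f x - w x - \<beta> x)"
    unfolding \<beta>_def using f(1) wc continuous_on_subset by (intro continuous_intros) auto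
  moreover have "cball z r \<noteq> {}" using r by auto
  ultimately obtain y where y: "y \<in> cball z r"
    and mx: "\<And>x. x \<in> cball z r \<Longrightarrow> f x - w x - \<beta> x \<le> f y - w y - \<beta> y"
    using continuous_attains_sup[OF compact_cball, of z r "\<lambda>x. f x - w x - \<beta> x"] by blast
  have ge: "f z - w z \<le> f y - w y - \<beta> y" using mx[of z] r by (simp add: \<beta>_def)
  have "dist z y \<noteq> r"
  proof
    assume "dist z y = r"
    then have "\<beta> y = 5 * (M + 1)" using r by (simp add: \<beta>_def K_def dist_norm norm_minus_commute)
    then show False using ge f(2)[of z] f(2)[of y] w(2)[of z] w(2)[of y] M by (simp add: abs_le_iff)
  qed
  then have yb: "y \<in> ball z r" using y by simp
  define gb where "gb x = (4 * K * ((x - z) \<bullet> (x - z))) *\<^sub>R (x - z)" for x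
  define Hb where "Hb = (4 * K * ((y - z) \<bullet> (y - z))) *\<^sub>R mat 1 + (8 * K) *\<^sub>R outer (y - z)"
  have "C2_at (\<lambda>x. (w x + \<beta> x) + (f y - w y - \<beta> y)) (\<lambda>x. g x + gb x) (H y + Hb) y"
    unfolding \<beta>_def gb_def Hb_def by (intro C2_at_add_const C2_at_add quartic_C2 w(1))
  moreover have "\<forall>\<^sub>F x in nhds y. f x \<le> (w x + \<beta> x) + (f y - w y - \<beta> y)"
    using eventually_nhds_in_open[OF open_ball yb]
    by eventually_elim (use mx in \<open>force simp: algebra_simps\<close>)
  ultimately have "touches_above (\<lambda>x. (w x + \<beta> x) + (f y - w y - \<beta> y)) (\<lambda>x. g x + gb x) (H y + Hb) f y"
    by (simp add: touches_above_def)
  then have "- C \<le> ftrace k e (H y + Hb)" using f(3) y unfolding viscosity_ge_def by blast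
  define Y where "Y = (y - z) \<bullet> (y - z)"
  have "ftrace k e Hb = 4 * K * Y * real k + 8 * K * (\<Sum>i<k. (e i \<bullet> (y - z))\<^sup>2)"
    by (simp add: Hb_def ftrace_add ftrace_scaleR ftrace_mat[OF e] ftrace_outer Y_def)
  also have "\<dots> \<le> 4 * K * Y * real k + 8 * K * Y"
    using frame_bessel[OF e, of "y - z"] K by (simp add: Y_def mult_left_mono)
  finally have Hb: "ftrace k e Hb \<le> 4 * K * (real k + 2) * Y" by (simp add: algebra_simps)
  have "- C - 4 * K * (real k + 2) * Y \<le> ftrace k e (H y)"
    using \<open>- C \<le> ftrace k e (H y + Hb)\<close> Hb by (simp add: ftrace_add)
  then have "s * (- C - 4 * K * (real k + 2) * Y) \<le> s * ftrace k e (H y)"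
    using s by (intro mult_left_mono) auto
  then have "f y - w y \<le> \<eta> + s * C + 4 * K * (real k + 2) * Y * s"
    using res[of y] by (simp add: algebra_simps)
  moreover have "\<beta> y = K * Y\<^sup>2"
    by (simp add: \<beta>_def Y_def power2_norm_eq_inner[symmetric] flip: power_mult)
  \<comment> \<open>Completing the square: the quartic penalty is quadratic in \<open>Y\<close>
    while its trace is only linear in \<open>Y\<close>, and the trace carries a factor
    \<open>s\<close>. Hence the net cost is of order \<open>s\<^sup>2\<close>.\<close>
  moreover have "4 * K * (real k + 2) * Y * s - K * Y\<^sup>2 \<le> K * (4 * (real k + 2)\<^sup>2) * s\<^sup>2"
  proof -
    have "0 \<le> K * (Y - 2 * (real k + 2) * s)\<^sup>2" using K by simp
    then show ?thesis by (simp add: power2_eq_square algebra_simps)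
  qed
  ultimately show ?thesis using ge unfolding K_def[symmetric] by linarith
qed

lemma conv_const: "mollifier \<delta> \<rho> k1 k2 \<Longrightarrow> conv (\<lambda>_. c) \<rho> x = c"
  by (simp add: conv_def mollifier_def)

lemma conv_mono:
  assumes m: "mollifier \<delta> \<rho> k1 k2" and f: "continuous_on UNIV f" "continuous_on UNIV f'"
    and le: "\<And>z. norm z \<le> \<delta> \<Longrightarrow> f (x + z) \<le> f' (x + z)"
  shows "conv f \<rho> x \<le> conv f' \<rho> x"
proof -
  have K: "continuous_on UNIV \<rho>" "\<And>z. \<delta> < norm z \<Longrightarrow> \<rho> z = 0" and nn: "\<And>z. 0 \<le> \<rho> z"
    using m by (auto simp: mollifier_def)
  show ?thesis unfolding conv_def
  proof (rule integral_mono[OF conv_integrable[OF f(1) K] conv_integrable[OF f(2) K]])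
    show "f (x + z) *\<^sub>R \<rho> z \<le> f' (x + z) *\<^sub>R \<rho> z" for z
      using le[of z] nn[of z] K(2)[of z] by (cases "\<delta> < norm z") (auto intro: mult_right_mono)
  qed
qed

lemma conv_close:
  assumes m: "mollifier \<delta> \<rho> k1 k2" and f: "continuous_on UNIV f"
    and le: "\<And>z. norm z \<le> \<delta> \<Longrightarrow> \<bar>f (x + z) - c\<bar> \<le> \<eta>"
  shows "\<bar>conv f \<rho> x - c\<bar> \<le> \<eta>"
proof -
  have b: "f (x + z) \<le> c + \<eta>" "c - \<eta> \<le> f (x + z)" if "norm z \<le> \<delta>" for z
    using le[OF that] by (auto simp: abs_le_iff)
  have "conv f \<rho> x \<le> conv (\<lambda>_. c + \<eta>) \<rho> x"
    by (rule conv_mono[OF m f]) (use b in auto)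
  moreover have "conv (\<lambda>_. c - \<eta>) \<rho> x \<le> conv f \<rho> x"
    by (rule conv_mono[OF m _ f]) (use b in auto)
  ultimately show ?thesis by (simp add: conv_const[OF m] abs_le_iff)
qed

lemma conv_abs_le:
  assumes m: "mollifier \<delta> \<rho> k1 k2" and f: "continuous_on UNIV f" "\<And>x. \<bar>f x\<bar> \<le> M"
  shows "\<bar>conv f \<rho> x\<bar> \<le> M"
  using conv_close[OF m f(1), of x 0 M] f(2) by simp

text \<open>Near \<open>x0\<close> uniform continuity suffices; farther away the bound
  \<open>2 * B\<close> is absorbed by the quadratic term. Averages of \<open>f\<close> are thus
  controlled by second moments.\<close>

lemma uniformly_continuous_quadratic_bound:
  fixes f :: "real ^ 'n \<Rightarrow> real"
  assumes f: "uniformly_continuous_on UNIV f" "\<And>x. \<bar>f x\<bar> \<le> B" and "0 < \<epsilon>"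
  obtains L where "0 \<le> L" "\<And>x. f x \<le> f x0 + \<epsilon> + L * ((x - x0) \<bullet> (x - x0))"
proof -
  obtain d where d: "0 < d" "\<And>x y. dist y x < d \<Longrightarrow> dist (f y) (f x) < \<epsilon>"
    using f(1) \<open>0 < \<epsilon>\<close> unfolding uniformly_continuous_on_def by (metis UNIV_I)
  have B: "0 \<le> B" using f(2)[of 0] by linarith
  define L where "L = 2 * B / d\<^sup>2"
  have L: "0 \<le> L" using B by (simp add: L_def)
  have "f x \<le> f x0 + \<epsilon> + L * ((x - x0) \<bullet> (x - x0))" for x
  proof (cases "dist x x0 < d")
    case True
    moreover have "0 \<le> L * ((x - x0) \<bullet> (x - x0))" using L by simp
    ultimately show ?thesis using d(2)[of x x0] by (simp add: dist_real_def abs_less_iff)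
  next
    case False
    then have "d\<^sup>2 \<le> (norm (x - x0))\<^sup>2" using d(1) by (intro power_mono) (auto simp: dist_norm)
    then have "2 * B \<le> L * ((x - x0) \<bullet> (x - x0))"
      using d(1) B by (simp add: L_def power2_norm_eq_inner[symmetric] field_simps mult_left_mono)
    then show ?thesis using f(2)[of x] f(2)[of x0] \<open>0 < \<epsilon>\<close> by (simp add: abs_le_iff)
  qed
  with L show ?thesis by (rule that)
qed

text \<open>An exact identity, which yields the second moment of the resolvent weights.\<close>

lemma Lh_square: "frame k e \<Longrightarrow> 0 < h \<Longrightarrow> Lh k e h (\<lambda>x. (x - x0) \<bullet> (x - x0)) x = 2 * real k"
proof -
  assume e: "frame k e" and h: "0 < h"
  have "(x + h *\<^sub>R e i - x0) \<bullet> (x + h *\<^sub>R e i - x0) + (x - h *\<^sub>R e i - x0) \<bullet> (x - h *\<^sub>R e i - x0)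
      - 2 * ((x - x0) \<bullet> (x - x0)) = 2 * h\<^sup>2" if "i < k" for i
  proof -
    have "e i \<bullet> e i = 1" using e that by (simp add: frame_def)
    then show ?thesis
      by (simp add: inner_add_left inner_add_right inner_diff_left inner_diff_right inner_commute power2_eq_square algebra_simps)
  qed
  then show ?thesis using h by (simp add: Lh_def)
qed

text \<open>Viscosity comparison gives \<open>f \<le> R f + s * C\<close> up to order
  \<open>s\<^sup>2\<close>, where \<open>R\<close> is the approximate resolvent. Mollification
  commutes with \<open>R\<close>, so the same holds for \<open>\<phi> = conv f \<rho>\<close>. For
  the smooth \<open>\<phi>\<close>, \<open>R \<phi> - \<phi>\<close> is about \<open>s * R D\<close>
  with \<open>D\<close> the frame trace of its Hessian, and \<open>R D\<close> is close to
  \<open>D x0\<close> because the weights concentrate as \<open>s\<close> tends to 0.\<close>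

theorem mollified_subsolution:
  fixes f :: "real ^ 'n \<Rightarrow> real"
  assumes k: "0 < k" and e: "frame k e" and m: "mollifier \<delta> \<rho> k1 k2" and r: "0 < r"
    and f: "uniformly_continuous_on UNIV f" "\<And>x. \<bar>f x\<bar> \<le> M"
    and vis: "\<And>z. z \<in> cball x0 \<delta> \<Longrightarrow> viscosity_ge k e C f (cball z r)"
  shows "- C \<le> ftrace k e (conv f k2 x0)"
proof -
  have fc: "continuous_on UNIV f" using f uniformly_continuous_imp_continuous by blast
  have M: "0 \<le> M" using f(2)[of 0] by linarith
  have \<rho>: "continuous_on UNIV \<rho>" "\<And>z. \<delta> < norm z \<Longrightarrow> \<rho> z = 0" and k2: "continuous_on UNIV k2" "\<And>z. \<delta> < norm z \<Longrightarrow> k2 z = 0"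
    using m by (auto simp: mollifier_def)
  define \<phi> where "\<phi> = conv f \<rho>"
  define D where "D x = ftrace k e (conv f k2 x)" for x
  have \<phi>C2: "C2u \<phi> (\<lambda>x. - conv f k1 x) (conv f k2)"
    unfolding \<phi>_def by (rule conv_C2u[OF f m])
  have Duc: "uniformly_continuous_on UNIV D"
    unfolding D_def
    by (rule bounded_linear.uniformly_continuous_on[OF bounded_linear_ftrace conv_uniformly_continuous[OF f(1) k2]])
  obtain B where B: "\<And>x. \<bar>D x\<bar> \<le> B"
  proof -
    define c where "c = M * (LINT z|lborel. norm (k2 z))"
    have "norm (conv f k2 x) \<le> c" for x
    proof -
      have "norm (conv f k2 x - conv (\<lambda>_. 0) k2 x) \<le> c"
        unfolding c_def
      proof (rule conv_diff_bound[where r = \<delta>, OF fc continuous_on_const k2])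
        show "\<bar>f (x + z) - 0\<bar> \<le> M" for z using f(2)[of "x + z"] by simp
      qed
      then show ?thesis by (simp add: conv_def)
    qed
    moreover obtain b where b: "\<And>X :: real ^ 'n ^ 'n. norm (ftrace k e X) \<le> norm X * b" "0 \<le> b"
      using bounded_linear.nonneg_bounded[OF bounded_linear_ftrace] by blast
    ultimately have "\<bar>D x\<bar> \<le> c * b" for x
      unfolding D_def using mult_right_mono[of "norm (conv f k2 x)" c b] b(1)[of "conv f k2 x"] by fastforce
    then show ?thesis by (rule that)
  qed
  have B0: "0 \<le> B" using B[of 0] by linarith
  define Q where "Q = (5 * (M + 1) / r ^ 4) * (4 * (real k + 2)\<^sup>2)"
  \<comment> \<open>Here \<open>\<eta>\<close> collects all errors of auxiliary mollification,
    finite differences and truncation, \<open>\<epsilon>\<close> and \<open>L\<close> the continuity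
    of \<open>D\<close>. The limits are taken in the order \<open>\<eta>\<close>, \<open>s\<close>,
    \<open>\<epsilon>\<close>; division by \<open>s\<close> requires that \<open>\<eta>\<close> has
    gone first.\<close>
  have main: "0 \<le> s * (C + D x0 + \<epsilon>) + s\<^sup>2 * (Q + 2 * L * real k) + \<eta> * (4 + s * (3 + B + \<epsilon>))"
    if s: "0 < s" and \<epsilon>: "0 < \<epsilon>" and L: "0 \<le> L" "\<And>x. D x \<le> D x0 + \<epsilon> + L * ((x - x0) \<bullet> (x - x0))"
      and \<eta>: "0 < \<eta>" "\<eta> < 1" for s \<epsilon> L \<eta>
  proof -
    obtain d where d: "0 < d" "\<And>x y. dist y x < d \<Longrightarrow> dist (f y) (f x) < \<eta>"
      using f(1) \<eta>(1) unfolding uniformly_continuous_on_def by (metis UNIV_I)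
    \<comment> \<open>Averaging by translations does not smooth \<open>f\<close>; a second
      mollification at a scale tied to \<open>\<eta>\<close> makes \<open>w = wsum l fe\<close> an
      admissible test function.\<close>
    obtain \<rho>' :: "real ^ 'n \<Rightarrow> real" and k1' k2' where m': "mollifier (d / 2) \<rho>' k1' k2'"
      using ex_mollifier[of "d / 2"] d(1) by auto
    define fe where "fe = conv f \<rho>'"
    define He where "He = conv f k2'"
    have feC2: "C2u fe (\<lambda>x. - conv f k1' x) He"
      unfolding fe_def He_def by (rule conv_C2u[OF f m'])
    have fec: "continuous_on UNIV fe"
      using feC2 unfolding C2u_def by (meson continuous_at_imp_continuous_on has_derivative_continuous)
    have close: "\<bar>fe x - f x\<bar> \<le> \<eta>" for x
      unfolding fe_def
    proof (rule conv_close[OF m' fc])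
      show "\<bar>f (x + z) - f x\<bar> \<le> \<eta>" if "norm z \<le> d / 2" for z
        using d(2)[of "x + z" x] that d(1) by (simp add: dist_norm)
    qed
    have feM: "\<bar>fe x\<bar> \<le> M" for x unfolding fe_def by (rule conv_abs_le[OF m' fc f(2)])
    have \<phi>M: "\<bar>\<phi> x\<bar> \<le> M" for x unfolding \<phi>_def by (rule conv_abs_le[OF m fc f(2)])
    obtain d1 where d1: "0 < d1" "\<And>h x. 0 < h \<Longrightarrow> h < d1 \<Longrightarrow> \<bar>Lh k e h fe x - ftrace k e (He x)\<bar> \<le> \<eta>"
      using C2u_Lh[OF feC2 e \<eta>(1)] by blast
    obtain d2 where d2: "0 < d2" "\<And>h x. 0 < h \<Longrightarrow> h < d2 \<Longrightarrow> \<bar>Lh k e h \<phi> x - D x\<bar> \<le> \<eta>"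
      using C2u_Lh[OF \<phi>C2 e \<eta>(1)] unfolding D_def by blast
    define h where "h = min d1 d2 / 2"
    have h: "0 < h" "h < d1" "h < d2" using d1(1) d2(1) by (auto simp: h_def)
    \<comment> \<open>Chosen so that truncation costs at most \<open>\<eta>\<close> for functions
      bounded by \<open>M\<close>, and at most \<open>\<eta>\<close> of total weight.\<close>
    define \<epsilon>' where "\<epsilon>' = \<eta> / (M + 1)"
    have \<epsilon>': "0 < \<epsilon>'" "\<epsilon>' * M \<le> \<eta>" "\<epsilon>' \<le> \<eta>" using \<eta> M by (auto simp: \<epsilon>'_def field_simps mult_left_mono)
    obtain l where l: "nonneg_weights l" "weight l \<le> 1" "1 - \<epsilon>' \<le> weight l"
      and res1: "\<And>f x. (\<And>x. 0 \<le> f x) \<Longrightarrow> wsum l f x - s * wsum l (Lh k e h f) x \<le> f x"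
      and res2: "\<And>f x C. (\<And>x. \<bar>f x\<bar> \<le> C) \<Longrightarrow> \<bar>wsum l f x - s * wsum l (Lh k e h f) x - f x\<bar> \<le> \<epsilon>' * C"
      using approx_resolvent[OF k h(1) s \<epsilon>'(1), of e] by blast
    have w0: "0 \<le> weight l" using l(3) \<epsilon>'(3) \<eta>(2) by linarith
    have wle: "\<bar>wsum l F x\<bar> \<le> c" if "\<And>x. \<bar>F x\<bar> \<le> c" for F :: "real ^ 'n \<Rightarrow> real" and c x
    proof -
      have "0 \<le> c" using that[of 0] by linarith
      then have "weight l * c \<le> c" using l(2) w0 by (simp add: mult_left_le_one_le)
      then show ?thesis using wsum_abs_le[where f = F, OF l(1) that, of x] by linarith
    qed
    define w where "w = wsum l fe"
    have fw: "f z \<le> w z + s * C + (2 + s) * \<eta> + Q * s\<^sup>2" if z: "z \<in> cball x0 \<delta>" for z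
      unfolding Q_def
    proof (rule viscosity_ge_le_resolvent[OF e r M fc f(2) vis[OF z] _ _ _ s])
      show "C2_at w (wsum l (\<lambda>x. - conv f k1' x)) (wsum l He x) x" for x
        unfolding w_def by (rule wsum_C2_at[OF feC2])
      show "\<bar>w x\<bar> \<le> M" for x unfolding w_def by (rule wle[OF feM])
      show "f x - (2 + s) * \<eta> \<le> w x - s * ftrace k e (wsum l He x)" for x
      proof -
        have "\<bar>wsum l (\<lambda>x. Lh k e h fe x - ftrace k e (He x)) x\<bar> \<le> \<eta>"
          by (rule wle) (use d1(2) h in auto)
        then have "\<bar>wsum l (Lh k e h fe) x - ftrace k e (wsum l He x)\<bar> \<le> \<eta>"
          by (simp add: wsum_diff wsum_bounded_linear[OF bounded_linear_ftrace])
        then have "ftrace k e (wsum l He x) \<le> wsum l (Lh k e h fe) x + \<eta>" by (simp add: abs_le_iff)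
        then have "s * ftrace k e (wsum l He x) \<le> s * (wsum l (Lh k e h fe) x + \<eta>)"
          using s by (intro mult_left_mono) auto
        moreover have "fe x - \<eta> \<le> w x - s * wsum l (Lh k e h fe) x"
          using res2[where f = fe, OF feM, of x] \<epsilon>'(2) unfolding w_def by (simp add: abs_le_iff)
        moreover have "f x - \<eta> \<le> fe x" using close[of x] by (simp add: abs_le_iff)
        ultimately show ?thesis by (simp add: algebra_simps)
      qed
    qed
    have wc: "continuous_on UNIV w" unfolding w_def by (rule wsum_continuous[OF fec])
    define c where "c = s * C + (2 + s) * \<eta> + Q * s\<^sup>2"
    have "\<phi> x0 \<le> conv (\<lambda>x. w x + c) \<rho> x0"
      unfolding \<phi>_def
    proof (rule conv_mono[OF m fc])
      show "f (x0 + z) \<le> w (x0 + z) + c" if "norm z \<le> \<delta>" for z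
        using fw[of "x0 + z"] that by (simp add: c_def dist_norm)
    qed (intro continuous_intros wc)
    \<comment> \<open>Translations commute with mollification: this carries the inequality from
      \<open>f\<close> to \<open>\<phi>\<close>.\<close>
    also have "\<dots> = wsum l (conv fe \<rho>) x0 + c"
      using conv_add[OF wc continuous_on_const \<rho>] conv_wsum[OF fec \<rho>] by (simp add: conv_const[OF m] w_def)
    also have "wsum l (conv fe \<rho>) x0 \<le> wsum l \<phi> x0 + \<eta>"
    proof -
      have "\<bar>conv fe \<rho> x - \<phi> x\<bar> \<le> \<eta>" for x
      proof -
        have "norm (conv fe \<rho> x - conv f \<rho> x) \<le> \<eta> * (LINT z|lborel. norm (\<rho> z))"
          by (rule conv_diff_bound[where r = \<delta>, OF fec fc \<rho>]) (assumption, rule close)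
        then show ?thesis using m by (simp add: \<phi>_def mollifier_def)
      qed
      then have "\<bar>wsum l (\<lambda>x. conv fe \<rho> x - \<phi> x) x0\<bar> \<le> \<eta>" by (rule wle)
      then show ?thesis by (simp add: wsum_diff abs_le_iff)
    qed
    finally have 1: "\<phi> x0 \<le> wsum l \<phi> x0 + \<eta> + c" by simp
    have 2: "wsum l \<phi> x0 \<le> \<phi> x0 + \<eta> + s * wsum l (Lh k e h \<phi>) x0"
      using res2[where f = \<phi>, OF \<phi>M, of x0] \<epsilon>'(2) by (simp add: abs_le_iff)
    define q where "q x = (x - x0) \<bullet> (x - x0)" for x
    have "wsum l (Lh k e h \<phi>) x0 \<le> wsum l (\<lambda>x. (D x0 + \<epsilon> + \<eta>) + L * q x) x0"
    proof (rule wsum_mono[OF l(1)])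
      show "Lh k e h \<phi> x \<le> (D x0 + \<epsilon> + \<eta>) + L * q x" for x
        using d2(2)[OF h(1) h(3), of x] L(2)[of x] by (simp add: abs_le_iff q_def)
    qed
    also have "\<dots> = weight l * (D x0 + \<epsilon> + \<eta>) + L * wsum l q x0"
      by (simp add: wsum_add wsum_mult wsum_const distrib_left)
    also have "weight l * (D x0 + \<epsilon> + \<eta>) \<le> (D x0 + \<epsilon> + \<eta>) + \<eta> * (B + \<epsilon> + 1)"
    proof -
      have "(weight l - 1) * (D x0 + \<epsilon> + \<eta>) \<le> \<bar>weight l - 1\<bar> * \<bar>D x0 + \<epsilon> + \<eta>\<bar>"
        by (metis abs_ge_self abs_mult)
      also have "\<dots> \<le> \<eta> * (B + \<epsilon> + 1)"
        using l(2,3) \<epsilon>' \<eta> \<epsilon> B[of x0] by (intro mult_mono) auto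
      finally show ?thesis by (simp add: algebra_simps)
    qed
    \<comment> \<open>The second moment of the weights. As \<open>q\<close> is unbounded, the
      one-sided estimate \<open>res1\<close> for nonnegative functions is the one that
      applies.\<close>
    also have "wsum l q x0 \<le> 2 * real k * s"
    proof -
      have Lq: "Lh k e h q = (\<lambda>_. 2 * real k)" using Lh_square[OF e h(1), of x0] unfolding q_def[abs_def] by blast
      have "wsum l q x0 - s * wsum l (Lh k e h q) x0 \<le> q x0" by (rule res1) (simp add: q_def)
      then have "wsum l q x0 \<le> weight l * (2 * real k * s)" by (simp add: Lq wsum_const q_def algebra_simps)
      also have "\<dots> \<le> 2 * real k * s" using l(2) w0 s by (simp add: mult_left_le_one_le)
      finally show ?thesis .
    qed
    finally have 3: "wsum l (Lh k e h \<phi>) x0 \<le> D x0 + \<epsilon> + \<eta> + \<eta> * (B + \<epsilon> + 1) + L * (2 * real k * s)"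
      using L(1) by (simp add: mult_left_mono)
    have "s * wsum l (Lh k e h \<phi>) x0 \<le> s * (D x0 + \<epsilon> + \<eta> + \<eta> * (B + \<epsilon> + 1) + L * (2 * real k * s))"
      using s 3 by (intro mult_left_mono) auto
    then show ?thesis using 1 2 unfolding c_def by (simp add: power2_eq_square algebra_simps)
  qed
  have "- C \<le> D x0 + \<epsilon>" if \<epsilon>: "0 < \<epsilon>" for \<epsilon>
  proof -
    obtain L where L: "0 \<le> L" "\<And>x. D x \<le> D x0 + \<epsilon> + L * ((x - x0) \<bullet> (x - x0))"
      using uniformly_continuous_quadratic_bound[OF Duc B \<epsilon>] by blast
    define A where "A = Q + 2 * L * real k"
    have 1: "0 \<le> (C + D x0 + \<epsilon>) + s * A" if s: "0 < s" for s
    proof -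
      have lim: "((\<lambda>\<eta>. s * (C + D x0 + \<epsilon>) + s\<^sup>2 * A + \<eta> * (4 + s * (3 + B + \<epsilon>))) \<longlongrightarrow>
          s * (C + D x0 + \<epsilon>) + s\<^sup>2 * A + 0 * (4 + s * (3 + B + \<epsilon>))) (at_right 0)"
        by (intro tendsto_intros)
      have "\<forall>\<^sub>F \<eta> in at_right (0::real). \<eta> < 1"
        by (rule order_tendstoD(2)[OF tendsto_ident_at]) simp
      moreover have "\<forall>\<^sub>F \<eta> in at_right (0::real). 0 < \<eta>" by (rule eventually_at_right_less)
      ultimately have "\<forall>\<^sub>F \<eta> in at_right 0. 0 \<le> s * (C + D x0 + \<epsilon>) + s\<^sup>2 * A + \<eta> * (4 + s * (3 + B + \<epsilon>))"
        by eventually_elim (use main[OF s \<epsilon> L] in \<open>simp add: A_def\<close>)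
      with lim have "0 \<le> s * (C + D x0 + \<epsilon>) + s\<^sup>2 * A + 0 * (4 + s * (3 + B + \<epsilon>))"
        by (rule tendsto_lowerbound) (rule trivial_limit_at_right_real)
      then have "0 \<le> s * ((C + D x0 + \<epsilon>) + s * A)" by (simp add: power2_eq_square algebra_simps)
      then show ?thesis using s by (simp add: zero_le_mult_iff)
    qed
    have "((\<lambda>s. (C + D x0 + \<epsilon>) + s * A) \<longlongrightarrow> (C + D x0 + \<epsilon>) + 0 * A) (at_right 0)"
      by (intro tendsto_intros)
    moreover have "\<forall>\<^sub>F s in at_right (0::real). 0 \<le> (C + D x0 + \<epsilon>) + s * A"
      using eventually_at_right_less[of "0::real"] by eventually_elim (rule 1)
    ultimately have "0 \<le> (C + D x0 + \<epsilon>) + 0 * A"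
      by (rule tendsto_lowerbound) (rule trivial_limit_at_right_real)
    then show ?thesis by simp
  qed
  then have "- C \<le> D x0" by (rule field_le_epsilon)
  then show ?thesis by (simp add: D_def)
qed

section \<open>Comparison principle\<close>

text \<open>Division by \<open>t\<close> turns the gradient coefficient \<open>c / u\<close> into
  \<open>c / (t * u)\<close>, which is at least \<open>c / r\<close>; the constant
  \<open>1 - p\<close> is not divided, and for \<open>t > 1\<close> this is a strict gain. The case
  \<open>t = 1\<close> is properness: lowering the value raises \<open>opw\<close>.\<close>

lemma opw_rescale:
  fixes X :: "real ^ 'n ^ 'n"
  assumes X: "transpose X = X" and k: "0 < k" "k \<le> CARD('n)" and p: "0 < p" "p < 1"
    and t: "0 < t" and u: "0 < u" "t * u \<le> r"
  shows "(opw k p r q X - (1 - p)) / t + (1 - p) \<le> opw k p u ((1 / t) *\<^sub>R q) ((1 / t) *\<^sub>R X)"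
proof -
  define c where "c = p / (1 - p)"
  have c: "0 < c" using p by (simp add: c_def)
  have "outer ((1 / t) *\<^sub>R q) = (1 / t * (1 / t)) *\<^sub>R outer q"
    by (simp add: outer_def vec_eq_iff)
  then have "(1 / t) *\<^sub>R X + (c / u) *\<^sub>R outer ((1 / t) *\<^sub>R q) = (1 / t) *\<^sub>R (X + (c / (t * u)) *\<^sub>R outer q)"
    by (simp add: scaleR_right_distrib)
  moreover have "P_minus k ((1 / t) *\<^sub>R (X + (c / (t * u)) *\<^sub>R outer q)) =
      1 / t * P_minus k (X + (c / (t * u)) *\<^sub>R outer q)"
    using X k t by (intro P_minus_scaleR) auto
  ultimately have 1: "opw k p u ((1 / t) *\<^sub>R q) ((1 / t) *\<^sub>R X) =
      P_minus k (X + (c / (t * u)) *\<^sub>R outer q) / t + (1 - p)"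
    by (simp add: opw_def c_def)
  have "P_minus k (X + (c / r) *\<^sub>R outer q) \<le> P_minus k (X + (c / (t * u)) *\<^sub>R outer q)"
  proof (rule P_minus_mono)
    have "0 < t * u" using t u by simp
    then have "c / r \<le> c / (t * u)" using u c by (intro divide_left_mono mult_pos_pos[of r]) linarith+
    then have "c / r * (q \<bullet> h)\<^sup>2 \<le> c / (t * u) * (q \<bullet> h)\<^sup>2" for h by (rule mult_right_mono) simp
    then show "h \<bullet> ((X + (c / r) *\<^sub>R outer q) *v h) \<le> h \<bullet> ((X + (c / (t * u)) *\<^sub>R outer q) *v h)" for h
      by (simp add: matrix_vector_mult_add_rdistrib inner_add_right scaleR_matrix_vector_assoc[symmetric]
          outer_mult power2_eq_square inner_commute mult.assoc)
  qed (use X k in auto)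
  moreover have "opw k p r q X = P_minus k (X + (c / r) *\<^sub>R outer q) + (1 - p)"
    by (simp add: opw_def c_def)
  ultimately show ?thesis unfolding 1 using t by (simp add: divide_right_mono)
qed

lemma continuous_on_powr_pos: "0 < b \<Longrightarrow> continuous_on S f \<Longrightarrow> (\<And>x. x \<in> S \<Longrightarrow> 0 \<le> f x) \<Longrightarrow>
  continuous_on S (\<lambda>x. f x powr b)" for f :: "'a::topological_space \<Rightarrow> real"
  by (rule continuous_on_powr') auto

lemma powr_uniformly_continuous:
  fixes M :: real
  assumes "0 < b" "0 < \<epsilon>"
  obtains \<gamma> where "0 < \<gamma>" "\<And>s r. 0 \<le> s \<Longrightarrow> s \<le> M \<Longrightarrow> 0 \<le> r \<Longrightarrow> r \<le> M \<Longrightarrow> \<bar>s - r\<bar> \<le> \<gamma> \<Longrightarrow> \<bar>s powr b - r powr b\<bar> \<le> \<epsilon>"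
proof -
  have "uniformly_continuous_on {0..M} (\<lambda>s. s powr b)"
    using assms by (intro compact_uniformly_continuous continuous_on_powr_pos) (auto intro: continuous_intros)
  then obtain d where d: "0 < d" "\<And>x y. x \<in> {0..M} \<Longrightarrow> y \<in> {0..M} \<Longrightarrow> dist y x < d \<Longrightarrow> dist (y powr b) (x powr b) < \<epsilon>"
    using assms(2) unfolding uniformly_continuous_on_def by metis
  show ?thesis
    by (rule that[of "d / 2"]) (use d in \<open>force simp: dist_real_def\<close>)+
qed

text \<open>At a maximum point of \<open>v - t u\<close> with \<open>t > 1\<close>, where \<open>v\<close> is the transform of the mollified
  subsolution, the transformed equation, which is proper, yields a contradiction.\<close>

theorem comparison:
  fixes \<Omega> :: "(real ^ 'n) set"
  assumes op: "open \<Omega>" and bd: "bounded \<Omega>" and k: "0 < k" "k \<le> CARD('n)" and p: "0 < p" "p < 1"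
    and V: "continuous_on UNIV V" "\<And>x. x \<notin> \<Omega> \<Longrightarrow> V x = 0" "\<And>x. x \<in> \<Omega> \<Longrightarrow> 0 < V x"
    and subV: "\<And>x \<phi> g H. x \<in> \<Omega> \<Longrightarrow> touches_above \<phi> g H V x \<Longrightarrow> 0 \<le> P_minus k H + V x powr p"
    and U: "continuous_on UNIV U" "\<And>x. x \<notin> \<Omega> \<Longrightarrow> U x = 0" "\<And>x. x \<in> \<Omega> \<Longrightarrow> 0 < U x"
    and superU: "\<And>x \<phi> g H. x \<in> \<Omega> \<Longrightarrow> touches_below \<phi> g H U x \<Longrightarrow> P_minus k H + U x powr p \<le> 0"
  shows "V x \<le> U x"
proof (rule ccontr)
  assume "\<not> V x \<le> U x"
  define b where "b = 1 - p"
  have b: "0 < b" "b < 1" using p by (auto simp: b_def)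
  have V0: "0 \<le> V x" and U0: "0 \<le> U x" for x
    using V(2,3)[of x] U(2,3)[of x] by (cases "x \<in> \<Omega>", auto)+
  define v where "v x = V x powr b" for x
  define u where "u x = U x powr b" for x
  have vc: "continuous_on UNIV v" and uc: "continuous_on UNIV u"
    unfolding v_def u_def using V(1) U(1) V0 U0 b by (auto intro!: continuous_on_powr_pos)
  have xO: "x \<in> \<Omega>" using \<open>\<not> V x \<le> U x\<close> V(2) U0[of x] by force
  have "u x < v x" unfolding u_def v_def using \<open>\<not> V x \<le> U x\<close> U0 b by (intro powr_less_mono2) auto
  have "0 < u x" using U(3)[OF xO] by (simp add: u_def)
  \<comment> \<open>Any number strictly between 1 and \<open>v x / u x\<close> would do; this is the
    midpoint.\<close>
  define t where "t = (1 + v x / u x) / 2"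
  have t: "1 < t" "t * u x < v x"
    using \<open>u x < v x\<close> \<open>0 < u x\<close> by (auto simp: t_def field_simps)
  define m where "m = v x - t * u x"
  have m: "0 < m" using t by (simp add: m_def)
  \<comment> \<open>Since \<open>u\<close> and \<open>v\<close> vanish outside
    \<open>\<Omega>\<close>, this is a compact subset of \<open>\<Omega>\<close>. A neighbourhood of
    fixed radius \<open>\<rho>0\<close> stays in \<open>\<Omega>\<close>, where the inequality for
    \<open>V\<close> may be mollified.\<close>
  define K where "K = {y. m / 2 \<le> v y - t * u y}"
  have KO: "K \<subseteq> \<Omega>" using m V(2) U(2) by (force simp: K_def v_def u_def)
  have "closed K" unfolding K_def
    by (intro closed_Collect_le continuous_intros vc uc)
  then have K: "compact K" using KO bd bounded_subset compact_eq_bounded_closed by blast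
  obtain \<rho>0 where \<rho>0': "0 < \<rho>0" "(\<Union>y\<in>K. cball y \<rho>0) \<subseteq> \<Omega>"
    using compact_subset_open_imp_cball_epsilon_subset[OF K op KO] by metis
  then have \<rho>0: "0 < \<rho>0" "\<And>y. y \<in> K \<Longrightarrow> cball y \<rho>0 \<subseteq> \<Omega>"
    by (simp_all only: UN_subset_iff)
  obtain R0 where R0: "\<And>y. y \<in> \<Omega> \<Longrightarrow> norm y \<le> R0" using bd by (auto simp: bounded_iff)
  have supp: "V y = 0" if "R0 < norm y" for y using V(2) R0 that by force
  have Vuc: "uniformly_continuous_on UNIV V"
    by (rule uniformly_continuous_compact_support[OF V(1) supp])
  have "compact (V ` cball 0 R0)" using V(1) continuous_on_subset by (intro compact_continuous_image) auto
  then have "bounded (V ` cball 0 R0)" by (rule compact_imp_bounded)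
  then obtain M0 where "\<forall>a\<in>V ` cball 0 R0. norm a \<le> M0" unfolding bounded_iff by blast
  then have M0: "\<And>y. y \<in> cball 0 R0 \<Longrightarrow> \<bar>V y\<bar> \<le> M0" by auto
  define M where "M = max M0 0"
  have VM: "\<bar>V y\<bar> \<le> M" for y using M0[of y] supp[of y] by (cases "R0 < norm y") (auto simp: M_def)
  \<comment> \<open>An upper bound for the negative power \<open>\<phi> y powr (b - 1)\<close>,
    since \<open>\<phi> y powr b \<ge> m / 2\<close> at the maximum point \<open>y\<close>.\<close>
  define B where "B = ((m / 2) powr (1 / b)) powr (b - 1)"
  have B: "0 < B" using m by (simp add: B_def)
  \<comment> \<open>Makes the mollification loss \<open>b * B * \<epsilon>\<close> half of the gain
    \<open>b * (t - 1)\<close> provided by \<open>opw_rescale\<close>.\<close>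
  define \<epsilon> where "\<epsilon> = (t - 1) / (2 * B)"
  have \<epsilon>: "0 < \<epsilon>" using t B by (simp add: \<epsilon>_def)
  \<comment> \<open>Two errors of \<open>m / 8\<close> still leave
    \<open>v y - t * u y > m / 2\<close> at the perturbed maximum point \<open>y\<close>, so
    \<open>y\<close> is interior to \<open>K\<close>.\<close>
  obtain \<gamma>1 where \<gamma>1: "0 < \<gamma>1" "\<And>s r. 0 \<le> s \<Longrightarrow> s \<le> M \<Longrightarrow> 0 \<le> r \<Longrightarrow> r \<le> M \<Longrightarrow> \<bar>s - r\<bar> \<le> \<gamma>1 \<Longrightarrow> \<bar>s powr b - r powr b\<bar> \<le> m / 8"
    using powr_uniformly_continuous[OF b(1), of "m / 8" M] m by auto
  obtain \<gamma>2 where \<gamma>2: "0 < \<gamma>2" "\<And>s r. 0 \<le> s \<Longrightarrow> s \<le> M \<Longrightarrow> 0 \<le> r \<Longrightarrow> r \<le> M \<Longrightarrow> \<bar>s - r\<bar> \<le> \<gamma>2 \<Longrightarrow> \<bar>s powr p - r powr p\<bar> \<le> \<epsilon> / 2"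
    using powr_uniformly_continuous[OF p(1), of "\<epsilon> / 2" M] \<epsilon> by auto
  define \<gamma> where "\<gamma> = min \<gamma>1 \<gamma>2"
  have \<gamma>: "0 < \<gamma>" using \<gamma>1 \<gamma>2 by (simp add: \<gamma>_def)
  obtain d where d: "0 < d" "\<And>x y. dist y x < d \<Longrightarrow> dist (V y) (V x) < \<gamma>"
    using Vuc \<gamma> unfolding uniformly_continuous_on_def by (metis UNIV_I)
  \<comment> \<open>The points where \<open>V\<close> is tested lie within \<open>\<delta>\<close>
    of a point that is itself within \<open>\<delta>\<close> of \<open>y\<close>, so
    \<open>2 * \<delta>\<close> must fit below \<open>d\<close> and \<open>\<rho>0\<close>.\<close>
  define \<delta> where "\<delta> = min d \<rho>0 / 3"
  have \<delta>: "0 < \<delta>" "2 * \<delta> < d" "2 * \<delta> \<le> \<rho>0" using d(1) \<rho>0(1) by (auto simp: \<delta>_def min_def)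
  obtain \<rho> :: "real ^ 'n \<Rightarrow> real" and k1 k2 where mol: "mollifier \<delta> \<rho> k1 k2"
    using ex_mollifier[OF \<delta>(1)] by blast
  define \<phi> where "\<phi> = conv V \<rho>"
  define g where "g = (\<lambda>x. - conv V k1 x)"
  define H where "H = conv V k2"
  have C2: "C2u \<phi> g H" unfolding \<phi>_def g_def H_def by (rule conv_C2u[OF Vuc VM mol])
  then have \<phi>c: "continuous_on UNIV \<phi>"
    unfolding C2u_def by (meson continuous_at_imp_continuous_on has_derivative_continuous)
  have close: "\<bar>\<phi> y - V y\<bar> \<le> \<gamma>" for y
    unfolding \<phi>_def
  proof (rule conv_close[OF mol V(1)])
    show "\<bar>V (y + z) - V y\<bar> \<le> \<gamma>" if "norm z \<le> \<delta>" for z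
      using d(2)[of "y + z" y] that \<delta> by (simp add: dist_norm)
  qed
  have \<phi>M: "\<phi> y \<le> M" for y using conv_abs_le[OF mol V(1) VM, of y] by (simp add: \<phi>_def abs_le_iff)
  have \<phi>0: "0 \<le> \<phi> y" for y
    using conv_mono[OF mol continuous_on_const[of _ 0] V(1), of y] V0 by (simp add: \<phi>_def conv_const[OF mol])
  have VM': "V y \<le> M" for y using VM[of y] by (simp add: abs_le_iff)
  have closeb: "\<bar>\<phi> y powr b - v y\<bar> \<le> m / 8" for y
    unfolding v_def using close[of y] by (intro \<gamma>1(2)) (auto simp: \<phi>0 \<phi>M V0 VM' \<gamma>_def)
  have "continuous_on K (\<lambda>y. \<phi> y powr b - t * u y)"
    using \<phi>c uc continuous_on_subset \<phi>0 b
    by (intro continuous_on_diff continuous_on_powr_pos continuous_on_mult continuous_on_const) auto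
  moreover have xK: "x \<in> K" using m by (simp add: K_def m_def)
  ultimately obtain y where y: "y \<in> K"
    and mx: "\<And>z. z \<in> K \<Longrightarrow> \<phi> z powr b - t * u z \<le> \<phi> y powr b - t * u y"
    using continuous_attains_sup[OF K, of "\<lambda>y. \<phi> y powr b - t * u y"] by blast
  have "m - m / 8 \<le> \<phi> y powr b - t * u y"
    using mx[OF xK] closeb[of x] unfolding abs_le_iff m_def[symmetric] using m_def by linarith
  then have yge: "m / 2 < \<phi> y powr b - t * u y" and yin: "m / 2 < v y - t * u y"
    using closeb[of y] m unfolding abs_le_iff by linarith+
  have yO: "y \<in> \<Omega>" using y KO by blast
  have uy: "0 < u y" using U(3)[OF yO] by (simp add: u_def)
  define r where "r = \<phi> y powr b"
  have "0 < t * u y" using uy t by simp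
  then have r: "t * u y \<le> r" "m / 2 \<le> r" using yge m unfolding r_def by linarith+
  have \<phi>y: "0 < \<phi> y" using r(2) m \<phi>0[of y] by (cases "\<phi> y = 0") (auto simp: r_def)
  define q where "q = (b * \<phi> y powr (b - 1)) *\<^sub>R g y"
  define X where "X = (b * \<phi> y powr (b - 1)) *\<^sub>R (H y + ((b - 1) / \<phi> y) *\<^sub>R outer (g y))"
  have C2y: "C2_at \<phi> g (H y) y" using C2 by (simp add: C2u_def C2_at_def)
  note C2p = C2_at_powr[OF C2y \<phi>y, of b, folded X_def]
  from C2_at_affine[OF C2p, of "1 / t" "u y - r / t"]
  \<comment> \<open>Maximality of \<open>\<phi> powr b - t u\<close> at \<open>y\<close> says that
    this rescaled and shifted power touches \<open>u\<close> from below.\<close>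
  have "C2_at (\<lambda>z. 1 / t * \<phi> z powr b + (u y - r / t)) (\<lambda>z. (1 / t) *\<^sub>R ((b * \<phi> z powr (b - 1)) *\<^sub>R g z)) ((1 / t) *\<^sub>R X) y" .
  moreover have "\<forall>\<^sub>F z in nhds y. 1 / t * \<phi> z powr b + (u y - r / t) \<le> u z"
  proof -
    have "open {z. m / 2 < v z - t * u z}"
      by (intro open_Collect_less continuous_intros vc uc)
    then have "\<forall>\<^sub>F z in nhds y. z \<in> {z. m / 2 < v z - t * u z}"
      using yin by (intro eventually_nhds_in_open) auto
    then show ?thesis
    proof eventually_elim
      case (elim z)
      then have "\<phi> z powr b - t * u z \<le> r - t * u y" unfolding r_def by (intro mx) (auto simp: K_def)
      then have "(\<phi> z powr b - r) / t \<le> u z - u y" using t by (simp add: field_simps)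
      then show ?case by (simp add: diff_divide_distrib)
    qed
  qed
  moreover have "1 / t * \<phi> y powr b + (u y - r / t) = u y" by (simp add: r_def)
  ultimately have tb: "touches_below (\<lambda>z. 1 / t * \<phi> z powr b + (u y - r / t))
      (\<lambda>z. (1 / t) *\<^sub>R ((b * \<phi> z powr (b - 1)) *\<^sub>R g z)) ((1 / t) *\<^sub>R X) u y"
    unfolding touches_below_def by blast
  have "super_at k p (\<lambda>x. U x powr (1 - p)) y"
    using super_at_powr_iff[OF k p, of U y] U(3)[OF yO] U0 superU[OF yO] by auto
  then have "super_at k p u y" by (simp add: u_def[abs_def] b_def)
  then have le0: "opw k p (u y) ((1 / t) *\<^sub>R q) ((1 / t) *\<^sub>R X) \<le> 0"
    using tb unfolding super_at_def q_def by blast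
  have Hs: "transpose (H y) = H y" by (rule C2_at_symmetric[OF C2y])
  \<comment> \<open>Concavity at work: the bound on the minimum over frames is proved frame by
    frame, where it is linear and survives mollification. The source term is frozen at
    \<open>\<phi> y powr p\<close> with error \<open>\<epsilon>\<close>.\<close>
  have PH: "- (\<phi> y powr p) - \<epsilon> \<le> P_minus k (H y)"
  proof (rule P_minus_geI[OF Hs k])
    fix e :: "nat \<Rightarrow> real ^ 'n" assume e: "frame k e"
    have "- (\<phi> y powr p + \<epsilon>) \<le> ftrace k e (conv V k2 y)"
    proof (rule mollified_subsolution[OF k(1) e mol \<delta>(1) Vuc VM])
      fix z assume z: "z \<in> cball y \<delta>"
      have near: "dist x' y \<le> 2 * \<delta>" if "x' \<in> cball z \<delta>" for x'
        using z that dist_triangle[of x' y z] by (simp add: dist_commute)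
      show "viscosity_ge k e (\<phi> y powr p + \<epsilon>) V (cball z \<delta>)"
        unfolding viscosity_ge_def
      proof (intro ballI allI impI)
        fix x' \<psi> g' H' assume x': "x' \<in> cball z \<delta>" and ta: "touches_above \<psi> g' H' V x'"
        have xO': "x' \<in> \<Omega>" using \<rho>0(2)[OF y] near[OF x'] \<delta>(3) by (auto simp: dist_commute)
        have "\<bar>V x' - V y\<bar> < \<gamma>" using d(2)[of x' y] near[OF x'] \<delta>(2) by (simp add: dist_real_def)
        then have 1: "\<bar>V x' powr p - V y powr p\<bar> \<le> \<epsilon> / 2"
          by (intro \<gamma>2(2)) (auto simp: V0 VM' \<gamma>_def)
        have 2: "\<bar>\<phi> y powr p - V y powr p\<bar> \<le> \<epsilon> / 2"
          using close[of y] by (intro \<gamma>2(2)) (auto simp: \<phi>0 \<phi>M V0 VM' \<gamma>_def)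
        have "- (V x' powr p) \<le> P_minus k H'" using subV[OF xO' ta] by simp
        also have "\<dots> \<le> ftrace k e H'" by (rule P_minus_le_ftrace[OF touches_sym(1)[OF ta] k e])
        finally show "- (\<phi> y powr p + \<epsilon>) \<le> ftrace k e H'" using 1 2 unfolding abs_le_iff by linarith
      qed
    qed
    then show "- (\<phi> y powr p) - \<epsilon> \<le> ftrace k e (H y)" by (simp add: H_def)
  qed
  have "opw k p r q X = (b * \<phi> y powr (b - 1)) * (P_minus k (H y) + \<phi> y powr p)"
    unfolding r_def q_def X_def by (rule opw_powr(2)[OF Hs k p \<phi>y b_def])
  also have "\<dots> \<ge> (b * \<phi> y powr (b - 1)) * (- \<epsilon>)"
    using PH b \<phi>y by (intro mult_left_mono) auto
  finally have op: "- (b * (\<phi> y powr (b - 1) * \<epsilon>)) \<le> opw k p r q X" by simp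
  have "\<phi> y powr (b - 1) \<le> B"
  proof -
    have "(m / 2) powr (1 / b) \<le> r powr (1 / b)" using r(2) m b by (intro powr_mono2) auto
    also have "\<dots> = \<phi> y" using b \<phi>y by (simp add: r_def powr_powr)
    finally show ?thesis unfolding B_def using m b by (intro powr_mono2') auto
  qed
  then have "b * (\<phi> y powr (b - 1) * \<epsilon>) \<le> b * (B * \<epsilon>)" using b \<epsilon> by (intro mult_left_mono mult_right_mono) auto
  also have "\<dots> = b * (t - 1) / 2" using B by (simp add: \<epsilon>_def)
  finally have opr: "- (b * (t - 1) / 2) \<le> opw k p r q X" using op by linarith
  have Xs: "transpose X = X" by (simp add: X_def Hs)
  have "(opw k p r q X - (1 - p)) / t + (1 - p) \<le> 0"
    using opw_rescale[OF Xs k p _ uy r(1), of q] le0 t by simp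
  then have "opw k p r q X - b + b * t \<le> 0" using t by (simp add: b_def[symmetric] field_simps)
  moreover have "b * (t - 1) = b * t - b" by (simp add: algebra_simps)
  ultimately have "b * (t - 1) / 2 \<le> 0" using opr by linarith
  then show False using b t by (simp add: mult_le_0_iff)
qed

lemma touches_cong:
  assumes "\<forall>\<^sub>F x in nhds x0. f x = f' x"
  shows "touches_above \<phi> g H f x0 \<longleftrightarrow> touches_above \<phi> g H f' x0"
    and "touches_below \<phi> g H f x0 \<longleftrightarrow> touches_below \<phi> g H f' x0"
proof -
  have "f x0 = f' x0" using assms by (rule eventually_nhds_x_imp_x)
  moreover have "(\<forall>\<^sub>F x in nhds x0. f x \<le> \<phi> x) \<longleftrightarrow> (\<forall>\<^sub>F x in nhds x0. f' x \<le> \<phi> x)"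
    by (rule eventually_subst) (use assms in \<open>auto elim: eventually_mono\<close>)
  moreover have "(\<forall>\<^sub>F x in nhds x0. \<phi> x \<le> f x) \<longleftrightarrow> (\<forall>\<^sub>F x in nhds x0. \<phi> x \<le> f' x)"
    by (rule eventually_subst) (use assms in \<open>auto elim: eventually_mono\<close>)
  ultimately show "touches_above \<phi> g H f x0 \<longleftrightarrow> touches_above \<phi> g H f' x0"
    "touches_below \<phi> g H f x0 \<longleftrightarrow> touches_below \<phi> g H f' x0"
    by (auto simp: touches_above_def touches_below_def)
qed

text \<open>Values off the closure are unconstrained, so both functions are replaced by their
  extensions by zero, continuous because they vanish on the frontier.\<close>

lemma Dirichlet_solution_le:
  fixes \<Omega> :: "(real ^ 'n) set"
  assumes op: "open \<Omega>" and bd: "bounded \<Omega>" and k: "0 < k" "k \<le> CARD('n)" and p: "0 < p" "p < 1"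
    and V: "Dirichlet_solution k p \<Omega> V" and U: "Dirichlet_solution k p \<Omega> U" and x: "x \<in> closure \<Omega>"
  shows "V x \<le> U x"
proof -
  define ext where "ext F x = (if x \<in> \<Omega> then F x else 0)" for F :: "real ^ 'n \<Rightarrow> real" and x
  have ev: "\<forall>\<^sub>F x in nhds y. F x = ext F x" if "y \<in> \<Omega>" for F y
    using eventually_nhds_in_open[OF op that] by eventually_elim (simp add: ext_def)
  have c: "continuous_on UNIV (ext F)" if F: "Dirichlet_solution k p \<Omega> F" for F
  proof -
    have "continuous_on (closure \<Omega> \<union> - \<Omega>) (\<lambda>x. if x \<in> \<Omega> then F x else 0)"
      by (rule continuous_on_cases) (use F op in \<open>auto simp: Dirichlet_solution_def frontier_def interior_open\<close>)
    moreover have "closure \<Omega> \<union> - \<Omega> = UNIV" using closure_subset by blast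
    ultimately show ?thesis by (simp add: ext_def[abs_def])
  qed
  have pos: "0 < ext F x" if "Dirichlet_solution k p \<Omega> F" "x \<in> \<Omega>" for F x
    using that by (simp add: ext_def Dirichlet_solution_def)
  have "ext V x \<le> ext U x"
  proof (rule comparison[OF op bd k p c[OF V] _ pos[OF V] _ c[OF U] _ pos[OF U]])
    have vV: "viscosity_subsolution k p \<Omega> V" and vU: "viscosity_supersolution k p \<Omega> U"
      using V U by (auto simp: Dirichlet_solution_def viscosity_solution_def)
    show "0 \<le> P_minus k H + ext V x powr p" if "x \<in> \<Omega>" "touches_above \<phi> g H (ext V) x" for x \<phi> g H
      using vV that unfolding viscosity_subsolution_iff[OF op k] touches_cong(1)[OF ev[OF that(1)], symmetric]
      by (simp add: ext_def)
    show "P_minus k H + ext U x powr p \<le> 0" if "x \<in> \<Omega>" "touches_below \<phi> g H (ext U) x" for x \<phi> g H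
      using vU that unfolding viscosity_supersolution_iff[OF op k] touches_cong(2)[OF ev[OF that(1)], symmetric]
      by (simp add: ext_def)
  qed (auto simp: ext_def)
  moreover have "ext F x = F x" if "Dirichlet_solution k p \<Omega> F" for F
    using that x op by (auto simp: ext_def Dirichlet_solution_def frontier_def interior_open)
  ultimately show ?thesis using V U by simp
qed

section \<open>Existence by the Perron method\<close>

text \<open>The first- and second-order conditions at a minimum of \<open>\<phi> - \<psi>\<close>;
  the second comes from the Taylor expansion along rays.\<close>

lemma C2_at_order:
  fixes \<phi> :: "real ^ 'n \<Rightarrow> real"
  assumes \<phi>: "C2_at \<phi> g H x0" and \<psi>: "C2_at \<psi> g' H' x0" and eq: "\<phi> x0 = \<psi> x0"
    and le: "\<forall>\<^sub>F x in nhds x0. \<psi> x \<le> \<phi> x"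
  shows "g x0 = g' x0" and "v \<bullet> (H' *v v) \<le> v \<bullet> (H *v v)"
proof -
  define \<xi> where "\<xi> x = \<phi> x + (- 1 * \<psi> x + 0)" for x
  define G where "G x = g x + (- 1) *\<^sub>R g' x" for x
  define K where "K = H + (- 1) *\<^sub>R H'"
  have C: "C2_at \<xi> G K x0"
    unfolding \<xi>_def G_def K_def by (intro C2_at_add \<phi> C2_at_affine \<psi>)
  have \<xi>0: "\<xi> x0 = 0" by (simp add: \<xi>_def eq)
  have \<xi>: "\<forall>\<^sub>F x in nhds x0. 0 \<le> \<xi> x" using le by eventually_elim (simp add: \<xi>_def)
  have "(\<xi> has_derivative (\<lambda>h. G x0 \<bullet> h)) (at x0)"
    using C eventually_nhds_x_imp_x unfolding C2_at_def by blast
  moreover obtain S where S: "open S" "x0 \<in> S" "\<And>x. x \<in> S \<Longrightarrow> \<xi> x0 \<le> \<xi> x"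
    using \<xi> unfolding eventually_nhds \<xi>0 by blast
  ultimately have "(\<lambda>h. G x0 \<bullet> h) = (\<lambda>h. 0)"
    using differential_zero_maxmin[of x0 S \<xi>] by blast
  then have "G x0 = 0" by (metis inner_eq_zero_iff)
  then show "g x0 = g' x0" by (simp add: G_def)
  have "0 \<le> v \<bullet> (K *v v) + (2 * (v \<bullet> v)) * \<epsilon>" if \<epsilon>: "0 < \<epsilon>" for \<epsilon>
  proof -
    have ev: "\<forall>\<^sub>F x in nhds x0. 0 \<le> (x - x0) \<bullet> (K *v (x - x0)) / 2 + \<epsilon> * (norm (x - x0))\<^sup>2"
      using \<xi> C2_at_taylor[OF C \<epsilon>]
      by eventually_elim (simp add: \<xi>0 \<open>G x0 = 0\<close> abs_le_iff)
    have "((\<lambda>t. x0 + t *\<^sub>R v) \<longlongrightarrow> x0 + 0 *\<^sub>R v) (at_right 0)"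
      by (intro tendsto_intros)
    then have "filterlim (\<lambda>t. x0 + t *\<^sub>R v) (nhds x0) (at_right 0)" by simp
    from eventually_compose_filterlim[OF ev this]
    have "\<forall>\<^sub>F t in at_right 0. 0 \<le> t\<^sup>2 * (v \<bullet> (K *v v) / 2 + \<epsilon> * (v \<bullet> v))"
    proof (rule eventually_mono)
      fix t :: real
      have "(norm (t *\<^sub>R v))\<^sup>2 = t\<^sup>2 * (v \<bullet> v)"
        by (simp add: power_mult_distrib power2_norm_eq_inner)
      moreover assume "0 \<le> (x0 + t *\<^sub>R v - x0) \<bullet> (K *v (x0 + t *\<^sub>R v - x0)) / 2 + \<epsilon> * (norm (x0 + t *\<^sub>R v - x0))\<^sup>2"
      ultimately show "0 \<le> t\<^sup>2 * (v \<bullet> (K *v v) / 2 + \<epsilon> * (v \<bullet> v))"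
        by (simp add: matrix_vector_mult_scaleR distrib_left power2_eq_square mult_ac)
    qed
    moreover have "\<forall>\<^sub>F t in at_right (0::real). 0 < t" by (rule eventually_at_right_less)
    ultimately have "\<forall>\<^sub>F t in at_right (0::real). 0 \<le> v \<bullet> (K *v v) / 2 + \<epsilon> * (v \<bullet> v)"
      by eventually_elim (simp add: zero_le_mult_iff)
    then show ?thesis by (simp add: algebra_simps)
  qed
  then have "0 \<le> v \<bullet> (K *v v)" by (rule field_le_mult_epsilon) simp_all
  then show "v \<bullet> (H' *v v) \<le> v \<bullet> (H *v v)"
    by (simp add: K_def matrix_vector_mult_diff_rdistrib inner_diff_right)
qed

lemma opw_mono:
  fixes X :: "real ^ 'n ^ 'n"
  assumes "transpose X = X" "transpose Y = Y" "0 < k" "k \<le> CARD('n)" "\<And>v. v \<bullet> (X *v v) \<le> v \<bullet> (Y *v v)"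
  shows "opw k p r q X \<le> opw k p r q Y"
  unfolding opw_def
  by (intro add_right_mono P_minus_mono) (use assms in \<open>auto simp: matrix_vector_mult_add_rdistrib inner_add_right\<close>)

text \<open>A test function above \<open>w\<close> lies above \<open>\<psi>\<close> too, so the
  gradients agree and the Hessians are ordered; \<open>opw\<close> is monotone in the
  Hessian.\<close>

lemma sub_at_C2I:
  fixes w :: "real ^ 'n \<Rightarrow> real"
  assumes \<psi>: "C2_at \<psi> g H x" "\<psi> x = w x" "\<forall>\<^sub>F z in nhds x. \<psi> z \<le> w z" and k: "0 < k" "k \<le> CARD('n)"
    and ge: "0 \<le> opw k p (w x) (g x) H"
  shows "sub_at k p w x"
  unfolding sub_at_def
proof (intro allI impI)
  fix \<phi> g' H' assume t: "touches_above \<phi> g' H' w x"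
  have "\<forall>\<^sub>F z in nhds x. w z \<le> \<phi> z" "C2_at \<phi> g' H' x" "\<phi> x = \<psi> x"
    using t \<psi> by (auto simp: touches_above_def)
  moreover from this(1) \<psi>(3) have "\<forall>\<^sub>F z in nhds x. \<psi> z \<le> \<phi> z" by eventually_elim simp
  ultimately have "g' x = g x" "v \<bullet> (H *v v) \<le> v \<bullet> (H' *v v)" for v
    using C2_at_order \<psi>(1) by blast+
  then show "0 \<le> opw k p (w x) (g' x) H'"
    using opw_mono[OF C2_at_symmetric[OF \<psi>(1)] touches_sym(1)[OF t] k] ge by (metis order_trans)
qed

text \<open>The local form of the fact that a maximum of subsolutions is a subsolution: any test
  function for \<open>w'\<close> also tests \<open>w\<close>.\<close>

lemma sub_at_le:
  assumes "sub_at k p w x" "w x = w' x" "\<And>z. w z \<le> w' z"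
  shows "sub_at k p w' x"
  unfolding sub_at_def
proof (intro allI impI)
  fix \<phi> g H assume t: "touches_above \<phi> g H w' x"
  then have "\<forall>\<^sub>F z in nhds x. w z \<le> \<phi> z"
    unfolding touches_above_def using assms(3) order_trans by (auto elim!: eventually_mono)
  then have "touches_above \<phi> g H w x" using t assms(2) by (simp add: touches_above_def)
  then show "0 \<le> opw k p (w' x) (g x) H" using assms(1,2) by (simp add: sub_at_def)
qed

lemma C2_at_translate:
  fixes \<phi> :: "real ^ 'n \<Rightarrow> real"
  assumes "C2_at \<phi> g H x"
  shows "C2_at (\<lambda>z. \<phi> (z - h)) (\<lambda>z. g (z - h)) H (x + h)"
proof -
  have sh: "((\<lambda>z. z - h) has_derivative (\<lambda>v. v)) (at z)" for z :: "real ^ 'n"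
    by (auto intro!: derivative_eq_intros)
  have "filterlim (\<lambda>z. z - h) (nhds (x + h - h)) (nhds (x + h))"
    by (intro tendsto_intros) (simp add: filterlim_ident)
  then have fl: "filterlim (\<lambda>z. z - h) (nhds x) (nhds (x + h))" by simp
  have "\<forall>\<^sub>F z in nhds (x + h). (\<phi> has_derivative (\<lambda>v. g (z - h) \<bullet> v)) (at (z - h))"
    by (rule eventually_compose_filterlim[OF assms[unfolded C2_at_def, THEN conjunct1] fl])
  then have "\<forall>\<^sub>F z in nhds (x + h). ((\<lambda>z. \<phi> (z - h)) has_derivative (\<lambda>v. g (z - h) \<bullet> v)) (at z)"
    by eventually_elim (rule has_derivative_compose[OF sh])
  moreover have "((\<lambda>z. g (z - h)) has_derivative (\<lambda>v. H *v v)) (at (x + h))"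
    using assms by (intro has_derivative_compose[OF sh]) (simp add: C2_at_def)
  ultimately show ?thesis by (simp add: C2_at_def)
qed

text \<open>The equation does not depend on the position, and lowering the value increases the
  coefficient of the gradient term.\<close>

lemma sub_at_translate:
  fixes w :: "real ^ 'n \<Rightarrow> real"
  assumes k: "0 < k" "k \<le> CARD('n)" and p: "0 < p" "p < 1" and s: "sub_at k p w (x + h)"
    and c: "0 \<le> c" "0 < w (x + h) - c"
  shows "sub_at k p (\<lambda>z. w (z + h) - c) x"
  unfolding sub_at_def
proof (intro allI impI)
  fix \<phi> g H assume t: "touches_above \<phi> g H (\<lambda>z. w (z + h) - c) x"
  have "filterlim (\<lambda>z. z - h) (nhds (x + h - h)) (nhds (x + h))"
    by (intro tendsto_intros) (simp add: filterlim_ident)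
  then have fl: "filterlim (\<lambda>z. z - h) (nhds x) (nhds (x + h))" by simp
  have "\<forall>\<^sub>F z in nhds x. w (z + h) - c \<le> \<phi> z" using t by (simp add: touches_above_def)
  from eventually_compose_filterlim[OF this fl]
  have "\<forall>\<^sub>F z in nhds (x + h). w z \<le> \<phi> (z - h) + c" by (rule eventually_mono) simp
  then have "touches_above (\<lambda>z. \<phi> (z - h) + c) (\<lambda>z. g (z - h)) H w (x + h)"
    using t unfolding touches_above_def by (auto intro!: C2_at_add_const C2_at_translate)
  then have "0 \<le> opw k p (w (x + h)) (g x) H" using s unfolding sub_at_def by fastforce
  also have "\<dots> \<le> opw k p (w (x + h) - c) (g x) H"
    using opw_rescale[OF touches_sym(1)[OF t] k p, of 1 "w (x + h) - c" "w (x + h)" "g x"] c by simp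
  finally show "0 \<le> opw k p (w (x + h) - c) (g x) H" .
qed

lemma tendsto_opw:
  fixes X0 :: "real ^ 'n ^ 'n"
  assumes k: "0 < k" "k \<le> CARD('n)" and p: "p < 1"
    and lim: "(r \<longlongrightarrow> r0) F" "(q \<longlongrightarrow> q0) F" "r0 \<noteq> 0" and X: "transpose X0 = X0"
  shows "((\<lambda>x. opw k p (r x) (q x) X0) \<longlongrightarrow> opw k p r0 q0 X0) F"
proof -
  define A where "A s v = X0 + (p / ((1 - p) * s)) *\<^sub>R outer v" for s v
  have sym: "transpose (A s v) = A s v" for s v by (simp add: A_def X)
  have o: "((\<lambda>x. outer (q x)) \<longlongrightarrow> outer q0) F"
    unfolding outer_def by (intro tendsto_intros tendsto_vec_lambda lim)
  have "((\<lambda>x. A (r x) (q x)) \<longlongrightarrow> A r0 q0) F"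
    unfolding A_def using p lim by (intro tendsto_intros o) auto
  then have "((\<lambda>x. real k * norm (A (r x) (q x) - A r0 q0)) \<longlongrightarrow> real k * norm (A r0 q0 - A r0 q0)) F"
    by (intro tendsto_intros)
  then have z: "((\<lambda>x. real k * norm (A (r x) (q x) - A r0 q0)) \<longlongrightarrow> 0) F" by simp
  have "((\<lambda>x. P_minus k (A (r x) (q x)) - P_minus k (A r0 q0)) \<longlongrightarrow> 0) F"
    by (rule Lim_null_comparison[OF _ z]) (use P_minus_lipschitz[OF sym sym k] in \<open>auto intro!: always_eventually\<close>)
  then have "((\<lambda>x. P_minus k (A (r x) (q x))) \<longlongrightarrow> P_minus k (A r0 q0)) F" by (rule Lim_null[THEN iffD2])
  then show ?thesis unfolding opw_def A_def by (intro tendsto_intros)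
qed

lemma opw_add_mat:
  fixes X :: "real ^ 'n ^ 'n"
  assumes "transpose X = X" "0 < k" "k \<le> CARD('n)"
  shows "opw k p r q (X + mat c) = opw k p r q X + real k * c"
proof -
  have e: "X + mat c + (p / ((1 - p) * r)) *\<^sub>R outer q = (X + (p / ((1 - p) * r)) *\<^sub>R outer q) + mat c" by simp
  show ?thesis unfolding opw_def e using P_minus_add_mat[of "X + (p / ((1 - p) * r)) *\<^sub>R outer q" k c] assms by simp
qed

section \<open>The Perron construction on an intersection of balls of equal radius\<close>

locale perron =
  fixes \<Omega> :: "(real ^ 'n) set" and k :: nat and p R :: real and Y :: "(real ^ 'n) set"
  assumes op: "open \<Omega>" and bd: "bounded \<Omega>" and k: "0 < k" "k < CARD('n)" and p: "0 < p" "p < 1"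
    and R: "0 < R" and Y: "\<Omega> = (\<Inter>y\<in>Y. ball y R)"
begin

lemma k': "k \<le> CARD('n)" using k by simp

text \<open>An empty intersection would be the whole space, which boundedness excludes. At least one
  ball is needed to bound the supremum.\<close>

lemma Y_nonempty: "Y \<noteq> {}"
proof
  assume "Y = {}"
  then have "\<Omega> = UNIV" by (subst Y) simp
  then show False using bd not_bounded_UNIV by simp
qed

lemma \<Omega>_iff: "x \<in> \<Omega> \<longleftrightarrow> (\<forall>y\<in>Y. norm (x - y) < R)"
  by (subst Y) (simp add: dist_norm norm_minus_commute)

text \<open>With this slope the paraboloid
  \<open>\<beta> * (R\<^sup>2 - (norm (x - y))\<^sup>2)\<close>, of Hessian
  \<open>mat (- 2 * \<beta>)\<close>, has trace \<open>- (1 - p)\<close> on every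
  \<open>k\<close>-frame.\<close>

definition \<beta> where "\<beta> = (1 - p) / (2 * real k)"

lemma \<beta>: "0 < \<beta>" "2 * \<beta> * real k = 1 - p"
  using p k by (auto simp: \<beta>_def)

text \<open>Competitors live on the whole space, so that they can be translated, and must be
  subsolutions only where they are positive; this admits the zero function and truncations at
  zero.\<close>

definition S :: "(real ^ 'n \<Rightarrow> real) set" where
  "S = {w. continuous_on UNIV w \<and> (\<forall>x. 0 \<le> w x) \<and> (\<forall>x. x \<notin> \<Omega> \<longrightarrow> w x = 0) \<and> (\<forall>x. 0 < w x \<longrightarrow> sub_at k p w x)}"

text \<open>Where \<open>w\<close> exceeds \<open>t > 1\<close> times the paraboloid by the most, a
  shift of the latter touches \<open>w\<close> from above. A frame orthogonal to its gradient gives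
  \<open>t * (1 - p) \<le> 1 - p\<close>, a contradiction.\<close>

lemma barrier:
  assumes w: "w \<in> S" and y: "y \<in> Y" and x: "x \<in> \<Omega>"
  shows "w x \<le> \<beta> * (R\<^sup>2 - (norm (x - y))\<^sup>2)"
proof (rule ccontr)
  define d where "d z = R\<^sup>2 - (norm (z - y))\<^sup>2" for z
  assume "\<not> ?thesis"
  then have less: "\<beta> * d x < w x" by (simp add: d_def)
  have "norm (x - y) < R" using x y by (simp add: \<Omega>_iff)
  then have "(norm (x - y))\<^sup>2 < R\<^sup>2" by (intro power_strict_mono) auto
  then have dx: "0 < d x" by (simp add: d_def)
  define t where "t = (1 + w x / (\<beta> * d x)) / 2"
  have t: "1 < t" "t * (\<beta> * d x) < w x" using less dx \<beta>(1) by (auto simp: t_def field_simps)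
  define \<tau> where "\<tau> = t * \<beta>"
  have \<tau>: "0 < \<tau>" using t \<beta> by (simp add: \<tau>_def)
  have wc: "continuous_on UNIV w" using w by (simp add: S_def)
  have cont: "continuous_on (closure \<Omega>) (\<lambda>z. w z - \<tau> * d z)"
    unfolding d_def using wc continuous_on_subset by (intro continuous_intros) auto
  have cO: "compact (closure \<Omega>)" "x \<in> closure \<Omega>" using bd x closure_subset by auto
  then have "closure \<Omega> \<noteq> {}" by auto
  from continuous_attains_sup[OF cO(1) this cont]
  obtain x0 where x0: "x0 \<in> closure \<Omega>" and mx': "\<forall>z\<in>closure \<Omega>. w z - \<tau> * d z \<le> w x0 - \<tau> * d x0"
    by (rule bexE)
  note mx = mx'[rule_format]
  define m where "m = w x0 - \<tau> * d x0"
  have m: "0 < m" using mx[OF cO(2)] t by (simp add: m_def \<tau>_def mult.assoc)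
  \<comment> \<open>The paraboloid is nonnegative on the closure, so \<open>w\<close> is positive at
    the maximum point; this places the point in \<open>\<Omega>\<close>.\<close>
  have "\<Omega> \<subseteq> cball y R" using y by (auto simp: \<Omega>_iff dist_norm norm_minus_commute less_imp_le)
  then have "closure \<Omega> \<subseteq> cball y R" by (rule closure_minimal) simp
  then have "norm (x0 - y) \<le> R" using x0 by (auto simp: dist_norm norm_minus_commute)
  then have "(norm (x0 - y))\<^sup>2 \<le> R\<^sup>2" by (intro power_mono) auto
  then have "0 \<le> \<tau> * d x0" using \<tau> by (simp add: d_def)
  then have w0: "0 < w x0" using m by (simp add: m_def)
  then have xO: "x0 \<in> \<Omega>" using w by (force simp: S_def)
  define Q where "Q = quad y (\<tau> * R\<^sup>2 + m) 0 (mat (- 2 * \<tau>))"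
  have Q: "Q z = \<tau> * d z + m" for z
    unfolding Q_def quad_ball d_def by (simp add: algebra_simps)
  have "\<forall>\<^sub>F z in nhds x0. w z \<le> Q z"
    using eventually_nhds_in_open[OF op xO]
    by eventually_elim (use mx closure_subset in \<open>force simp: Q m_def\<close>)
  moreover have "C2_at Q (\<lambda>z. 0 + mat (- 2 * \<tau>) *v (z - y)) (mat (- 2 * \<tau>)) x0"
    unfolding Q_def by (rule C2_at_quad) simp
  moreover have "Q x0 = w x0" by (simp add: Q m_def)
  ultimately have ta: "touches_above Q (\<lambda>z. 0 + mat (- 2 * \<tau>) *v (z - y)) (mat (- 2 * \<tau>)) w x0"
    unfolding touches_above_def by blast
  have "sub_at k p w x0" using w w0 by (simp add: S_def)
  then have G: "0 \<le> opw k p (w x0) (0 + mat (- 2 * \<tau>) *v (x0 - y)) (mat (- 2 * \<tau>))"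
    using ta unfolding sub_at_def by blast
  obtain e where e: "frame k e" "\<And>i. i < k \<Longrightarrow> e i \<bullet> (x0 - y) = 0"
    using ex_frame_orthogonal[OF k(2), of "x0 - y"] by blast
  have P: "P_minus k (mat (- 2 * \<tau>) + c *\<^sub>R outer (0 + mat (- 2 * \<tau>) *v (x0 - y))) \<le> - 2 * \<tau> * real k" for c
  proof -
    have "P_minus k (mat (- 2 * \<tau>) + c *\<^sub>R outer (0 + mat (- 2 * \<tau>) *v (x0 - y))) \<le>
        ftrace k e (mat (- 2 * \<tau>) + c *\<^sub>R outer (0 + mat (- 2 * \<tau>) *v (x0 - y)))"
      by (rule P_minus_le_ftrace) (use k' k e in auto)
    also have "\<dots> = - 2 * \<tau> * real k"
      using e by (simp add: ftrace_add ftrace_mat ftrace_scaleR ftrace_outer mat_mult_vec)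
    finally show ?thesis .
  qed
  have "2 * \<tau> * real k \<le> 1 - p"
    using G P[of "p / ((1 - p) * w x0)"] unfolding opw_def by linarith
  then have "t * (1 - p) \<le> 1 - p" using \<beta>(2) by (simp add: \<tau>_def mult_ac)
  then show False using t p by simp
qed

text \<open>The steepest slope of the paraboloid barrier, attained on the sphere of radius
  \<open>R\<close>.\<close>

definition L where "L = 2 * R * \<beta>"

lemma L_pos: "0 < L" using R \<beta> by (simp add: L_def)

text \<open>Outside \<open>\<Omega>\<close> the barrier bounds the translate by
  \<open>L * norm h\<close>, so lowering it by that amount restores the zero boundary values. One
  upper barrier thus controls the modulus of continuity everywhere.\<close>

lemma translate_max_in_S:
  assumes w: "w \<in> S"
  shows "(\<lambda>x. max (w x) (w (x + h) - L * norm h)) \<in> S"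
proof -
  define w' where "w' x = max (w x) (w (x + h) - L * norm h)" for x
  have wc: "continuous_on UNIV w" and w0: "\<And>x. 0 \<le> w x" "\<And>x. x \<notin> \<Omega> \<Longrightarrow> w x = 0"
    and sub: "\<And>x. 0 < w x \<Longrightarrow> sub_at k p w x" using w by (auto simp: S_def)
  have Lh: "0 \<le> L * norm h" using L_pos by simp
  have "continuous_on UNIV w'"
    unfolding w'_def by (auto intro!: continuous_intros wc continuous_on_compose2[OF wc])
  moreover have "0 \<le> w' x" for x using w0(1)[of x] by (simp add: w'_def)
  moreover have "w' x = 0" if x: "x \<notin> \<Omega>" for x
  proof -
    have "w (x + h) \<le> L * norm h"
    proof (cases "x + h \<in> \<Omega>")
      case True
      obtain y where y: "y \<in> Y" "R \<le> norm (x - y)" using x by (auto simp: \<Omega>_iff not_less)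
      have l: "norm (x + h - y) < R" using True y(1) by (simp add: \<Omega>_iff)
      have "norm (x - y) \<le> norm (x + h - y) + norm h"
        using norm_triangle_ineq4[of "x + h - y" h] by simp
      \<comment> \<open>A difference of squares in factored form: the depth of \<open>x + h\<close>
        in the ball is at most \<open>norm h\<close>, because \<open>x\<close> lies outside, and the
        other factor is at most \<open>2 * R\<close>.\<close>
      then have "(R - norm (x + h - y)) * (R + norm (x + h - y)) \<le> norm h * (2 * R)"
        using y(2) l R norm_ge_zero[of "x + h - y"] norm_ge_zero[of h] by (intro mult_mono) linarith+
      then have "R\<^sup>2 - (norm (x + h - y))\<^sup>2 \<le> norm h * (2 * R)" by (simp add: power2_eq_square algebra_simps)
      then have "\<beta> * (R\<^sup>2 - (norm (x + h - y))\<^sup>2) \<le> \<beta> * (norm h * (2 * R))"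
        using \<beta> by (intro mult_left_mono) auto
      then show ?thesis using barrier[OF w y(1) True] by (simp add: L_def mult_ac)
    qed (use w0 Lh in simp)
    then show ?thesis using w0(2)[OF x] by (simp add: w'_def)
  qed
  moreover have "sub_at k p w' x" if x: "0 < w' x" for x
  proof (cases "w' x = w x")
    case True
    then show ?thesis using x by (intro sub_at_le[OF sub]) (auto simp: w'_def)
  next
    case False
    then have e: "w' x = w (x + h) - L * norm h" by (auto simp: w'_def max_def split: if_splits)
    show ?thesis
    proof (rule sub_at_le[where w = "\<lambda>z. w (z + h) - L * norm h"])
      show "sub_at k p (\<lambda>z. w (z + h) - L * norm h) x"
        using x e Lh by (intro sub_at_translate[OF k(1) k' p] sub) auto
    qed (use e in \<open>auto simp: w'_def\<close>)
  qed
  ultimately show ?thesis unfolding S_def w'_def[abs_def] by blast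
qed

definition W where "W x = (SUP w\<in>S. w x)"

lemma zero_in_S: "(\<lambda>_. 0) \<in> S" by (simp add: S_def)

lemma S_le_W:
  assumes "w \<in> S" shows "w x \<le> W x"
  unfolding W_def
proof (rule cSUP_upper[OF assms])
  show "bdd_above ((\<lambda>w. w x) ` S)"
  proof (cases "x \<in> \<Omega>")
    case True
    obtain y where "y \<in> Y" using Y_nonempty by blast
    then show ?thesis using barrier True by (intro bdd_aboveI2[of _ _ "\<beta> * (R\<^sup>2 - (norm (x - y))\<^sup>2)"]) auto
  next
    case False
    then show ?thesis by (intro bdd_aboveI2[of _ _ 0]) (auto simp: S_def)
  qed
qed

lemma W_leI: "(\<And>w. w \<in> S \<Longrightarrow> w x \<le> c) \<Longrightarrow> W x \<le> c"
  unfolding W_def using zero_in_S by (intro cSUP_least) auto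

lemma W_nonneg: "0 \<le> W x" using S_le_W[OF zero_in_S] by simp

lemma W_outside: "x \<notin> \<Omega> \<Longrightarrow> W x = 0"
  by (intro antisym W_nonneg W_leI) (simp add: S_def)

text \<open>The Perron class is closed under the maximum with a lowered translate, so its supremum
  dominates every lowered translate of a member.\<close>

lemma W_lipschitz: "\<bar>W x - W z\<bar> \<le> L * norm (x - z)"
proof -
  have "W z \<le> W x + L * norm (z - x)" for x z
  proof (rule W_leI)
    fix w assume "w \<in> S"
    from S_le_W[OF translate_max_in_S[OF this, of "z - x"], of x]
    show "w z \<le> W x + L * norm (z - x)" by simp
  qed
  from this[of z x] this[of x z] show ?thesis by (simp add: norm_minus_commute)
qed

lemma W_continuous: "continuous_on UNIV W"
proof -
  have "L-lipschitz_on UNIV W"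
    using W_lipschitz L_pos by (auto simp: lipschitz_on_def dist_norm)
  then show ?thesis by (rule lipschitz_on_continuous_on)
qed

text \<open>The paraboloid solution on a small ball, cut off at zero, belongs to \<open>S\<close>;
  in \<open>opw\<close> the gradient term only helps.\<close>

lemma W_pos:
  assumes "x0 \<in> \<Omega>" shows "0 < W x0"
proof -
  obtain r where r: "0 < r" "ball x0 r \<subseteq> \<Omega>" using op assms by (auto simp: open_contains_ball)
  define Q where "Q = quad x0 (\<beta> * r\<^sup>2) 0 (mat (- 2 * \<beta>))"
  have Q: "Q x = \<beta> * (r\<^sup>2 - (norm (x - x0))\<^sup>2)" for x
    unfolding Q_def quad_ball by (simp add: algebra_simps)
  define w where "w x = max 0 (Q x)" for x
  have "w \<in> S" unfolding S_def
  proof (intro CollectI conjI allI impI)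
    show "continuous_on UNIV w" unfolding w_def Q by (intro continuous_intros)
    show "0 \<le> w x" for x by (simp add: w_def)
    show "w x = 0" if "x \<notin> \<Omega>" for x
    proof -
      have "r \<le> norm (x - x0)" using that r by (auto simp: dist_norm norm_minus_commute not_less)
      then have "r\<^sup>2 \<le> (norm (x - x0))\<^sup>2" using r by (intro power_mono) auto
      then show ?thesis using \<beta> by (simp add: w_def Q mult_le_0_iff)
    qed
    show "sub_at k p w x" if x: "0 < w x" for x
    proof (rule sub_at_C2I[OF _ _ _ k(1) k'])
      show "C2_at Q (\<lambda>z. 0 + mat (- 2 * \<beta>) *v (z - x0)) (mat (- 2 * \<beta>)) x"
        unfolding Q_def by (rule C2_at_quad) simp
      show "Q x = w x" using x by (simp add: w_def max_def split: if_splits)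
      show "\<forall>\<^sub>F z in nhds x. Q z \<le> w z" by (simp add: w_def)
      define c where "c = p / ((1 - p) * w x)"
      have "0 \<le> c" using p x by (simp add: c_def)
      have "- 2 * \<beta> * real k \<le> P_minus k (mat (- 2 * \<beta>) + c *\<^sub>R outer (0 + mat (- 2 * \<beta>) *v (x - x0)))"
      proof (rule P_minus_geI[OF _ k(1) k'])
        fix e :: "nat \<Rightarrow> real ^ 'n" assume e: "frame k e"
        have "0 \<le> ftrace k e (c *\<^sub>R outer (0 + mat (- 2 * \<beta>) *v (x - x0)))"
          unfolding ftrace_scaleR ftrace_outer using \<open>0 \<le> c\<close> by (intro mult_nonneg_nonneg sum_nonneg) auto
        then show "- 2 * \<beta> * real k \<le> ftrace k e (mat (- 2 * \<beta>) + c *\<^sub>R outer (0 + mat (- 2 * \<beta>) *v (x - x0)))"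
          by (simp add: ftrace_add ftrace_mat[OF e])
      qed simp
      then show "0 \<le> opw k p (w x) (0 + mat (- 2 * \<beta>) *v (x - x0)) (mat (- 2 * \<beta>))"
        unfolding opw_def c_def using \<beta>(2) by simp
    qed
  qed
  from S_le_W[OF this, of x0] have "\<beta> * r\<^sup>2 \<le> W x0" by (simp add: w_def Q)
  moreover have "0 < \<beta> * r\<^sup>2" using \<beta> r by simp
  ultimately show ?thesis by linarith
qed

text \<open>Stability under suprema: members of \<open>S\<close> nearly optimal at \<open>x0\<close>
  are touched by translates of a strict test function at points tending to \<open>x0\<close>, and
  \<open>opw\<close> passes to the limit.\<close>

lemma W_sub:
  assumes r: "0 < W x0" shows "sub_at k p W x0"
  unfolding sub_at_def
proof (intro allI impI)
  fix \<phi> g H assume t: "touches_above \<phi> g H W x0"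
  note sym = touches_sym(1)[OF t]
  have "0 \<le> opw k p (W x0) (g x0) H + (4 * real k) * \<epsilon>" if \<epsilon>: "0 < \<epsilon>" for \<epsilon>
  proof -
    \<comment> \<open>Half of the margin absorbs the Taylor error; the other half separates
      \<open>W\<close> from \<open>Q\<close> by
      \<open>\<epsilon> * (norm (x - x0))\<^sup>2\<close>.\<close>
    define X where "X = H + mat (4 * \<epsilon>)"
    have X: "transpose X = X" by (simp add: X_def sym)
    define Q where "Q = quad x0 (W x0) (g x0) X"
    have "\<forall>\<^sub>F x in nhds x0. W x \<le> Q x - \<epsilon> * (norm (x - x0))\<^sup>2"
      using touches_above_quad[OF t \<epsilon>] by eventually_elim (simp add: Q_def X_def quad_add_mat)
    then obtain d where d: "0 < d" "\<And>x. dist x x0 < d \<Longrightarrow> W x \<le> Q x - \<epsilon> * (norm (x - x0))\<^sup>2"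
      unfolding eventually_nhds_metric by blast
    define \<rho> where "\<rho> = d / 2"
    have \<rho>: "0 < \<rho>" "\<And>x. x \<in> cball x0 \<rho> \<Longrightarrow> W x \<le> Q x - \<epsilon> * (norm (x - x0))\<^sup>2"
      using d by (auto simp: \<rho>_def dist_commute)
    have CQ: "C2_at Q (\<lambda>x. g x0 + X *v (x - x0)) X z" for z unfolding Q_def by (rule C2_at_quad[OF X])
    then have Qc: "continuous_on UNIV Q" using C2_at_isCont[OF CQ] by (auto simp: continuous_on_eq_continuous_at)
    \<comment> \<open>A null sequence; the shift \<open>n + 2\<close> keeps it strictly below
      \<open>\<epsilon> * \<rho>\<^sup>2\<close> from the start.\<close>
    define \<eta> where "\<eta> n = \<epsilon> * \<rho>\<^sup>2 / real (n + 2)" for n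
    have \<eta>: "0 < \<eta> n" "\<eta> n < \<epsilon> * \<rho>\<^sup>2" for n
      using \<epsilon> \<rho>(1) by (auto simp: \<eta>_def divide_less_eq)
    have "\<exists>z s. (norm (z - x0))\<^sup>2 \<le> \<eta> n / \<epsilon> \<and> Q z - \<eta> n \<le> s \<and> s \<le> W z \<and>
        (0 < s \<longrightarrow> 0 \<le> opw k p s (g x0 + X *v (z - x0)) X)" for n
    proof -
      obtain w where w: "w \<in> S" "W x0 - \<eta> n < w x0"
      proof -
        have "\<not> W x0 \<le> W x0 - \<eta> n" using \<eta> by (simp add: not_le)
        then show ?thesis using W_leI[of x0 "W x0 - \<eta> n"] that by (meson not_less)
      qed
      have wc: "continuous_on UNIV w" and wsub: "\<And>x. 0 < w x \<Longrightarrow> sub_at k p w x" using w by (auto simp: S_def)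
      have "continuous_on (cball x0 \<rho>) (\<lambda>x. w x - Q x)"
        using wc Qc continuous_on_subset by (intro continuous_intros) auto
      moreover have "cball x0 \<rho> \<noteq> {}" using \<rho> by auto
      ultimately obtain z where z: "z \<in> cball x0 \<rho>" and mx: "\<And>x. x \<in> cball x0 \<rho> \<Longrightarrow> w x - Q x \<le> w z - Q z"
        using continuous_attains_sup[OF compact_cball, of x0 \<rho> "\<lambda>x. w x - Q x"] by blast
      \<comment> \<open>Together with the next bound this confines the maximum point
        \<open>z\<close> to distance \<open>sqrt (\<eta> n / \<epsilon>)\<close> from
        \<open>x0\<close>, inside the open ball.\<close>
      have 1: "- \<eta> n \<le> w z - Q z" using mx[of x0] \<rho>(1) w(2) by (simp add: Q_def)
      have 2: "w z - Q z \<le> - (\<epsilon> * (norm (z - x0))\<^sup>2)" using \<rho>(2)[OF z] S_le_W[OF w(1), of z] by simp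
      have 3: "\<epsilon> * (norm (z - x0))\<^sup>2 \<le> \<eta> n" using 1 2 by simp
      then have "\<epsilon> * (norm (z - x0))\<^sup>2 < \<epsilon> * \<rho>\<^sup>2" using \<eta>(2)[of n] by simp
      then have "norm (z - x0) < \<rho>" using \<epsilon> \<rho>(1) power_less_imp_less_base by fastforce
      then have zb: "z \<in> ball x0 \<rho>" by (simp add: dist_norm norm_minus_commute)
      have "\<forall>\<^sub>F x in nhds z. w x \<le> Q x + (w z - Q z)"
        using eventually_nhds_in_open[OF open_ball zb]
        by eventually_elim (use mx in \<open>force simp: algebra_simps\<close>)
      then have "touches_above (\<lambda>x. Q x + (w z - Q z)) (\<lambda>x. g x0 + X *v (x - x0)) X w z"
        unfolding touches_above_def using C2_at_add_const[OF CQ] by simp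
      then have "0 < w z \<longrightarrow> 0 \<le> opw k p (w z) (g x0 + X *v (z - x0)) X"
        using wsub unfolding sub_at_def by blast
      moreover have "(norm (z - x0))\<^sup>2 \<le> \<eta> n / \<epsilon>" using 3 \<epsilon> by (simp add: field_simps)
      ultimately show ?thesis using 1 S_le_W[OF w(1), of z] by (intro exI[of _ z] exI[of _ "w z"]) auto
    qed
    then obtain z s where zs: "\<And>n. (norm (z n - x0))\<^sup>2 \<le> \<eta> n / \<epsilon>" "\<And>n. Q (z n) - \<eta> n \<le> s n" "\<And>n. s n \<le> W (z n)"
      "\<And>n. 0 < s n \<Longrightarrow> 0 \<le> opw k p (s n) (g x0 + X *v (z n - x0)) X" by metis
    have \<eta>lim: "\<eta> \<longlonglongrightarrow> 0"
    proof -
      have "(\<lambda>n. \<epsilon> * \<rho>\<^sup>2 / real n) \<longlonglongrightarrow> 0" by (rule lim_const_over_n)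
      from LIMSEQ_ignore_initial_segment[OF this, of 2] show ?thesis by (simp add: \<eta>_def[abs_def])
    qed
    have "(\<lambda>n. (norm (z n - x0))\<^sup>2) \<longlonglongrightarrow> 0"
    proof (rule Lim_null_comparison)
      show "(\<lambda>n. \<eta> n / \<epsilon>) \<longlonglongrightarrow> 0" using tendsto_divide[OF \<eta>lim tendsto_const[of \<epsilon>]] \<epsilon> by simp
    qed (use zs(1) in simp)
    from tendsto_real_sqrt[OF this] have "(\<lambda>n. norm (z n - x0)) \<longlonglongrightarrow> 0" by simp
    then have zlim: "z \<longlonglongrightarrow> x0" by (rule LIM_zero_cancel[OF tendsto_norm_zero_cancel])
    have Qlim: "(\<lambda>n. Q (z n)) \<longlonglongrightarrow> W x0"
      using isCont_tendsto_compose[OF C2_at_isCont[OF CQ] zlim] by (simp add: Q_def)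
    have Wlim: "(\<lambda>n. W (z n)) \<longlonglongrightarrow> W x0"
      using W_continuous zlim by (simp add: continuous_on_eq_continuous_at isCont_tendsto_compose)
    have slim: "s \<longlonglongrightarrow> W x0"
    proof (rule tendsto_sandwich)
      show "(\<lambda>n. Q (z n) - \<eta> n) \<longlonglongrightarrow> W x0" using tendsto_diff[OF Qlim \<eta>lim] by simp
    qed (use zs Wlim in auto)
    have qlim: "(\<lambda>n. g x0 + X *v (z n - x0)) \<longlonglongrightarrow> g x0"
    proof -
      have "(\<lambda>n. X *v (z n - x0)) \<longlonglongrightarrow> X *v (x0 - x0)"
        by (intro bounded_linear.tendsto[OF matrix_vector_mul_bounded_linear] tendsto_intros zlim)
      from tendsto_add[OF tendsto_const[of "g x0"] this] show ?thesis by simp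
    qed
    have "(\<lambda>n. opw k p (s n) (g x0 + X *v (z n - x0)) X) \<longlonglongrightarrow> opw k p (W x0) (g x0) X"
      using r by (intro tendsto_opw[OF k(1) k' p(2) slim qlim _ X]) auto
    moreover have "\<forall>\<^sub>F n in sequentially. 0 \<le> opw k p (s n) (g x0 + X *v (z n - x0)) X"
      using order_tendstoD(1)[OF slim r] by eventually_elim (rule zs(4))
    ultimately have "0 \<le> opw k p (W x0) (g x0) X"
      by (rule tendsto_lowerbound) simp
    then show ?thesis by (simp add: X_def opw_add_mat[OF sym k(1) k'])
  qed
  then show "0 \<le> opw k p (W x0) (g x0) H" by (rule field_le_mult_epsilon) simp_all
qed

text \<open>If the inequality failed, a raised quadratic would be a strict subsolution near
  \<open>x0\<close>; glued to \<open>W\<close> by a maximum it gives a member of \<open>S\<close>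
  larger than \<open>W\<close> at \<open>x0\<close>.\<close>

lemma W_super:
  assumes x0: "x0 \<in> \<Omega>" shows "super_at k p W x0"
  unfolding super_at_def
proof (intro allI impI)
  fix \<phi> g H assume t: "touches_below \<phi> g H W x0"
  note sym = touches_sym(2)[OF t]
  define r where "r = W x0"
  have r: "0 < r" using W_pos[OF x0] by (simp add: r_def)
  show "opw k p (W x0) (g x0) H \<le> 0"
  proof (rule ccontr)
    assume "\<not> ?thesis"
    then have pos: "0 < opw k p r (g x0) H" by (simp add: r_def)
    \<comment> \<open>Lowering the Hessian by \<open>4 * \<epsilon>\<close> then costs half of the
      positive value of \<open>opw\<close>.\<close>
    define \<epsilon> where "\<epsilon> = opw k p r (g x0) H / (8 * real k)"
    have \<epsilon>: "0 < \<epsilon>" using pos k by (simp add: \<epsilon>_def)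
    define X where "X = H + mat (- 4 * \<epsilon>)"
    have X: "transpose X = X" by (simp add: X_def sym)
    have Xpos: "0 < opw k p r (g x0) X"
      unfolding X_def opw_add_mat[OF sym k(1) k'] using pos k by (simp add: \<epsilon>_def)
    define Q where "Q = quad x0 r (g x0) X"
    have CQ: "C2_at Q (\<lambda>x. g x0 + X *v (x - x0)) X z" for z unfolding Q_def by (rule C2_at_quad[OF X])
    then have Qc: "continuous_on UNIV Q" using C2_at_isCont[OF CQ] by (auto simp: continuous_on_eq_continuous_at)
    have ev1: "\<forall>\<^sub>F x in nhds x0. Q x + \<epsilon> * (norm (x - x0))\<^sup>2 \<le> W x"
      using touches_below_quad[OF t \<epsilon>] by eventually_elim (simp add: Q_def X_def quad_add_mat r_def)
    have "((\<lambda>a. opw k p (fst a) (g x0 + X *v (snd a - x0)) X) \<longlongrightarrow> opw k p r (g x0) X) (nhds (r, x0))"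
    proof (intro tendsto_opw[OF k(1) k' p(2) _ _ _ X])
      show "(fst \<longlongrightarrow> r) (nhds (r, x0))" using tendsto_fst[OF filterlim_ident, of "(r, x0)"] by simp
      have s: "(snd \<longlongrightarrow> x0) (nhds (r, x0))" using tendsto_snd[OF filterlim_ident, of "(r, x0)"] by simp
      have "((\<lambda>a. X *v (snd a - x0)) \<longlongrightarrow> X *v (x0 - x0)) (nhds (r, x0))"
        by (intro bounded_linear.tendsto[OF matrix_vector_mul_bounded_linear] tendsto_intros s)
      from tendsto_add[OF tendsto_const[of "g x0"] this]
      show "((\<lambda>a. g x0 + X *v (snd a - x0)) \<longlongrightarrow> g x0) (nhds (r, x0))" by simp
    qed (use r in auto)
    from order_tendstoD(1)[OF this Xpos]
    obtain d where d: "0 < d" "\<And>s z. dist (s, z) (r, x0) < d \<Longrightarrow> 0 < opw k p s (g x0 + X *v (z - x0)) X"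
      unfolding eventually_nhds_metric by (metis fst_conv snd_conv)
    have "Q x0 = r" by (simp add: Q_def)
    then have ev2: "\<forall>\<^sub>F x in nhds x0. dist (Q x) r < d / 4"
      using tendstoD[OF isCont_nhds[OF C2_at_isCont[OF CQ]], of "d / 4" x0] d(1) by simp
    have ev3: "\<forall>\<^sub>F x in nhds x0. x \<in> \<Omega>" by (rule eventually_nhds_in_open[OF op x0])
    obtain \<rho>1 where \<rho>1: "0 < \<rho>1" "\<And>x. dist x x0 < \<rho>1 \<Longrightarrow> Q x + \<epsilon> * (norm (x - x0))\<^sup>2 \<le> W x \<and> dist (Q x) r < d / 4 \<and> x \<in> \<Omega>"
      using eventually_conj[OF ev1 eventually_conj[OF ev2 ev3]] unfolding eventually_nhds_metric by blast
    define \<rho> where "\<rho> = min \<rho>1 (d / 2) / 2"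
    have \<rho>: "0 < \<rho>" "\<rho> < \<rho>1" "\<rho> < d / 2" using \<rho>1(1) d(1) by (auto simp: \<rho>_def min_def)
    \<comment> \<open>Below \<open>\<epsilon> * \<rho>\<^sup>2\<close>, so that
      \<open>Q + \<delta>\<close> is under \<open>W\<close> on the sphere and the gluing is
      continuous; below \<open>d / 4\<close>, so that the raised values stay where
      \<open>opw\<close> is positive.\<close>
    define \<delta> where "\<delta> = min (\<epsilon> * \<rho>\<^sup>2) (d / 4) / 2"
    have \<delta>: "0 < \<delta>" "\<delta> < \<epsilon> * \<rho>\<^sup>2" "\<delta> < d / 4" using \<epsilon> \<rho>(1) d(1) by (auto simp: \<delta>_def min_def)
    have \<rho>2: "Q x + \<epsilon> * (norm (x - x0))\<^sup>2 \<le> W x" "dist (Q x) r < d / 4" "x \<in> \<Omega>" if "x \<in> cball x0 \<rho>" for x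
      using \<rho>1(2)[of x] that \<rho>(2) by (auto simp: dist_commute)
    define w where "w x = (if x \<in> ball x0 \<rho> then max (W x) (Q x + \<delta>) else W x)" for x
    have Ww: "W x \<le> w x" for x by (simp add: w_def)
    have "w \<in> S" unfolding S_def
    proof (intro CollectI conjI allI impI)
      have "continuous_on (cball x0 \<rho> \<union> - ball x0 \<rho>) (\<lambda>x. if x \<in> ball x0 \<rho> then max (W x) (Q x + \<delta>) else W x)"
      proof (rule continuous_on_cases)
        show "continuous_on (cball x0 \<rho>) (\<lambda>x. max (W x) (Q x + \<delta>))" "continuous_on (- ball x0 \<rho>) W"
          using W_continuous Qc continuous_on_subset by (auto intro!: continuous_intros)
        show "\<forall>x. x \<in> cball x0 \<rho> \<and> x \<notin> ball x0 \<rho> \<or> x \<in> - ball x0 \<rho> \<and> x \<in> ball x0 \<rho> \<longrightarrow> max (W x) (Q x + \<delta>) = W x"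
        proof (intro allI impI)
          fix x assume "x \<in> cball x0 \<rho> \<and> x \<notin> ball x0 \<rho> \<or> x \<in> - ball x0 \<rho> \<and> x \<in> ball x0 \<rho>"
          then have x: "x \<in> cball x0 \<rho>" "norm (x - x0) = \<rho>" by (auto simp: dist_norm norm_minus_commute)
          show "max (W x) (Q x + \<delta>) = W x" using \<rho>2(1)[OF x(1)] x(2) \<delta>(2) by simp
        qed
      qed auto
      moreover have "cball x0 \<rho> \<union> - ball x0 \<rho> = UNIV" by auto
      ultimately show "continuous_on UNIV w" by (simp add: w_def[abs_def])
      show "0 \<le> w x" for x using Ww[of x] W_nonneg[of x] by linarith
      show "w x = 0" if "x \<notin> \<Omega>" for x using that \<rho>2(3)[of x] W_outside by (auto simp: w_def)
      show "sub_at k p w x" if x: "0 < w x" for x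
      proof (cases "w x = W x")
        case True
        then have "sub_at k p W x" using x by (intro W_sub) simp
        then show ?thesis using True[symmetric] Ww by (rule sub_at_le)
      next
        case False
        then have xb: "x \<in> ball x0 \<rho>" and wx: "w x = Q x + \<delta>" by (auto simp: w_def max_def split: if_splits)
        show ?thesis
        proof (rule sub_at_C2I[OF _ _ _ k(1) k'])
          show "C2_at (\<lambda>z. Q z + \<delta>) (\<lambda>x. g x0 + X *v (x - x0)) X x" by (rule C2_at_add_const[OF CQ])
          show "\<forall>\<^sub>F z in nhds x. Q z + \<delta> \<le> w z"
            using eventually_nhds_in_open[OF open_ball xb] by eventually_elim (simp add: w_def)
          have "dist (w x, x) (r, x0) \<le> dist (w x) r + dist x x0"
            by (simp add: dist_prod_def sqrt_sum_squares_le_sum)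
          also have "dist (w x) r + dist x x0 < d"
          proof -
            have "dist (Q x) r < d / 4" using xb by (intro \<rho>2(2)) simp
            then have "dist (w x) r < d / 4 + d / 4" using \<delta> unfolding wx dist_real_def by linarith
            moreover have "dist x x0 < d / 2" using xb \<rho>(3) by (simp add: dist_commute)
            ultimately show ?thesis by linarith
          qed
          finally show "0 \<le> opw k p (w x) (g x0 + X *v (x - x0)) X" using d(2) by (simp add: less_imp_le)
        qed (simp add: wx)
      qed
    qed
    from S_le_W[OF this, of x0] have "r + \<delta> \<le> r" using \<rho>(1) by (simp add: w_def r_def[symmetric] Q_def)
    then show False using \<delta>(1) by simp
  qed
qed

definition U where "U x = W x powr (1 / (1 - p))"

lemma U_powr: "U x powr (1 - p) = W x"
  using p W_nonneg[of x] by (simp add: U_def powr_powr)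

lemma U_solution: "Dirichlet_solution k p \<Omega> U"
proof -
  have Uc: "continuous_on A U" for A
    unfolding U_def using p W_nonneg continuous_on_subset[OF W_continuous, of A]
    by (intro continuous_on_powr_pos) auto
  have Upos: "0 < U x" if "x \<in> \<Omega>" for x using W_pos[OF that] by (simp add: U_def)
  have U0: "0 \<le> U x" for x by (simp add: U_def)
  have sub: "viscosity_subsolution k p \<Omega> U"
    unfolding viscosity_subsolution_iff[OF op k(1) k']
  proof (intro conjI)
    show "usc_on \<Omega> U" unfolding usc_on_def
      using Uc[of \<Omega>] by (auto simp: continuous_on_def intro: order_tendstoD)
    show "\<forall>x0\<in>\<Omega>. \<forall>\<phi> g H. touches_above \<phi> g H U x0 \<longrightarrow> 0 \<le> P_minus k H + U x0 powr p"
    proof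
      fix x0 assume x0: "x0 \<in> \<Omega>"
      have "sub_at k p (\<lambda>x. U x powr (1 - p)) x0" using W_sub[OF W_pos[OF x0]] by (simp add: U_powr)
      then show "\<forall>\<phi> g H. touches_above \<phi> g H U x0 \<longrightarrow> 0 \<le> P_minus k H + U x0 powr p"
        using sub_at_powr_iff[of k p U x0, OF k(1) k' p Upos[OF x0]] U0 by simp
    qed
  qed (use U0 in auto)
  have super: "viscosity_supersolution k p \<Omega> U"
    unfolding viscosity_supersolution_iff[OF op k(1) k']
  proof (intro conjI)
    show "lsc_on \<Omega> U" unfolding lsc_on_def
      using Uc[of \<Omega>] by (auto simp: continuous_on_def intro: order_tendstoD)
    show "\<forall>x0\<in>\<Omega>. \<forall>\<phi> g H. touches_below \<phi> g H U x0 \<longrightarrow> P_minus k H + U x0 powr p \<le> 0"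
    proof
      fix x0 assume x0: "x0 \<in> \<Omega>"
      have "super_at k p (\<lambda>x. U x powr (1 - p)) x0" using W_super[OF x0] by (simp add: U_powr)
      then show "\<forall>\<phi> g H. touches_below \<phi> g H U x0 \<longrightarrow> P_minus k H + U x0 powr p \<le> 0"
        using super_at_powr_iff[of k p U x0, OF k(1) k' p Upos[OF x0]] U0 by simp
    qed
  qed (use U0 in auto)
  have "U x = 0" if "x \<in> frontier \<Omega>" for x
  proof -
    have "x \<notin> \<Omega>" using that op by (auto simp: frontier_def interior_open)
    then show ?thesis by (simp add: U_def W_outside)
  qed
  then show ?thesis
    using Uc Upos sub super by (simp add: Dirichlet_solution_def viscosity_solution_def)
qed

text \<open>The Lipschitz bound for \<open>W\<close>, which vanishes at \<open>x0\<close>, becomes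
  Hoelder decay of exponent \<open>1 / (1 - p)\<close> for its power \<open>U\<close>; the excess
  over \<open>q\<close> is a positive power of the distance.\<close>

lemma U_decay:
  assumes x0: "x0 \<in> frontier \<Omega>" and q: "q < 1 / (1 - p)"
  shows "((\<lambda>x. (U x - U x0) / norm (x - x0) powr q) \<longlongrightarrow> 0) (at x0 within \<Omega>)"
proof -
  define a where "a = 1 / (1 - p)"
  have a: "0 < a" using p by (simp add: a_def)
  have "x0 \<notin> \<Omega>" using x0 op by (auto simp: frontier_def interior_open)
  then have W0: "W x0 = 0" and U0: "U x0 = 0" by (simp_all add: U_def W_outside)
  have bound: "norm ((U x - U x0) / norm (x - x0) powr q) \<le> L powr a * norm (x - x0) powr (a - q)" for x
  proof -
    have "W x \<le> L * norm (x - x0)" using W_lipschitz[of x x0] W0 by simp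
    then have "U x \<le> (L * norm (x - x0)) powr a"
      unfolding U_def a_def[symmetric] using a W_nonneg by (intro powr_mono2) auto
    also have "\<dots> = L powr a * norm (x - x0) powr a" using L_pos by (simp add: powr_mult)
    finally have "U x / norm (x - x0) powr q \<le> L powr a * norm (x - x0) powr a / norm (x - x0) powr q"
      by (rule divide_right_mono) simp
    moreover have "0 \<le> U x" by (simp add: U_def)
    ultimately show ?thesis by (simp add: U0 powr_diff)
  qed
  have "((\<lambda>x. norm (x - x0)) \<longlongrightarrow> norm (x0 - x0)) (at x0 within \<Omega>)" by (intro tendsto_intros)
  then have "((\<lambda>x. norm (x - x0) powr (a - q)) \<longlongrightarrow> 0) (at x0 within \<Omega>)"
    using q by (intro tendsto_zero_powrI[OF _ tendsto_const]) (auto simp: a_def)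
  from tendsto_mult[OF tendsto_const[of "L powr a"] this]
  have "((\<lambda>x. L powr a * norm (x - x0) powr (a - q)) \<longlongrightarrow> 0) (at x0 within \<Omega>)" by simp
  then show ?thesis by (rule Lim_null_comparison[rotated]) (use bound in \<open>auto intro: always_eventually\<close>)
qed

end

theorem theorem1p1:
  fixes \<Omega> :: "(real ^ 'n) set" and k :: nat
  assumes "CARD('n) \<ge> 2"
    and "open \<Omega>" and "connected \<Omega>" and "\<Omega> \<noteq> {}" and "bounded \<Omega>"
    and "0 < k" and "k < CARD('n)"
  shows "(\<forall>p::real. p \<ge> 1 \<longrightarrow> \<not> (\<exists>u. Dirichlet_subsolution k p \<Omega> u)) \<and>
    (\<forall>p::real. 0 < p \<and> p < 1 \<and> \<Omega> \<in> class_CR \<longrightarrow>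
       (\<exists>U. Dirichlet_solution k p \<Omega> U \<and>
          (\<forall>V. Dirichlet_solution k p \<Omega> V \<longrightarrow> (\<forall>x\<in>closure \<Omega>. V x = U x)) \<and>
          (\<forall>x0\<in>frontier \<Omega>. \<forall>q::real. q < 1 / (1 - p) \<longrightarrow>
             ((\<lambda>x. (U x - U x0) / norm (x - x0) powr q) \<longlongrightarrow> 0) (at x0 within \<Omega>))))"
proof (intro conjI allI impI)
  fix p :: real assume "1 \<le> p"
  then show "\<not> (\<exists>u. Dirichlet_subsolution k p \<Omega> u)"
    using no_Dirichlet_subsolution assms by blast
next
  fix p :: real assume hp: "0 < p \<and> p < 1 \<and> \<Omega> \<in> class_CR"
  then obtain R Y where "0 < R" "\<Omega> = (\<Inter>y\<in>Y. ball y R)" by (auto simp: class_CR_def)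
  then interpret perron \<Omega> k p R Y using assms hp by unfold_locales auto
  have "V x = U x" if "Dirichlet_solution k p \<Omega> V" "x \<in> closure \<Omega>" for V x
    using that U_solution Dirichlet_solution_le[OF op bd k(1) k' p] by (metis antisym)
  then show "\<exists>U. Dirichlet_solution k p \<Omega> U \<and>
      (\<forall>V. Dirichlet_solution k p \<Omega> V \<longrightarrow> (\<forall>x\<in>closure \<Omega>. V x = U x)) \<and>
      (\<forall>x0\<in>frontier \<Omega>. \<forall>q::real. q < 1 / (1 - p) \<longrightarrow>
         ((\<lambda>x. (U x - U x0) / norm (x - x0) powr q) \<longlongrightarrow> 0) (at x0 within \<Omega>))"
    using U_solution U_decay by blast
qed

end
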